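(* Let $A=S(V,N)$ be the $N$-symmetric algebra of $V$, let $M,P$ be $A$-bimodules, and let $q\ge p\ge 0$ be such that $\nu(q-p)=\nu(q)-\nu(p)$. Let $f:\bigwedge^{\nu(p)}V\to P$ be a $k$-linear map and $z=m\otimes(x_1\wedge\cdots\wedge x_{\nu(q)})\in M\otimes\bigwedge^{\nu(q)}V$, where $m\in M$ and $x_1<\cdots<x_{\nu(q)}$ belong to the ordered basis $(e_1,\ldots,e_n)$ of $V$, viewed as a Koszul $p$-cochain and a Koszul $q$-chain via the isomorphisms $\phi_r:\bigwedge^r V\to Ant_r(V^{\otimes r})$. Then the right Koszul cap product, viewed in $(M\otimes_AP)\otimes\bigwedge^{\nu(q-p)}V$, is given by $$z\underset{K}{\frown}f=(-1)^{qp}\sum_{\sigma\in Sh(\nu(p),\nu(q-p))}\mathrm{sgn}(\sigma)\,\bigl(m\otimes_A f(x_{\sigma(1)}\wedge\cdots\wedge x_{\sigma(\nu(p))})\bigr)\otimes(x_{\sigma(\nu(p)+1)}\wedge\cdots\wedge x_{\sigma(\nu(q))}).$$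
   Context: $k$ is a field, $V$ a $k$-vector space of finite dimension $n\ge 2$ with ordered basis $(e_1,\ldots,e_n)$ (with $e_1<\cdots<e_n$), and $N$ is an integer with $2\le N\le n$. Tensor symbols $\otimes$ between elements of $V$ are omitted. For $r\ge1$, $Ant_r:V^{\otimes r}\to V^{\otimes r}$ is the linear map $Ant_r(z)=\sum_{\sigma\in\Sigma_r}\mathrm{sgn}(\sigma)\,\sigma\cdot z$, where $\Sigma_r$ is the group of permutations of $\{1,\ldots,r\}$ and $\sigma\cdot(x_1\ldots x_r)=x_{\sigma^{-1}(1)}\ldots x_{\sigma^{-1}(r)}$; $Ant_0=\mathrm{Id}_k$. There is an isomorphism $\phi_r:\bigwedge^r V\to Ant_r(V^{\otimes r})$, $e_{i_1}\wedge\cdots\wedge e_{i_r}\mapsto Ant_r(e_{i_1}\ldots e_{i_r})$ for $i_1<\cdots<i_r$. The $N$-symmetric algebra is $A=S(V,N)=T(V)/(R)$ with $R=Ant_N(V^{\otimes N})$. Elements of $V$ appearing as factors in bimodules mean their images in $A$. Put $W_r=\bigcap_{i+N+j=r}V^{\otimes i}\otimes R\otimes V^{\otimes j}\subseteq V^{\otimes r}$ (so $W_r=V^{\otimes r}$ for $r<N$). Define $\nu(2p')=Np'$ and $\nu(2p'+1)=Np'+1$. For all $p$ one has $W_{\nu(p)}=Ant_{\nu(p)}(V^{\otimes\nu(p)})$, so Koszul $p$-cochains (linear maps $f:W_{\nu(p)}\to P$) are identified with linear maps $f\circ\phi_{\nu(p)}:\bigwedge^{\nu(p)}V\to P$, denoted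 by the same letter, and Koszul $q$-chains (elements of $M\otimes W_{\nu(q)}$) with elements of $M\otimes\bigwedge^{\nu(q)}V$ via $\mathrm{id}\otimes\phi_{\nu(q)}$. Right Koszul cap product: for a Koszul $p$-cochain $f:W_{\nu(p)}\to P$ and a Koszul $q$-chain written as (a sum of) $z=m\otimes x_1\ldots x_{\nu(q)}\in M\otimes W_{\nu(q)}$ with $q\ge p$, the element $z\underset{K}{\frown}f\in(M\otimes_AP)\otimes W_{\nu(q-p)}$ is defined as follows, $f$ being applied to the indicated tensor positions, using the natural inclusions $W_{\nu(q)}\subseteq V^{\otimes i}\otimes W_{\nu(p)}\otimes V^{\otimes l}\otimes W_{\nu(q-p)}\otimes V^{\otimes j}$. (1) If $p$ and $q-p$ are not both odd (so $\nu(q-p)=\nu(q)-\nu(p)$): $z\underset{K}{\frown}f=(-1)^{pq}(m\otimes_Af(x_1\ldots x_{\nu(p)}))\otimes x_{\nu(p)+1}\ldots x_{\nu(q)}$. (2) If $p$ is odd and $q$ is even (so $\nu(q-p)=\nu(q)-\nu(p)-N+2$): $z\underset{K}{\frown}f=\sum_{0\le i+j\le N-2}\bigl(x_{\nu(q)-j+1}\ldots x_{\nu(q)}\,m\,x_1\ldots x_i\otimes_Af(x_{i+1}\ldots x_{i+\nu(p)})\,x_{i+\nu(p)+1}\ldots x_{\nu(p)+N-j-2}\bigr)\otimes x_{\nu(p)+N-j-1}\ldots x_{\nu(q)-j}$, the sum being over $i,j\ge0$. $Sh(a,b)$ denotes the set of $(a,b)$-shuffles: permutations $\sigma$ of $\{1,\ldots,a+b\}$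 with $\sigma(1)<\cdots<\sigma(a)$ and $\sigma(a+1)<\cdots<\sigma(a+b)$. *)

theory Defs
  imports
    Complex_Main
    "HOL-Combinatorics.Permutations"
    "HOL-Library.Poly_Mapping"
    "HOL-Library.FuncSet"
    "HOL-Algebra.QuotRing"
    "HOL-Algebra.Module"
begin

section \<open>Linear algebra over the records of HOL-Algebra\<close>

text \<open>The ground field is a type \<open>'k :: field\<close>. Vector spaces and (not necessarily
  commutative) algebras over it are values of the record type \<open>('k, 'a) module\<close>, whose fields
  \<open>mult\<close> and \<open>one\<close> carry no information when only a vector space is meant. A subspace
  \<open>W\<close> of \<open>X\<close> is turned into a vector space by \<open>X\<lparr>carrier := W\<rparr>\<close>.\<close>

definition scalar_ring :: "'k::field ring" where
  "scalar_ring = \<lparr>carrier = UNIV, mult = (*), one = 1, zero = 0, add = (+)\<rparr>"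

definition linear_span :: "('k::field, 'a, 'z) module_scheme \<Rightarrow> 'a set \<Rightarrow> 'a set" where
  "linear_span X S = \<Inter>{H. submodule H scalar_ring X \<and> S \<subseteq> H}"

definition linear_maps ::
    "('k, 'a, 'y) module_scheme \<Rightarrow> ('k, 'b, 'z) module_scheme \<Rightarrow> ('a \<Rightarrow> 'b) set" where
  "linear_maps X Y = {g \<in> hom (add_monoid X) (add_monoid Y).
     \<forall>c. \<forall>x\<in>carrier X. g (c \<odot>\<^bsub>X\<^esub> x) = c \<odot>\<^bsub>Y\<^esub> g x}"

text \<open>The linear map \<open>X \<rightarrow> Y\<close> determined by a prescription \<open>S\<close>, typically of its values on
  generators. It is arbitrary unless there is exactly one such map.\<close>

definition the_linear_map ::
    "('k, 'a, 'y) module_scheme \<Rightarrow> ('k, 'b, 'z) module_scheme \<Rightarrow> (('a \<Rightarrow> 'b) \<Rightarrow> bool) \<Rightarrow> 'a \<Rightarrow> 'b" where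
  "the_linear_map X Y S = (THE g. g \<in> linear_maps X Y \<and> g \<in> extensional (carrier X) \<and> S g)"

definition quotient_space :: "('k, 'a, 'z) module_scheme \<Rightarrow> 'a set \<Rightarrow> ('k, 'a set) module" where
  "quotient_space X I =
     \<lparr>carrier = carrier (X Quot I), mult = (\<otimes>\<^bsub>X Quot I\<^esub>), one = one (X Quot I),
      zero = zero (X Quot I), add = add (X Quot I),
      smult = (\<lambda>c C. \<Union>x\<in>C. I +>\<^bsub>X\<^esub> (c \<odot>\<^bsub>X\<^esub> x))\<rparr>"

definition list_product :: "('a, 'z) monoid_scheme \<Rightarrow> 'a list \<Rightarrow> 'a" where
  "list_product A xs = foldr (\<otimes>\<^bsub>A\<^esub>) xs (one A)"

definition free_space :: "'a set \<Rightarrow> ('k::field, 'a \<Rightarrow>\<^sub>0 'k) module" where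
  "free_space B =
     \<lparr>carrier = {p. Poly_Mapping.keys p \<subseteq> B}, mult = undefined, one = undefined, zero = 0, add = (+),
      smult = (\<lambda>c. Poly_Mapping.map ((*) c))\<rparr>"


section \<open>Bimodules and tensor products\<close>

record ('k, 'a, 'm) bimodule = "('k, 'm) module" +
  lact :: "'a \<Rightarrow> 'm \<Rightarrow> 'm"
  ract :: "'m \<Rightarrow> 'a \<Rightarrow> 'm"

text \<open>Bimodules over a \<open>k\<close>-algebra: the two induced actions of \<open>k\<close> agree.\<close>

locale algebra_bimodule = M: module scalar_ring M
  for A :: "('k::field, 'a) module" and M :: "('k, 'a, 'm) bimodule" +
  assumes lact_closed: "a \<in> carrier A \<Longrightarrow> x \<in> carrier M \<Longrightarrow> lact M a x \<in> carrier M"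
    and lact_add_left: "a \<in> carrier A \<Longrightarrow> b \<in> carrier A \<Longrightarrow> x \<in> carrier M \<Longrightarrow>
      lact M (a \<oplus>\<^bsub>A\<^esub> b) x = lact M a x \<oplus>\<^bsub>M\<^esub> lact M b x"
    and lact_add_right: "a \<in> carrier A \<Longrightarrow> x \<in> carrier M \<Longrightarrow> y \<in> carrier M \<Longrightarrow>
      lact M a (x \<oplus>\<^bsub>M\<^esub> y) = lact M a x \<oplus>\<^bsub>M\<^esub> lact M a y"
    and lact_mult: "a \<in> carrier A \<Longrightarrow> b \<in> carrier A \<Longrightarrow> x \<in> carrier M \<Longrightarrow>
      lact M (a \<otimes>\<^bsub>A\<^esub> b) x = lact M a (lact M b x)"
    and lact_scalar: "x \<in> carrier M \<Longrightarrow> lact M (c \<odot>\<^bsub>A\<^esub> \<one>\<^bsub>A\<^esub>) x = c \<odot>\<^bsub>M\<^esub> x"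
    and ract_closed: "a \<in> carrier A \<Longrightarrow> x \<in> carrier M \<Longrightarrow> ract M x a \<in> carrier M"
    and ract_add_right: "a \<in> carrier A \<Longrightarrow> b \<in> carrier A \<Longrightarrow> x \<in> carrier M \<Longrightarrow>
      ract M x (a \<oplus>\<^bsub>A\<^esub> b) = ract M x a \<oplus>\<^bsub>M\<^esub> ract M x b"
    and ract_add_left: "a \<in> carrier A \<Longrightarrow> x \<in> carrier M \<Longrightarrow> y \<in> carrier M \<Longrightarrow>
      ract M (x \<oplus>\<^bsub>M\<^esub> y) a = ract M x a \<oplus>\<^bsub>M\<^esub> ract M y a"
    and ract_mult: "a \<in> carrier A \<Longrightarrow> b \<in> carrier A \<Longrightarrow> x \<in> carrier M \<Longrightarrow>
      ract M x (a \<otimes>\<^bsub>A\<^esub> b) = ract M (ract M x a) b"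
    and ract_scalar: "x \<in> carrier M \<Longrightarrow> ract M x (c \<odot>\<^bsub>A\<^esub> \<one>\<^bsub>A\<^esub>) = c \<odot>\<^bsub>M\<^esub> x"
    and lact_ract: "a \<in> carrier A \<Longrightarrow> b \<in> carrier A \<Longrightarrow> x \<in> carrier M \<Longrightarrow>
      lact M a (ract M x b) = ract M (lact M a x) b"

definition bilinear_relations ::
    "('k::field, 'a, 'y) module_scheme \<Rightarrow> ('k, 'b, 'z) module_scheme \<Rightarrow> ('a \<times> 'b \<Rightarrow>\<^sub>0 'k) set" where
  "bilinear_relations X Y =
     {Poly_Mapping.single (x \<oplus>\<^bsub>X\<^esub> x', y) 1 - Poly_Mapping.single (x, y) 1
        - Poly_Mapping.single (x', y) 1 | x x' y.
        x \<in> carrier X \<and> x' \<in> carrier X \<and> y \<in> carrier Y} \<union>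
     {Poly_Mapping.single (x, y \<oplus>\<^bsub>Y\<^esub> y') 1 - Poly_Mapping.single (x, y) 1
        - Poly_Mapping.single (x, y') 1 | x y y'.
        x \<in> carrier X \<and> y \<in> carrier Y \<and> y' \<in> carrier Y} \<union>
     {Poly_Mapping.single (c \<odot>\<^bsub>X\<^esub> x, y) 1 - Poly_Mapping.single (x, y) c | c x y.
        x \<in> carrier X \<and> y \<in> carrier Y} \<union>
     {Poly_Mapping.single (x, c \<odot>\<^bsub>Y\<^esub> y) 1 - Poly_Mapping.single (x, y) c | c x y.
        x \<in> carrier X \<and> y \<in> carrier Y}"

definition balanced_relations ::
    "('k::field, 'a) module \<Rightarrow> ('k, 'a, 'm) bimodule \<Rightarrow> ('k, 'a, 'p) bimodule \<Rightarrow> ('m \<times> 'p \<Rightarrow>\<^sub>0 'k) set" where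
  "balanced_relations A M P =
     {Poly_Mapping.single (ract M x a, y) 1 - Poly_Mapping.single (x, lact P a y) 1 | x a y.
        x \<in> carrier M \<and> a \<in> carrier A \<and> y \<in> carrier P}"

definition tensor_kernel ::
    "('k::field, 'a, 'y) module_scheme \<Rightarrow> ('k, 'b, 'z) module_scheme \<Rightarrow> ('a \<times> 'b \<Rightarrow>\<^sub>0 'k) set" where
  "tensor_kernel X Y =
     linear_span (free_space (carrier X \<times> carrier Y)) (bilinear_relations X Y)"

definition tensor_product ::
    "('k::field, 'a, 'y) module_scheme \<Rightarrow> ('k, 'b, 'z) module_scheme
      \<Rightarrow> ('k, ('a \<times> 'b \<Rightarrow>\<^sub>0 'k) set) module" where
  "tensor_product X Y = quotient_space (free_space (carrier X \<times> carrier Y)) (tensor_kernel X Y)"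

definition pure_tensor ::
    "('k::field, 'a, 'y) module_scheme \<Rightarrow> ('k, 'b, 'z) module_scheme \<Rightarrow> 'a \<Rightarrow> 'b
      \<Rightarrow> ('a \<times> 'b \<Rightarrow>\<^sub>0 'k) set" where
  "pure_tensor X Y x y =
     tensor_kernel X Y +>\<^bsub>free_space (carrier X \<times> carrier Y)\<^esub> Poly_Mapping.single (x, y) 1"

definition id_tensor_map ::
    "('k::field, 'a, 'x) module_scheme \<Rightarrow> ('k, 'b, 'y) module_scheme \<Rightarrow> ('k, 'c, 'z) module_scheme
      \<Rightarrow> ('b \<Rightarrow> 'c) \<Rightarrow> ('a \<times> 'b \<Rightarrow>\<^sub>0 'k) set \<Rightarrow> ('a \<times> 'c \<Rightarrow>\<^sub>0 'k) set" where
  "id_tensor_map X Y Z h =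
     the_linear_map (tensor_product X Y) (tensor_product X Z)
       (\<lambda>g. \<forall>x\<in>carrier X. \<forall>y\<in>carrier Y. g (pure_tensor X Y x y) = pure_tensor X Z x (h y))"

definition tensor_kernel_over ::
    "('k::field, 'a) module \<Rightarrow> ('k, 'a, 'm) bimodule \<Rightarrow> ('k, 'a, 'p) bimodule \<Rightarrow> ('m \<times> 'p \<Rightarrow>\<^sub>0 'k) set" where
  "tensor_kernel_over A M P =
     linear_span (free_space (carrier M \<times> carrier P))
       (bilinear_relations M P \<union> balanced_relations A M P)"

definition tensor_product_over ::
    "('k::field, 'a) module \<Rightarrow> ('k, 'a, 'm) bimodule \<Rightarrow> ('k, 'a, 'p) bimodule
      \<Rightarrow> ('k, ('m \<times> 'p \<Rightarrow>\<^sub>0 'k) set) module" where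
  "tensor_product_over A M P =
     quotient_space (free_space (carrier M \<times> carrier P)) (tensor_kernel_over A M P)"

definition pure_tensor_over ::
    "('k::field, 'a) module \<Rightarrow> ('k, 'a, 'm) bimodule \<Rightarrow> ('k, 'a, 'p) bimodule
      \<Rightarrow> 'm \<Rightarrow> 'p \<Rightarrow> ('m \<times> 'p \<Rightarrow>\<^sub>0 'k) set" where
  "pure_tensor_over A M P x y =
     tensor_kernel_over A M P +>\<^bsub>free_space (carrier M \<times> carrier P)\<^esub> Poly_Mapping.single (x, y) 1"


section \<open>The tensor algebra and the exterior algebra\<close>

text \<open>Words under concatenation, written additively so that \<open>'v word \<Rightarrow>\<^sub>0 'k\<close> is the free
  associative \<open>k\<close>-algebra on the letters \<open>'v\<close>, with the convolution product of the library.\<close>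

datatype 'v word = Word (letters: "'v list")

instantiation word :: (type) monoid_add
begin

definition zero_word :: "'a word" where "0 = Word []"

definition plus_word :: "'a word \<Rightarrow> 'a word \<Rightarrow> 'a word" where
  "u + w = Word (letters u @ letters w)"

instance
  by standard (simp_all add: zero_word_def plus_word_def)

end

definition free_algebra :: "('k::field, 'v word \<Rightarrow>\<^sub>0 'k) module" where
  "free_algebra =
     \<lparr>carrier = UNIV, mult = (*), one = 1, zero = 0, add = (+),
      smult = (\<lambda>c. Poly_Mapping.map ((*) c))\<rparr>"

type_synonym ('k, 'v) tensor = "('v word \<Rightarrow>\<^sub>0 'k) set"

definition linearity_ideal :: "('k::field \<Rightarrow> 'v::ab_group_add \<Rightarrow> 'v) \<Rightarrow> ('k, 'v) tensor" where
  "linearity_ideal scale = genideal free_algebra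
     ({Poly_Mapping.single (Word [v + w]) 1 - Poly_Mapping.single (Word [v]) 1
         - Poly_Mapping.single (Word [w]) 1 | v w. True} \<union>
      {Poly_Mapping.single (Word [scale c v]) 1 - Poly_Mapping.single (Word [v]) c | c v. True})"

definition tensor_algebra ::
    "('k::field \<Rightarrow> 'v::ab_group_add \<Rightarrow> 'v) \<Rightarrow> ('k, ('k, 'v) tensor) module" where
  "tensor_algebra scale = quotient_space free_algebra (linearity_ideal scale)"

definition tensor_letter :: "('k::field \<Rightarrow> 'v::ab_group_add \<Rightarrow> 'v) \<Rightarrow> 'v \<Rightarrow> ('k, 'v) tensor" where
  "tensor_letter scale v =
     linearity_ideal scale +>\<^bsub>free_algebra\<^esub> Poly_Mapping.single (Word [v]) 1"

text \<open>\<open>tensor_word scale [v\<^sub>1, \<dots>, v\<^sub>r]\<close> is the tensor \<open>v\<^sub>1 \<dots> v\<^sub>r\<close>; the tensor power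
  \<open>V\<^sup>\<otimes>\<^sup>r\<close> is the component of degree \<open>r\<close> of the tensor algebra, so that for subspaces of tensor
  powers \<open>X \<otimes> Y\<close> is the span of the products.\<close>

definition tensor_word :: "('k::field \<Rightarrow> 'v::ab_group_add \<Rightarrow> 'v) \<Rightarrow> 'v list \<Rightarrow> ('k, 'v) tensor" where
  "tensor_word scale vs = list_product (tensor_algebra scale) (map (tensor_letter scale) vs)"

definition tensor_power :: "('k::field \<Rightarrow> 'v::ab_group_add \<Rightarrow> 'v) \<Rightarrow> nat \<Rightarrow> ('k, 'v) tensor set" where
  "tensor_power scale r =
     linear_span (tensor_algebra scale) {tensor_word scale vs | vs. length vs = r}"

definition exterior_ideal ::
    "('k::field \<Rightarrow> 'v::ab_group_add \<Rightarrow> 'v) \<Rightarrow> ('k, 'v) tensor set" where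
  "exterior_ideal scale =
     genideal (tensor_algebra scale) {tensor_word scale [v, v] | v. True}"

definition exterior_algebra ::
    "('k::field \<Rightarrow> 'v::ab_group_add \<Rightarrow> 'v) \<Rightarrow> ('k, ('k, 'v) tensor set) module" where
  "exterior_algebra scale = quotient_space (tensor_algebra scale) (exterior_ideal scale)"

definition wedge :: "('k::field \<Rightarrow> 'v::ab_group_add \<Rightarrow> 'v) \<Rightarrow> 'v list \<Rightarrow> ('k, 'v) tensor set" where
  "wedge scale vs = list_product (exterior_algebra scale)
     (map (\<lambda>v. exterior_ideal scale +>\<^bsub>tensor_algebra scale\<^esub> tensor_letter scale v) vs)"

definition exterior_power ::
    "('k::field \<Rightarrow> 'v::ab_group_add \<Rightarrow> 'v) \<Rightarrow> nat \<Rightarrow> ('k, ('k, 'v) tensor set) module" where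
  "exterior_power scale r = (exterior_algebra scale)
     \<lparr>carrier := linear_span (exterior_algebra scale) {wedge scale vs | vs. length vs = r}\<rparr>"

text \<open>\<open>inv_into UNIV \<sigma>\<close> is \<open>\<sigma>\<^sup>-\<^sup>1\<close>; lists are indexed from \<open>0\<close>, tensor positions from \<open>1\<close>.\<close>

definition permute_tensor ::
    "('k::field \<Rightarrow> 'v::ab_group_add \<Rightarrow> 'v) \<Rightarrow> nat \<Rightarrow> (nat \<Rightarrow> nat) \<Rightarrow> ('k, 'v) tensor \<Rightarrow> ('k, 'v) tensor" where
  "permute_tensor scale r \<sigma> =
     the_linear_map ((tensor_algebra scale)\<lparr>carrier := tensor_power scale r\<rparr>)
       ((tensor_algebra scale)\<lparr>carrier := tensor_power scale r\<rparr>)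
       (\<lambda>g. \<forall>vs. length vs = r \<longrightarrow>
          g (tensor_word scale vs)
            = tensor_word scale (map (\<lambda>i. vs ! (inv_into UNIV \<sigma> i - 1)) [1..<Suc r]))"

definition Ant ::
    "('k::field \<Rightarrow> 'v::ab_group_add \<Rightarrow> 'v) \<Rightarrow> nat \<Rightarrow> ('k, 'v) tensor \<Rightarrow> ('k, 'v) tensor" where
  "Ant scale r z =
     (\<Oplus>\<^bsub>tensor_algebra scale\<^esub> \<sigma> \<in> {\<sigma>. \<sigma> permutes {1..r}}.
        of_int (sign \<sigma>) \<odot>\<^bsub>tensor_algebra scale\<^esub> permute_tensor scale r \<sigma> z)"

text \<open>The isomorphism \<open>\<phi>\<^sub>r\<close>, for the ordered basis \<open>e 1, \<dots>, e n\<close>.\<close>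

definition ext_to_Ant ::
    "('k::field \<Rightarrow> 'v::ab_group_add \<Rightarrow> 'v) \<Rightarrow> nat \<Rightarrow> (nat \<Rightarrow> 'v) \<Rightarrow> nat
      \<Rightarrow> ('k, 'v) tensor set \<Rightarrow> ('k, 'v) tensor" where
  "ext_to_Ant scale n e r =
     the_linear_map (exterior_power scale r)
       ((tensor_algebra scale)\<lparr>carrier := Ant scale r ` tensor_power scale r\<rparr>)
       (\<lambda>g. \<forall>s. strict_mono_on {1..r} s \<and> s ` {1..r} \<subseteq> {1..n} \<longrightarrow>
          g (wedge scale (map (\<lambda>j. e (s j)) [1..<Suc r]))
            = Ant scale r (tensor_word scale (map (\<lambda>j. e (s j)) [1..<Suc r])))"


section \<open>The N-symmetric algebra and the Koszul cap product\<close>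

definition sym_relations ::
    "('k::field \<Rightarrow> 'v::ab_group_add \<Rightarrow> 'v) \<Rightarrow> nat \<Rightarrow> ('k, 'v) tensor set" where
  "sym_relations scale N = Ant scale N ` tensor_power scale N"

definition sym_ideal :: "('k::field \<Rightarrow> 'v::ab_group_add \<Rightarrow> 'v) \<Rightarrow> nat \<Rightarrow> ('k, 'v) tensor set" where
  "sym_ideal scale N = genideal (tensor_algebra scale) (sym_relations scale N)"

definition sym_algebra ::
    "('k::field \<Rightarrow> 'v::ab_group_add \<Rightarrow> 'v) \<Rightarrow> nat \<Rightarrow> ('k, ('k, 'v) tensor set) module" where
  "sym_algebra scale N = quotient_space (tensor_algebra scale) (sym_ideal scale N)"

definition to_sym ::
    "('k::field \<Rightarrow> 'v::ab_group_add \<Rightarrow> 'v) \<Rightarrow> nat \<Rightarrow> ('k, 'v) tensor \<Rightarrow> ('k, 'v) tensor set" where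
  "to_sym scale N t = sym_ideal scale N +>\<^bsub>tensor_algebra scale\<^esub> t"

definition koszul_W ::
    "('k::field \<Rightarrow> 'v::ab_group_add \<Rightarrow> 'v) \<Rightarrow> nat \<Rightarrow> nat \<Rightarrow> ('k, 'v) tensor set" where
  "koszul_W scale N r = tensor_power scale r \<inter>
     (\<Inter>(i, j)\<in>{(i, j). i + N + j = r}.
        linear_span (tensor_algebra scale)
          {a \<otimes>\<^bsub>tensor_algebra scale\<^esub> b \<otimes>\<^bsub>tensor_algebra scale\<^esub> c | a b c.
             a \<in> tensor_power scale i \<and> b \<in> sym_relations scale N \<and> c \<in> tensor_power scale j})"

definition koszul_space ::
    "('k::field \<Rightarrow> 'v::ab_group_add \<Rightarrow> 'v) \<Rightarrow> nat \<Rightarrow> nat \<Rightarrow> ('k, ('k, 'v) tensor) module" where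
  "koszul_space scale N r = (tensor_algebra scale)\<lparr>carrier := koszul_W scale N r\<rparr>"

definition nu :: "nat \<Rightarrow> nat \<Rightarrow> nat" where
  "nu N p = (if even p then N * (p div 2) else N * (p div 2) + 1)"

type_synonym ('k, 'v, 'm) sym_bimodule = "('k, ('k, 'v) tensor set, 'm) bimodule"

text \<open>For a fixed \<open>m\<close>, the map
  \<open>V\<^sup>\<otimes>\<^sup>i \<otimes> W\<^sub>\<nu>\<^sub>(\<^sub>p\<^sub>) \<otimes> V\<^sup>\<otimes>\<^sup>l \<otimes> W\<^sub>\<nu>\<^sub>(\<^sub>q\<^sub>-\<^sub>p\<^sub>) \<otimes> V\<^sup>\<otimes>\<^sup>j \<rightarrow> (M \<otimes>\<^sub>A P) \<otimes> W\<^sub>\<nu>\<^sub>(\<^sub>q\<^sub>-\<^sub>p\<^sub>)\<close>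
  sending \<open>a b c d h\<close> to \<open>(h m a \<otimes>\<^sub>A f(b) c) \<otimes> d\<close>.\<close>

definition cap_on_words ::
    "('k::field \<Rightarrow> 'v::ab_group_add \<Rightarrow> 'v) \<Rightarrow> nat \<Rightarrow> ('k, 'v, 'm) sym_bimodule \<Rightarrow> ('k, 'v, 'p) sym_bimodule
      \<Rightarrow> nat \<Rightarrow> nat \<Rightarrow> nat \<Rightarrow> nat \<Rightarrow> nat \<Rightarrow> (('k, 'v) tensor \<Rightarrow> 'p) \<Rightarrow> 'm \<Rightarrow> ('k, 'v) tensor
      \<Rightarrow> (('m \<times> 'p \<Rightarrow>\<^sub>0 'k) set \<times> ('k, 'v) tensor \<Rightarrow>\<^sub>0 'k) set" where
  "cap_on_words scale N M P p q i l j f m =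
    (let T = tensor_algebra scale; A = sym_algebra scale N; \<pi> = to_sym scale N;
         V = tensor_power scale;
         W = koszul_W scale N (nu N p); W' = koszul_W scale N (nu N (q - p));
         MP = tensor_product_over A M P
     in the_linear_map
          (T\<lparr>carrier := linear_span T
               {a \<otimes>\<^bsub>T\<^esub> b \<otimes>\<^bsub>T\<^esub> c \<otimes>\<^bsub>T\<^esub> d \<otimes>\<^bsub>T\<^esub> h | a b c d h.
                  a \<in> V i \<and> b \<in> W \<and> c \<in> V l \<and> d \<in> W' \<and> h \<in> V j}\<rparr>)
          (tensor_product MP (koszul_space scale N (nu N (q - p))))
          (\<lambda>g. \<forall>a\<in>V i. \<forall>b\<in>W. \<forall>c\<in>V l. \<forall>d\<in>W'. \<forall>h\<in>V j.
             g (a \<otimes>\<^bsub>T\<^esub> b \<otimes>\<^bsub>T\<^esub> c \<otimes>\<^bsub>T\<^esub> d \<otimes>\<^bsub>T\<^esub> h)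
               = pure_tensor MP (koszul_space scale N (nu N (q - p)))
                   (pure_tensor_over A M P (ract M (lact M (\<pi> h) m) (\<pi> a)) (ract P (f b) (\<pi> c)))
                   d))"

definition cap_term ::
    "('k::field \<Rightarrow> 'v::ab_group_add \<Rightarrow> 'v) \<Rightarrow> nat \<Rightarrow> ('k, 'v, 'm) sym_bimodule \<Rightarrow> ('k, 'v, 'p) sym_bimodule
      \<Rightarrow> nat \<Rightarrow> nat \<Rightarrow> nat \<Rightarrow> nat \<Rightarrow> nat \<Rightarrow> (('k, 'v) tensor \<Rightarrow> 'p) \<Rightarrow> ('m \<times> ('k, 'v) tensor \<Rightarrow>\<^sub>0 'k) set
      \<Rightarrow> (('m \<times> 'p \<Rightarrow>\<^sub>0 'k) set \<times> ('k, 'v) tensor \<Rightarrow>\<^sub>0 'k) set" where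
  "cap_term scale N M P p q i l j f =
     the_linear_map (tensor_product M (koszul_space scale N (nu N q)))
       (tensor_product (tensor_product_over (sym_algebra scale N) M P)
          (koszul_space scale N (nu N (q - p))))
       (\<lambda>g. \<forall>m\<in>carrier M. \<forall>w\<in>koszul_W scale N (nu N q).
          g (pure_tensor M (koszul_space scale N (nu N q)) m w)
            = cap_on_words scale N M P p q i l j f m w)"

text \<open>The right Koszul cap product of a \<open>q\<close>-chain \<open>z\<close> with a \<open>p\<close>-cochain \<open>f\<close> on \<open>W\<^sub>\<nu>\<^sub>(\<^sub>p\<^sub>)\<close>,
  for \<open>p \<le> q\<close>.\<close>

definition koszul_cap ::
    "('k::field \<Rightarrow> 'v::ab_group_add \<Rightarrow> 'v) \<Rightarrow> nat \<Rightarrow> ('k, 'v, 'm) sym_bimodule \<Rightarrow> ('k, 'v, 'p) sym_bimodule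
      \<Rightarrow> nat \<Rightarrow> nat \<Rightarrow> ('m \<times> ('k, 'v) tensor \<Rightarrow>\<^sub>0 'k) set \<Rightarrow> (('k, 'v) tensor \<Rightarrow> 'p)
      \<Rightarrow> (('m \<times> 'p \<Rightarrow>\<^sub>0 'k) set \<times> ('k, 'v) tensor \<Rightarrow>\<^sub>0 'k) set" where
  "koszul_cap scale N M P p q z f =
    (let C = tensor_product (tensor_product_over (sym_algebra scale N) M P)
               (koszul_space scale N (nu N (q - p)))
     in if odd p \<and> odd (q - p)
        then (\<Oplus>\<^bsub>C\<^esub> i \<in> {..N - 2}. \<Oplus>\<^bsub>C\<^esub> j \<in> {..N - 2 - i}.
               cap_term scale N M P p q i (N - 2 - i - j) j f z)
        else (- 1) ^ (p * q) \<odot>\<^bsub>C\<^esub> cap_term scale N M P p q 0 0 0 f z)"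

text \<open>The same product with chains, cochains and values transported to exterior powers by
  \<open>\<phi>\<close> and \<open>id \<otimes> \<phi>\<close>.\<close>

definition koszul_cap_ext ::
    "('k::field \<Rightarrow> 'v::ab_group_add \<Rightarrow> 'v) \<Rightarrow> nat \<Rightarrow> nat \<Rightarrow> (nat \<Rightarrow> 'v)
      \<Rightarrow> ('k, 'v, 'm) sym_bimodule \<Rightarrow> ('k, 'v, 'p) sym_bimodule
      \<Rightarrow> nat \<Rightarrow> nat \<Rightarrow> ('m \<times> ('k, 'v) tensor set \<Rightarrow>\<^sub>0 'k) set \<Rightarrow> (('k, 'v) tensor set \<Rightarrow> 'p)
      \<Rightarrow> (('m \<times> 'p \<Rightarrow>\<^sub>0 'k) set \<times> ('k, 'v) tensor set \<Rightarrow>\<^sub>0 'k) set" where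
  "koszul_cap_ext scale N n e M P p q z f =
    (let E = exterior_power scale; W = koszul_space scale N; \<phi> = ext_to_Ant scale n e;
         MP = tensor_product_over (sym_algebra scale N) M P
     in inv_into (carrier (tensor_product MP (E (nu N (q - p)))))
          (id_tensor_map MP (E (nu N (q - p))) (W (nu N (q - p))) (\<phi> (nu N (q - p))))
          (koszul_cap scale N M P p q
             (id_tensor_map M (E (nu N q)) (W (nu N q)) (\<phi> (nu N q)) z)
             (\<lambda>w. f (inv_into (carrier (E (nu N p))) (\<phi> (nu N p)) w))))"

definition shuffle_perms :: "nat \<Rightarrow> nat \<Rightarrow> (nat \<Rightarrow> nat) set" where
  "shuffle_perms a b =
     {\<sigma>. \<sigma> permutes {1..a + b} \<and> strict_mono_on {1..a} \<sigma> \<and> strict_mono_on {a + 1..a + b} \<sigma>}"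

end

theory Submission
  imports Defs
begin

text \<open>The formula is the Laplace expansion of an antisymmetrized word along two complementary blocks of
  positions. By \<open>Ant_shuffle\<close>, \<open>Ant\<^sub>a\<^sub>+\<^sub>b (v\<^sub>1 \<dots> v\<^sub>a\<^sub>+\<^sub>b)\<close> is the sum over the shuffles \<open>\<tau>\<close> of
  \<open>sgn \<tau> Ant\<^sub>a (v\<^sub>\<tau>\<^sub>1 \<dots> v\<^sub>\<tau>\<^sub>a) Ant\<^sub>b (v\<^sub>\<tau>\<^sub>a\<^sub>+\<^sub>1 \<dots> v\<^sub>\<tau>\<^sub>a\<^sub>+\<^sub>b)\<close>, because the shuffles represent the cosets of
  \<open>\<Sigma>\<^sub>a \<times> \<Sigma>\<^sub>b\<close> in \<open>\<Sigma>\<^sub>a\<^sub>+\<^sub>b\<close>. With \<open>a = \<nu>(p)\<close> and \<open>b = \<nu>(q - p)\<close> the chain \<open>m \<otimes> \<phi>(x\<^sub>1 \<and> \<dots>)\<close> is the left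
  side, the cochain \<open>f \<circ> \<phi>\<^sup>-\<^sup>1\<close> is evaluated on the first factor of each summand, and the second
  factor is \<open>\<phi>\<close> of the complementary wedge. When \<open>p\<close> and \<open>q - p\<close> are both odd, additivity of \<open>\<nu>\<close>
  forces \<open>N = 2\<close>, so the second formula for the cap product has the single term \<open>i = j = 0\<close> and
  the first and the second formula agree (\<open>nu_additive_odd\<close>).

  Everything in the definitions is described as the unique linear map with prescribed values, so most
  of the work consists in showing that these maps exist. Three facts carry it.

  The spaces \<open>W\<^sub>\<nu>\<^sub>(\<^sub>p\<^sub>)\<close> are the images of \<open>Ant\<close> (\<open>koszul_W_eq_Ant\<close>), so \<open>f \<circ> \<phi>\<^sup>-\<^sup>1\<close> is
  linear on the whole of \<open>W\<^sub>\<nu>\<^sub>(\<^sub>p\<^sub>)\<close>. A tensor whose coordinates alternate in every window of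
  length \<open>N \<ge> 2\<close> alternates in all positions, since every neighbouring transposition takes place
  inside a window; and an alternating tensor is the combination of the antisymmetrized increasing
  words with its own coordinates as coefficients.

  The map sending an increasing word in the basis to its wedge and all other words in the basis to
  zero is a left inverse of \<open>\<phi>\<close> defined on all tensors (\<open>increasing_part_phi\<close>). It involves no
  division by factorials, hence works in any characteristic. It extends the maps on \<open>W\<close> to
  bilinear maps on tensor powers, from which linear maps on \<open>V\<^sup>\<otimes>\<^sup>(\<^sup>a\<^sup>+\<^sup>b\<^sup>)\<close> are obtained
  (\<open>tensor_split_lift\<close>), and it shows that \<open>id \<otimes> \<phi>\<close> is injective.

  The tensor and exterior algebras and the tensor products have their universal properties
  (\<open>tensor_algebra_lift\<close>, \<open>exterior_algebra_lift\<close>, \<open>tensor_product_lift\<close>).\<close>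

section \<open>Vector spaces as records\<close>

lemma scalar_ring_simps [simp]:
  "carrier scalar_ring = UNIV" "monoid.mult scalar_ring = (*)" "one scalar_ring = 1"
  "zero scalar_ring = 0" "add scalar_ring = (+)"
  by (simp_all add: scalar_ring_def)

lemma cring_scalar_ring: "cring (scalar_ring :: 'k::field ring)"
proof (rule cringI)
  show "abelian_group (scalar_ring :: 'k ring)"
  proof (rule abelian_groupI)
    show "\<exists>y\<in>carrier scalar_ring. y \<oplus>\<^bsub>scalar_ring\<^esub> x = \<zero>\<^bsub>scalar_ring\<^esub>" for x :: 'k
      by (rule bexI[of _ "- x"]) simp_all
  qed (auto simp: algebra_simps)
  show "comm_monoid (scalar_ring :: 'k ring)"
    by (rule comm_monoidI) (auto simp: algebra_simps)
qed (auto simp: algebra_simps)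

text \<open>The scalars are a whole type, so the module laws are restated without membership conditions on
  them.\<close>

locale kspace = module scalar_ring X for X :: "('k::field, 'a, 'z) module_scheme" (structure)
begin

lemma smult_in [simp, intro]: "x \<in> carrier X \<Longrightarrow> c \<odot> x \<in> carrier X"
  using smult_closed by simp

lemma smult_add_left: "x \<in> carrier X \<Longrightarrow> (a + b) \<odot> x = a \<odot> x \<oplus> b \<odot> x"
  using smult_l_distr[of a b x] by simp

lemma smult_add_right: "x \<in> carrier X \<Longrightarrow> y \<in> carrier X \<Longrightarrow> a \<odot> (x \<oplus> y) = a \<odot> x \<oplus> a \<odot> y"
  using smult_r_distr by simp

lemma smult_smult: "x \<in> carrier X \<Longrightarrow> a \<odot> (b \<odot> x) = (a * b) \<odot> x"
  using smult_assoc1[of a b x] by simp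

lemma one_smult [simp]: "x \<in> carrier X \<Longrightarrow> 1 \<odot> x = x"
  using smult_one by simp

lemma zero_smult [simp]: "x \<in> carrier X \<Longrightarrow> 0 \<odot> x = \<zero>"
  using smult_l_null by simp

lemma smult_zero [simp]: "c \<odot> \<zero> = \<zero>"
  using smult_r_null by simp

lemma minus_one_smult: "x \<in> carrier X \<Longrightarrow> (- 1) \<odot> x = \<ominus> x"
  using smult_add_left[of x "-1" 1] by (simp add: minus_equality[symmetric])

lemma sum_minus_terms:
  "u \<in> carrier X \<Longrightarrow> v \<in> carrier X \<Longrightarrow> (u \<oplus> v) \<ominus> u \<ominus> v = \<zero>"
  by (metis a_inv_closed a_assoc a_comm a_closed a_minus_def r_neg r_neg2)

lemma smult_finsum:
  "f \<in> A \<rightarrow> carrier X \<Longrightarrow> c \<odot> (\<Oplus>i\<in>A. f i) = (\<Oplus>i\<in>A. c \<odot> f i)"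
  by (cases "finite A") (simp_all add: finsum_smult_ldistr finsum_infinite)

lemma subspaceI:
  assumes "H \<subseteq> carrier X" "\<zero> \<in> H" "\<And>a b. a \<in> H \<Longrightarrow> b \<in> H \<Longrightarrow> a \<oplus> b \<in> H"
    and smult: "\<And>c a. a \<in> H \<Longrightarrow> c \<odot> a \<in> H"
  shows "submodule H scalar_ring X"
proof (rule submoduleI)
  fix a assume "a \<in> H"
  then show "\<ominus> a \<in> H"
    using smult[of a "-1"] assms(1) minus_one_smult[of a] by auto
qed (use assms in auto)

lemma subspaceD:
  assumes "submodule H scalar_ring X"
  shows "\<And>x. x \<in> H \<Longrightarrow> x \<in> carrier X" "\<zero> \<in> H" "\<And>a b. a \<in> H \<Longrightarrow> b \<in> H \<Longrightarrow> a \<oplus> b \<in> H"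
    and "\<And>c a. a \<in> H \<Longrightarrow> c \<odot> a \<in> H" "\<And>a. a \<in> H \<Longrightarrow> \<ominus> a \<in> H"
  using submoduleE[OF assms] submodule.axioms(1)[OF assms] subgroup.one_closed by fastforce+

lemma subspace_finsum:
  assumes "submodule H scalar_ring X" "f \<in> A \<rightarrow> H"
  shows "(\<Oplus>i\<in>A. f i) \<in> H"
  using assms(2)
proof (induction A rule: infinite_finite_induct)
  case (insert x F)
  then have "f \<in> F \<rightarrow> carrier X" "f x \<in> carrier X"
    using subspaceD(1)[OF assms(1)] by auto
  with insert show ?case
    by (simp add: subspaceD(3)[OF assms(1)])
qed (simp_all add: subspaceD(2)[OF assms(1)])

lemma subspace_kspace:
  assumes "submodule H scalar_ring X"
  shows "kspace (X\<lparr>carrier := H\<rparr>)"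
  unfolding kspace_def using submodule.submodule_is_module[OF assms module_axioms] .

lemma span_subset_carrier: "S \<subseteq> carrier X \<Longrightarrow> linear_span X S \<subseteq> carrier X"
  unfolding linear_span_def using carrier_is_submodule by blast

lemma span_superset: "S \<subseteq> linear_span X S"
  unfolding linear_span_def by blast

lemma span_least: "submodule H scalar_ring X \<Longrightarrow> S \<subseteq> H \<Longrightarrow> linear_span X S \<subseteq> H"
  unfolding linear_span_def by blast

lemma span_subspace:
  assumes "S \<subseteq> carrier X"
  shows "submodule (linear_span X S) scalar_ring X"
proof (rule subspaceI[OF span_subset_carrier[OF assms]])
  show "\<zero> \<in> linear_span X S"
    unfolding linear_span_def by (auto intro: subspaceD(2))
  show "a \<oplus> b \<in> linear_span X S" if "a \<in> linear_span X S" "b \<in> linear_span X S" for a b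
    using that unfolding linear_span_def by (auto intro: subspaceD(3))
  show "c \<odot> a \<in> linear_span X S" if "a \<in> linear_span X S" for c a
    using that unfolding linear_span_def by (auto intro: subspaceD(4))
qed

lemma span_induct [consumes 2, case_names base zero add smult]:
  assumes "x \<in> linear_span X S" and "S \<subseteq> carrier X"
    and "\<And>x. x \<in> S \<Longrightarrow> Q x" and "Q \<zero>"
    and "\<And>x y. x \<in> carrier X \<Longrightarrow> y \<in> carrier X \<Longrightarrow> Q x \<Longrightarrow> Q y \<Longrightarrow> Q (x \<oplus> y)"
    and "\<And>c x. x \<in> carrier X \<Longrightarrow> Q x \<Longrightarrow> Q (c \<odot> x)"
  shows "Q x"
proof -
  have "submodule {x \<in> carrier X. Q x} scalar_ring X"
    by (rule subspaceI) (use assms in auto)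
  from span_least[OF this, of S] assms show ?thesis by blast
qed

lemma span_mono: "S \<subseteq> linear_span X S' \<Longrightarrow> S' \<subseteq> carrier X \<Longrightarrow> linear_span X S \<subseteq> linear_span X S'"
  by (rule span_least[OF span_subspace])

lemma finsum_times:
  assumes "finite A" "finite B" "\<And>a b. a \<in> A \<Longrightarrow> b \<in> B \<Longrightarrow> f (a, b) \<in> carrier X"
  shows "(\<Oplus>z\<in>A \<times> B. f z) = (\<Oplus>a\<in>A. \<Oplus>b\<in>B. f (a, b))"
  using assms(1,3)
proof (induction A)
  case (insert x F)
  have "insert x F \<times> B = ({x} \<times> B) \<union> (F \<times> B)" by auto
  moreover have "(\<Oplus>z\<in>({x} \<times> B) \<union> (F \<times> B). f z) = (\<Oplus>z\<in>{x} \<times> B. f z) \<oplus> (\<Oplus>z\<in>F \<times> B. f z)"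
    by (rule finsum_Un_disjoint) (use insert assms(2) in auto)
  moreover have "(\<Oplus>z\<in>Pair x ` B. f z) = (\<Oplus>b\<in>B. f (x, b))"
    by (rule finsum_reindex) (use insert in \<open>auto simp: inj_on_def\<close>)
  moreover have "Pair x ` B = {x} \<times> B" by auto
  ultimately show ?case
    using insert by (auto simp: Pi_def)
qed simp

end

lemma kspaceI:
  fixes X (structure)
  assumes "\<zero> \<in> carrier X" "\<And>x y. x \<in> carrier X \<Longrightarrow> y \<in> carrier X \<Longrightarrow> x \<oplus> y \<in> carrier X"
    "\<And>c x. x \<in> carrier X \<Longrightarrow> c \<odot> x \<in> carrier X"
    "\<And>x y z. x \<in> carrier X \<Longrightarrow> y \<in> carrier X \<Longrightarrow> z \<in> carrier X \<Longrightarrow> (x \<oplus> y) \<oplus> z = x \<oplus> (y \<oplus> z)"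
    "\<And>x y. x \<in> carrier X \<Longrightarrow> y \<in> carrier X \<Longrightarrow> x \<oplus> y = y \<oplus> x"
    "\<And>x. x \<in> carrier X \<Longrightarrow> \<zero> \<oplus> x = x" "\<And>x. x \<in> carrier X \<Longrightarrow> 0 \<odot> x = \<zero>"
    "\<And>x. x \<in> carrier X \<Longrightarrow> 1 \<odot> x = x"
    "\<And>a b x. x \<in> carrier X \<Longrightarrow> (a + b) \<odot> x = a \<odot> x \<oplus> b \<odot> x"
    "\<And>a x y. x \<in> carrier X \<Longrightarrow> y \<in> carrier X \<Longrightarrow> a \<odot> (x \<oplus> y) = a \<odot> x \<oplus> a \<odot> y"
    "\<And>a b x. x \<in> carrier X \<Longrightarrow> (a * b) \<odot> x = a \<odot> (b \<odot> x)"
  shows "kspace X"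
  unfolding kspace_def
proof (rule moduleI[OF cring_scalar_ring])
  show "abelian_group X"
  proof (rule abelian_groupI)
    fix x assume x: "x \<in> carrier X"
    show "\<exists>y\<in>carrier X. y \<oplus> x = \<zero>"
      using assms(9)[OF x, of "-1" 1] assms(7,8)[OF x] assms(3)[OF x, of "-1"] by auto
  qed (use assms in auto)
qed (use assms in auto)

text \<open>The axioms of a vector space are equations, so they pass to a homomorphic image.\<close>

lemma kspace_image:
  fixes X :: "('k::field, 'a, 'z) module_scheme" and Q :: "('k, 'b, 'y) module_scheme"
  assumes "kspace X" and img: "h ` carrier X = carrier Q"
    and add: "\<And>x y. x \<in> carrier X \<Longrightarrow> y \<in> carrier X \<Longrightarrow> h (x \<oplus>\<^bsub>X\<^esub> y) = h x \<oplus>\<^bsub>Q\<^esub> h y"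
    and smult: "\<And>c x. x \<in> carrier X \<Longrightarrow> h (c \<odot>\<^bsub>X\<^esub> x) = c \<odot>\<^bsub>Q\<^esub> h x"
    and zero: "h \<zero>\<^bsub>X\<^esub> = \<zero>\<^bsub>Q\<^esub>"
  shows "kspace Q"
proof -
  interpret kspace X by fact
  note rev = add[symmetric] smult[symmetric] zero[symmetric]
  show ?thesis
    by (rule kspaceI; unfold img[symmetric])
      (auto simp: rev a_ac smult_add_left smult_add_right smult_smult)
qed

section \<open>Linear maps\<close>

lemma linear_mapsI:
  assumes "\<And>x. x \<in> carrier X \<Longrightarrow> g x \<in> carrier Y"
    and "\<And>x y. x \<in> carrier X \<Longrightarrow> y \<in> carrier X \<Longrightarrow> g (x \<oplus>\<^bsub>X\<^esub> y) = g x \<oplus>\<^bsub>Y\<^esub> g y"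
    and "\<And>c x. x \<in> carrier X \<Longrightarrow> g (c \<odot>\<^bsub>X\<^esub> x) = c \<odot>\<^bsub>Y\<^esub> g x"
  shows "g \<in> linear_maps X Y"
  using assms by (auto simp: linear_maps_def hom_def)

lemma linear_mapsD:
  assumes "g \<in> linear_maps X Y"
  shows linear_closed: "x \<in> carrier X \<Longrightarrow> g x \<in> carrier Y"
    and linear_add: "x \<in> carrier X \<Longrightarrow> y \<in> carrier X \<Longrightarrow> g (x \<oplus>\<^bsub>X\<^esub> y) = g x \<oplus>\<^bsub>Y\<^esub> g y"
    and linear_smult: "x \<in> carrier X \<Longrightarrow> g (c \<odot>\<^bsub>X\<^esub> x) = c \<odot>\<^bsub>Y\<^esub> g x"
  using assms by (auto simp: linear_maps_def hom_def)

lemma linear_maps_zero: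
  assumes "g \<in> linear_maps X Y" "kspace X" "kspace Y"
  shows "g \<zero>\<^bsub>X\<^esub> = \<zero>\<^bsub>Y\<^esub>"
proof -
  interpret X: kspace X by fact
  interpret Y: kspace Y by fact
  have "g (0 \<odot>\<^bsub>X\<^esub> \<zero>\<^bsub>X\<^esub>) = 0 \<odot>\<^bsub>Y\<^esub> g \<zero>\<^bsub>X\<^esub>"
    by (rule linear_smult[OF assms(1)]) simp
  then show ?thesis
    using linear_closed[OF assms(1), of "\<zero>\<^bsub>X\<^esub>"] by simp
qed

lemma linear_finsum:
  assumes "g \<in> linear_maps X Y" "kspace X" "kspace Y" "f \<in> A \<rightarrow> carrier X"
  shows "g (\<Oplus>\<^bsub>X\<^esub>i\<in>A. f i) = (\<Oplus>\<^bsub>Y\<^esub>i\<in>A. g (f i))"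
proof -
  interpret X: kspace X by fact
  interpret Y: kspace Y by fact
  note [simp] = linear_maps_zero[OF assms(1-3)]
  show ?thesis
    using assms(4)
  proof (induction A rule: infinite_finite_induct)
    case (insert x F)
    then show ?case
      using linear_closed[OF assms(1)]
      by (auto simp: linear_add[OF assms(1)] Pi_def X.finsum_closed)
  qed (simp_all add: X.finsum_infinite Y.finsum_infinite)
qed

lemma linear_cong:
  assumes "g \<in> linear_maps X Y" "kspace X" "\<And>x. x \<in> carrier X \<Longrightarrow> h x = g x"
  shows "h \<in> linear_maps X Y"
proof -
  interpret X: kspace X by fact
  show ?thesis
    by (rule linear_mapsI) (auto simp: assms(3) linear_mapsD[OF assms(1)])
qed

lemma linear_maps_id: "(\<lambda>x. x) \<in> linear_maps X X"
  by (rule linear_mapsI) auto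

lemma linear_comp:
  "g \<in> linear_maps X Y \<Longrightarrow> h \<in> linear_maps Y Z \<Longrightarrow> (\<lambda>x. h (g x)) \<in> linear_maps X Z"
  by (rule linear_mapsI) (auto simp: linear_mapsD)

lemma linear_restrict_domain:
  "g \<in> linear_maps X Y \<Longrightarrow> H \<subseteq> carrier X \<Longrightarrow> g \<in> linear_maps (X\<lparr>carrier := H\<rparr>) Y"
  by (rule linear_mapsI) (auto simp: linear_mapsD subsetD)

lemma linear_restrict_range:
  "g \<in> linear_maps X Y \<Longrightarrow> g ` carrier X \<subseteq> H \<Longrightarrow> g \<in> linear_maps X (Y\<lparr>carrier := H\<rparr>)"
  by (rule linear_mapsI) (auto simp: linear_mapsD)

lemma linear_extend_range:
  "g \<in> linear_maps X (Y\<lparr>carrier := H\<rparr>) \<Longrightarrow> H \<subseteq> carrier Y \<Longrightarrow> g \<in> linear_maps X Y"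
  by (auto simp: linear_maps_def hom_def)

lemma linear_sum_map:
  assumes "kspace X" "kspace Y" "\<And>i. i \<in> A \<Longrightarrow> g i \<in> linear_maps X Y"
  shows "(\<lambda>x. \<Oplus>\<^bsub>Y\<^esub>i\<in>A. g i x) \<in> linear_maps X Y"
proof -
  interpret X: kspace X by fact
  interpret Y: kspace Y by fact
  have 1: "(\<lambda>i. g i x) \<in> A \<rightarrow> carrier Y" if "x \<in> carrier X" for x
    using that linear_closed[OF assms(3)] by auto
  show ?thesis
  proof (rule linear_mapsI)
    fix x y assume *: "x \<in> carrier X" "y \<in> carrier X"
    have "(\<Oplus>\<^bsub>Y\<^esub>i\<in>A. g i (x \<oplus>\<^bsub>X\<^esub> y)) = (\<Oplus>\<^bsub>Y\<^esub>i\<in>A. g i x \<oplus>\<^bsub>Y\<^esub> g i y)"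
      using * 1 by (intro Y.finsum_cong') (auto simp: linear_add[OF assms(3)] Pi_def)
    then show "(\<Oplus>\<^bsub>Y\<^esub>i\<in>A. g i (x \<oplus>\<^bsub>X\<^esub> y)) = (\<Oplus>\<^bsub>Y\<^esub>i\<in>A. g i x) \<oplus>\<^bsub>Y\<^esub> (\<Oplus>\<^bsub>Y\<^esub>i\<in>A. g i y)"
      using 1 * by (simp add: Y.finsum_addf)
  next
    fix c x assume *: "x \<in> carrier X"
    have "(\<Oplus>\<^bsub>Y\<^esub>i\<in>A. g i (c \<odot>\<^bsub>X\<^esub> x)) = (\<Oplus>\<^bsub>Y\<^esub>i\<in>A. c \<odot>\<^bsub>Y\<^esub> g i x)"
      using * 1 by (intro Y.finsum_cong') (auto simp: linear_smult[OF assms(3)] Pi_def)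
    then show "(\<Oplus>\<^bsub>Y\<^esub>i\<in>A. g i (c \<odot>\<^bsub>X\<^esub> x)) = c \<odot>\<^bsub>Y\<^esub> (\<Oplus>\<^bsub>Y\<^esub>i\<in>A. g i x)"
      using 1 * by (simp add: Y.smult_finsum)
  qed (use 1 in \<open>auto intro: Y.finsum_closed\<close>)
qed

lemma linear_smult_map:
  assumes "kspace Y" "g \<in> linear_maps X Y"
  shows "(\<lambda>x. c \<odot>\<^bsub>Y\<^esub> g x) \<in> linear_maps X Y"
proof -
  interpret Y: kspace Y by fact
  show ?thesis
    by (rule linear_mapsI)
      (auto simp: linear_mapsD[OF assms(2)] Y.smult_add_right Y.smult_smult mult.commute)
qed

lemma linear_add_map:
  assumes "kspace Y" "g \<in> linear_maps X Y" "h \<in> linear_maps X Y"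
  shows "(\<lambda>x. g x \<oplus>\<^bsub>Y\<^esub> h x) \<in> linear_maps X Y"
proof -
  interpret Y: kspace Y by fact
  note g = linear_mapsD[OF assms(2)] and h = linear_mapsD[OF assms(3)]
  show ?thesis
    by (rule linear_mapsI) (auto simp: g h Y.smult_add_right Y.a_ac)
qed

lemma linear_kernel_subspace:
  assumes "kspace X" "kspace Y" "g \<in> linear_maps X Y"
  shows "submodule {x \<in> carrier X. g x = \<zero>\<^bsub>Y\<^esub>} scalar_ring X"
proof -
  interpret X: kspace X by fact
  interpret Y: kspace Y by fact
  show ?thesis
    by (rule X.subspaceI) (auto simp: linear_mapsD[OF assms(3)] linear_maps_zero[OF assms(3,1,2)])
qed

lemma linear_image_span:
  assumes "kspace X" "kspace Y" "g \<in> linear_maps X Y" "S \<subseteq> carrier X"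
    and "x \<in> linear_span X S"
  shows "g x \<in> linear_span Y (g ` S)"
proof -
  interpret X: kspace X by fact
  interpret Y: kspace Y by fact
  have S: "g ` S \<subseteq> carrier Y" using assms(3,4) by (auto simp: linear_closed)
  note sub = Y.subspaceD[OF Y.span_subspace[OF S]]
  show ?thesis
    using assms(5,4)
  proof (induction rule: X.span_induct)
    case (base x)
    then show ?case using Y.span_superset by blast
  qed (auto simp: linear_mapsD[OF assms(3)] linear_maps_zero[OF assms(3,1,2)] sub)
qed

lemma linear_eq_on_span:
  assumes "kspace X" "kspace Y" "S \<subseteq> carrier X"
    and g: "g \<in> linear_maps (X\<lparr>carrier := linear_span X S\<rparr>) Y"
    and h: "h \<in> linear_maps (X\<lparr>carrier := linear_span X S\<rparr>) Y"
    and eq: "\<And>x. x \<in> S \<Longrightarrow> g x = h x" and x: "x \<in> linear_span X S"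
  shows "g x = h x"
proof -
  interpret X: kspace X by fact
  interpret Y: kspace Y by fact
  note sub = X.subspaceD[OF X.span_subspace[OF assms(3)]]
  let ?X = "X\<lparr>carrier := linear_span X S\<rparr>"
  have kX: "kspace ?X" using X.subspace_kspace X.span_subspace assms(3) by blast
  have "g x = h x \<and> x \<in> linear_span X S"
    using x assms(3)
  proof (induction rule: X.span_induct)
    case (base x)
    then show ?case using eq X.span_superset by blast
  next
    case zero
    then show ?case using linear_maps_zero[OF g kX assms(2)] linear_maps_zero[OF h kX assms(2)] sub by simp
  next
    case (add x y)
    then show ?case using linear_add[OF g, of x y] linear_add[OF h, of x y] sub by simp
  next
    case (smult c x)
    then show ?case using linear_smult[OF g, of x c] linear_smult[OF h, of x c] sub by simp
  qed
  then show ?thesis by simp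
qed

text \<open>The definite description ranges over maps that are undefined outside the carrier, whence the
  restriction of \<open>g\<close>; the last hypothesis says that the prescription determines a linear map.\<close>

lemma the_linear_map_eq:
  assumes "kspace X" "g \<in> linear_maps X Y" "S (restrict g (carrier X))"
    and uniq: "\<And>h x. h \<in> linear_maps X Y \<Longrightarrow> S h \<Longrightarrow> x \<in> carrier X \<Longrightarrow> h x = g x"
  shows "the_linear_map X Y S = restrict g (carrier X)"
  unfolding the_linear_map_def
proof (rule the_equality)
  show "restrict g (carrier X) \<in> linear_maps X Y \<and> restrict g (carrier X) \<in> extensional (carrier X)
    \<and> S (restrict g (carrier X))"
    using assms(3) linear_cong[OF assms(2,1), of "restrict g (carrier X)"] by auto
  show "h = restrict g (carrier X)"
    if "h \<in> linear_maps X Y \<and> h \<in> extensional (carrier X) \<and> S h" for h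
    by (rule extensionalityI[of _ "carrier X"]) (use that uniq in auto)
qed

text \<open>The target of linear functionals.\<close>

definition field_space :: "('k::field, 'k) module" where
  "field_space = \<lparr>carrier = UNIV, mult = (*), one = 1, zero = 0, add = (+), smult = (*)\<rparr>"

lemma field_space_simps [simp]:
  "carrier field_space = UNIV" "zero field_space = 0" "add field_space = (+)"
  "smult field_space = (*)"
  by (simp_all add: field_space_def)

lemma kspace_field_space [simp]: "kspace field_space"
  by (rule kspaceI) (auto simp: algebra_simps)

lemma linear_functional_times:
  assumes "kspace Y" "c \<in> linear_maps X field_space" "y \<in> carrier Y"
  shows "(\<lambda>x. c x \<odot>\<^bsub>Y\<^esub> y) \<in> linear_maps X Y"
proof -
  interpret Y: kspace Y by fact
  show ?thesis
    by (rule linear_mapsI)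
      (use assms(3) in \<open>auto simp: linear_mapsD[OF assms(2)] Y.smult_add_left Y.smult_smult\<close>)
qed

section \<open>Quotient spaces\<close>

lemma quotient_space_simps [simp]:
  "carrier (quotient_space X I) = (\<lambda>x. I +>\<^bsub>X\<^esub> x) ` carrier X"
  "zero (quotient_space X I) = I" "add (quotient_space X I) = set_add X"
  "one (quotient_space X I) = I +>\<^bsub>X\<^esub> \<one>\<^bsub>X\<^esub>" "monoid.mult (quotient_space X I) = rcoset_mult X I"
  "smult (quotient_space X I) c C = (\<Union>x\<in>C. I +>\<^bsub>X\<^esub> (c \<odot>\<^bsub>X\<^esub> x))"
  by (auto simp: quotient_space_def FactRing_def A_RCOSETS_def' a_r_coset_def' image_def)

context kspace
begin

lemma subspace_abelian_subgroup:
  "submodule I scalar_ring X \<Longrightarrow> abelian_subgroup I X"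
  by (rule abelian_subgroupI3[OF additive_subgroup.intro[OF submodule.axioms(1)] abelian_group_axioms])

lemma coset_eq_iff:
  assumes "submodule I scalar_ring X" "x \<in> carrier X" "y \<in> carrier X"
  shows "I +> x = I +> y \<longleftrightarrow> x \<ominus> y \<in> I"
proof -
  interpret I: abelian_subgroup I X using subspace_abelian_subgroup[OF assms(1)] .
  have "x \<ominus> y \<in> I \<longleftrightarrow> x \<in> I +> y"
    using I.a_rcos_module[of y x] assms(2,3) by (simp add: a_minus_def)
  also have "\<dots> \<longleftrightarrow> I +> x = I +> y"
    using I.a_repr_independence'[of x y] I.a_repr_independenceD[of x y] assms(2,3) by metis
  finally show ?thesis by simp
qed

lemma coset_add:
  assumes "submodule I scalar_ring X" "x \<in> carrier X" "y \<in> carrier X"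
  shows "I +> (x \<oplus> y) = (I +> x) \<oplus>\<^bsub>quotient_space X I\<^esub> (I +> y)"
proof -
  interpret I: abelian_subgroup I X using subspace_abelian_subgroup[OF assms(1)] .
  show ?thesis using assms by (simp add: I.a_rcos_sum)
qed

lemma coset_smult:
  assumes "submodule I scalar_ring X" "x \<in> carrier X"
  shows "I +> (c \<odot> x) = c \<odot>\<^bsub>quotient_space X I\<^esub> (I +> x)"
proof -
  interpret I: abelian_subgroup I X using subspace_abelian_subgroup[OF assms(1)] .
  have const: "I +> (c \<odot> y) = I +> (c \<odot> x)" if "y \<in> I +> x" for y
  proof -
    have y: "y \<in> carrier X" using that I.a_elemrcos_carrier assms(2) by blast
    have "y \<ominus> x \<in> I" using I.a_rcos_module_imp[OF assms(2) that] by (simp add: a_minus_def)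
    then have "c \<odot> (y \<ominus> x) \<in> I" using subspaceD(4)[OF assms(1)] by blast
    also have "c \<odot> (y \<ominus> x) = c \<odot> y \<ominus> c \<odot> x"
      using y assms(2) smult_r_minus[of c x] by (simp add: a_minus_def smult_add_right)
    finally show ?thesis using coset_eq_iff[OF assms(1)] y assms(2) by simp
  qed
  have "x \<in> I +> x" using assms(2) I.a_rcos_self by blast
  then have "(\<Union>y\<in>I +> x. I +> (c \<odot> y)) = I +> (c \<odot> x)"
    by (intro SUP_eq_const const) blast+
  then show ?thesis by (simp only: quotient_space_simps)
qed

lemma coset_zero: "submodule I scalar_ring X \<Longrightarrow> x \<in> I \<Longrightarrow> I +> x = I"
  using abelian_subgroup.a_rcos_const[OF subspace_abelian_subgroup] by blast

lemma coset_linear: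
  assumes "submodule I scalar_ring X"
  shows "(\<lambda>x. I +> x) \<in> linear_maps X (quotient_space X I)"
  by (rule linear_mapsI) (auto simp: coset_add[OF assms] coset_smult[OF assms]
    simp del: quotient_space_simps(2-))

lemma kspace_quotient:
  assumes "submodule I scalar_ring X"
  shows "kspace (quotient_space X I)"
  by (rule kspace_image[OF kspace_axioms, where h = "\<lambda>x. I +> x"])
    (use linear_mapsD[OF coset_linear[OF assms]] coset_zero[OF assms subspaceD(2)[OF assms]] in \<open>simp_all\<close>)

lemma quotient_lift:
  fixes Y :: "('k, 'b, 'y) module_scheme"
  assumes I: "submodule I scalar_ring X" and "kspace Y" and g: "g \<in> linear_maps X Y"
    and zero: "\<And>x. x \<in> I \<Longrightarrow> g x = \<zero>\<^bsub>Y\<^esub>"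
  obtains h where "h \<in> linear_maps (quotient_space X I) Y" "\<And>x. x \<in> carrier X \<Longrightarrow> h (I +> x) = g x"
proof -
  interpret Y: kspace Y by fact
  have well: "g x = g y" if "x \<in> carrier X" "y \<in> carrier X" "I +> x = I +> y" for x y
  proof -
    have "\<zero>\<^bsub>Y\<^esub> = g (x \<ominus> y)" using zero coset_eq_iff[OF I] that by simp
    also have "\<dots> = g x \<oplus>\<^bsub>Y\<^esub> g ((-1) \<odot> y)"
      using that minus_one_smult[of y] by (simp add: a_minus_def linear_add[OF g, symmetric])
    also have "\<dots> = g x \<ominus>\<^bsub>Y\<^esub> g y"
      using that linear_closed[OF g] by (simp add: linear_smult[OF g] Y.minus_one_smult a_minus_def)
    finally show ?thesis
      using that linear_closed[OF g] by (metis a_minus_def Y.a_inv_closed Y.minus_equality Y.minus_minus)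
  qed
  \<comment> \<open>any representative gives the same value, by the previous step\<close>
  define h where "h C = g (SOME x. x \<in> carrier X \<and> C = I +> x)" for C
  have h: "h (I +> x) = g x" if "x \<in> carrier X" for x
  proof -
    have "(SOME y. y \<in> carrier X \<and> I +> x = I +> y) \<in> carrier X
        \<and> I +> x = I +> (SOME y. y \<in> carrier X \<and> I +> x = I +> y)"
      by (rule someI[where x = x]) (use that in auto)
    then show ?thesis unfolding h_def using well that by metis
  qed
  have "h \<in> linear_maps (quotient_space X I) Y"
    by (rule linear_mapsI)
      (auto simp: h linear_mapsD[OF g] coset_add[OF I, symmetric] coset_smult[OF I, symmetric]
        simp del: quotient_space_simps(2-))
  then show ?thesis using h that by blast
qed

end

section \<open>Free spaces and tensor products\<close>

lemma lookup_scale [simp]: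
  "Poly_Mapping.lookup (Poly_Mapping.map ((*) c) p) k = c * Poly_Mapping.lookup p (k :: 'b)"
  for c :: "'k::field"
  by (simp add: Poly_Mapping.map.rep_eq when_def)

lemma scale_single: "Poly_Mapping.map ((*) c) (Poly_Mapping.single b d) = Poly_Mapping.single b (c * d)"
  for c :: "'k::field"
  by (rule poly_mapping_eqI) (simp add: lookup_single when_def)

lemma sum_monomials:
  fixes p :: "'b \<Rightarrow>\<^sub>0 'k::field"
  shows "(\<Sum>b\<in>Poly_Mapping.keys p. Poly_Mapping.single b (Poly_Mapping.lookup p b)) = p"
proof (rule poly_mapping_eqI)
  fix k
  have "Poly_Mapping.lookup (\<Sum>b\<in>Poly_Mapping.keys p. Poly_Mapping.single b (Poly_Mapping.lookup p b)) k
    = (\<Sum>b\<in>Poly_Mapping.keys p. if b = k then Poly_Mapping.lookup p b else 0)"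
    by (simp add: lookup_sum lookup_single when_def)
  also have "\<dots> = Poly_Mapping.lookup p k"
    by (simp add: in_keys_iff)
  finally show "Poly_Mapping.lookup (\<Sum>b\<in>Poly_Mapping.keys p.
    Poly_Mapping.single b (Poly_Mapping.lookup p b)) k = Poly_Mapping.lookup p k" .
qed

lemma free_space_simps [simp]:
  "carrier (free_space B) = {p. Poly_Mapping.keys p \<subseteq> B}" "zero (free_space B) = 0"
  "add (free_space B) = (+)" "smult (free_space B) = (\<lambda>c. Poly_Mapping.map ((*) c))"
  by (simp_all add: free_space_def)

lemma keys_scale: "Poly_Mapping.keys (Poly_Mapping.map ((*) c) p) \<subseteq> Poly_Mapping.keys (p :: 'b \<Rightarrow>\<^sub>0 'k::field)"
  by (auto simp: in_keys_iff)

lemma kspace_free_space: "kspace (free_space B :: ('k::field, 'b \<Rightarrow>\<^sub>0 'k) module)"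
proof (rule kspaceI)
  fix x y :: "'b \<Rightarrow>\<^sub>0 'k" and c
  show "x \<oplus>\<^bsub>free_space B\<^esub> y \<in> carrier (free_space B)"
    if "x \<in> carrier (free_space B)" "y \<in> carrier (free_space B)"
    using that Poly_Mapping.keys_add[of x y] by auto
  show "c \<odot>\<^bsub>free_space B\<^esub> x \<in> carrier (free_space B)" if "x \<in> carrier (free_space B)"
    using that keys_scale[of c x] by auto
qed (auto intro!: poly_mapping_eqI simp: lookup_add algebra_simps)

lemma free_space_minus:
  assumes "x \<in> carrier (free_space B)" "y \<in> carrier (free_space B)"
  shows "x \<ominus>\<^bsub>free_space B\<^esub> y = x - (y :: 'b \<Rightarrow>\<^sub>0 'k::field)"
proof -
  interpret kspace "free_space B :: ('k, 'b \<Rightarrow>\<^sub>0 'k) module" by (rule kspace_free_space)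
  have "\<ominus>\<^bsub>free_space B\<^esub> y = (- 1) \<odot>\<^bsub>free_space B\<^esub> y"
    using assms(2) minus_one_smult by simp
  also have "\<dots> = - y" by (auto intro!: poly_mapping_eqI)
  finally show ?thesis by (simp add: a_minus_def)
qed

lemma free_space_linear_minus:
  assumes "kspace Z" "g \<in> linear_maps (free_space B) Z"
    and "u \<in> carrier (free_space B)" "v \<in> carrier (free_space B)"
  shows "g (u - v) = g u \<ominus>\<^bsub>Z\<^esub> g (v :: 'b \<Rightarrow>\<^sub>0 'k::field)"
proof -
  interpret F: kspace "free_space B :: ('k, 'b \<Rightarrow>\<^sub>0 'k) module" by (rule kspace_free_space)
  have "u - v = u \<oplus>\<^bsub>free_space B\<^esub> (- 1) \<odot>\<^bsub>free_space B\<^esub> v"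
    by (auto intro!: poly_mapping_eqI simp: lookup_add lookup_minus)
  then show ?thesis
    using assms(3,4) F.smult_in[of v "-1"]
    by (simp only: linear_mapsD[OF assms(2)] kspace.minus_one_smult[OF assms(1)] a_minus_def)
qed

lemma free_space_span:
  "linear_span (free_space B) ((\<lambda>b. Poly_Mapping.single b 1) ` B)
    = carrier (free_space B :: ('k::field, 'b \<Rightarrow>\<^sub>0 'k) module)"
  (is "?S = _")
proof
  interpret kspace "free_space B :: ('k, 'b \<Rightarrow>\<^sub>0 'k) module" by (rule kspace_free_space)
  have gens: "(\<lambda>b. Poly_Mapping.single b (1::'k)) ` B \<subseteq> carrier (free_space B)" by auto
  show "?S \<subseteq> carrier (free_space B)" by (rule span_subset_carrier[OF gens])
  note sub = subspaceD[OF span_subspace[OF gens]]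
  have sum: "(\<Sum>b\<in>K. Poly_Mapping.single b (Poly_Mapping.lookup p b)) \<in> ?S"
    if "finite K" "K \<subseteq> B" for K and p :: "'b \<Rightarrow>\<^sub>0 'k"
    using that
  proof (induction K)
    case empty
    then show ?case using sub(2) by simp
  next
    case (insert b K)
    have "Poly_Mapping.single b 1 \<in> ?S" using insert.prems span_superset by fastforce
    from sub(4)[OF this, of "Poly_Mapping.lookup p b"]
    have "Poly_Mapping.single b (Poly_Mapping.lookup p b) \<in> ?S" by (simp add: scale_single)
    with insert sub(3) show ?case by simp
  qed
  show "carrier (free_space B) \<subseteq> ?S"
  proof
    fix p :: "'b \<Rightarrow>\<^sub>0 'k" assume "p \<in> carrier (free_space B)"
    then show "p \<in> ?S" using sum[of "Poly_Mapping.keys p" p] by (simp add: sum_monomials)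
  qed
qed

lemma free_space_lift:
  fixes h :: "'b \<Rightarrow> 'z" and Z :: "('k::field, 'z, 'y) module_scheme"
  assumes "kspace Z" and h: "\<And>b. b \<in> B \<Longrightarrow> h b \<in> carrier Z"
  obtains g where "g \<in> linear_maps (free_space B) Z"
    "\<And>b. b \<in> B \<Longrightarrow> g (Poly_Mapping.single b 1) = h b"
proof -
  interpret Z: kspace Z by fact
  let ?F = "free_space B :: ('k, 'b \<Rightarrow>\<^sub>0 'k) module"
  define g where "g p = (\<Oplus>\<^bsub>Z\<^esub>b\<in>Poly_Mapping.keys p. Poly_Mapping.lookup p b \<odot>\<^bsub>Z\<^esub> h b)" for p
  have g: "g p = (\<Oplus>\<^bsub>Z\<^esub>b\<in>K. Poly_Mapping.lookup p b \<odot>\<^bsub>Z\<^esub> h b)"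
    if "finite K" "Poly_Mapping.keys p \<subseteq> K" "K \<subseteq> B" for p K
    unfolding g_def
    by (rule Z.add.finprod_mono_neutral_cong_left) (use that h in \<open>auto simp: in_keys_iff\<close>)
  have "g \<in> linear_maps ?F Z"
  proof (rule linear_mapsI)
    fix p q assume *: "p \<in> carrier ?F" "q \<in> carrier ?F"
    let ?K = "Poly_Mapping.keys p \<union> Poly_Mapping.keys q"
    have K: "finite ?K" "?K \<subseteq> B" using * by auto
    have c: "(\<lambda>b. Poly_Mapping.lookup r b \<odot>\<^bsub>Z\<^esub> h b) \<in> ?K \<rightarrow> carrier Z" for r
      using K(2) h by auto
    have "g (p + q) = (\<Oplus>\<^bsub>Z\<^esub>b\<in>?K. Poly_Mapping.lookup (p + q) b \<odot>\<^bsub>Z\<^esub> h b)"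
      by (rule g[OF K(1) _ K(2)]) (rule Poly_Mapping.keys_add)
    also have "\<dots> = (\<Oplus>\<^bsub>Z\<^esub>b\<in>?K. Poly_Mapping.lookup p b \<odot>\<^bsub>Z\<^esub> h b \<oplus>\<^bsub>Z\<^esub> Poly_Mapping.lookup q b \<odot>\<^bsub>Z\<^esub> h b)"
      by (rule Z.finsum_cong') (use K(2) h in \<open>auto simp: lookup_add Z.smult_add_left\<close>)
    also have "\<dots> = g p \<oplus>\<^bsub>Z\<^esub> g q"
      by (simp only: Z.finsum_addf[OF c c] g[OF K(1) _ K(2)] Un_upper1 Un_upper2)
    finally show "g (p \<oplus>\<^bsub>?F\<^esub> q) = g p \<oplus>\<^bsub>Z\<^esub> g q" by simp
  next
    fix c p assume *: "p \<in> carrier ?F"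
    have c: "(\<lambda>b. Poly_Mapping.lookup p b \<odot>\<^bsub>Z\<^esub> h b) \<in> Poly_Mapping.keys p \<rightarrow> carrier Z"
      using * h by auto
    have "g (Poly_Mapping.map ((*) c) p)
      = (\<Oplus>\<^bsub>Z\<^esub>b\<in>Poly_Mapping.keys p. Poly_Mapping.lookup (Poly_Mapping.map ((*) c) p) b \<odot>\<^bsub>Z\<^esub> h b)"
      by (rule g) (use * keys_scale[of c p] in auto)
    also have "\<dots> = (\<Oplus>\<^bsub>Z\<^esub>b\<in>Poly_Mapping.keys p. c \<odot>\<^bsub>Z\<^esub> (Poly_Mapping.lookup p b \<odot>\<^bsub>Z\<^esub> h b))"
      by (rule Z.finsum_cong') (use * h in \<open>auto simp: Z.smult_smult\<close>)
    also have "\<dots> = c \<odot>\<^bsub>Z\<^esub> g p"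
      unfolding g_def by (rule Z.smult_finsum[OF c, symmetric])
    finally show "g (c \<odot>\<^bsub>?F\<^esub> p) = c \<odot>\<^bsub>Z\<^esub> g p" by simp
  next
    fix p assume "p \<in> carrier ?F"
    then show "g p \<in> carrier Z"
      unfolding g_def using h by (intro Z.finsum_closed) auto
  qed
  moreover have "g (Poly_Mapping.single b 1) = h b" if "b \<in> B" for b
    unfolding g_def using h[OF that] by simp
  ultimately show ?thesis using that by blast
qed

locale kspace_pair = X: kspace X + Y: kspace Y
  for X :: "('k::field, 'a, 'x) module_scheme" and Y :: "('k, 'b, 'y) module_scheme"
begin

abbreviation "pairs \<equiv> (free_space (carrier X \<times> carrier Y) :: ('k, 'a \<times> 'b \<Rightarrow>\<^sub>0 'k) module)"

lemma bilinear_relations_closed: "bilinear_relations X Y \<subseteq> carrier pairs"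
proof -
  have d: "Poly_Mapping.keys (u - v) \<subseteq> B"
    if "Poly_Mapping.keys u \<subseteq> B" "Poly_Mapping.keys v \<subseteq> B" for u v :: "'a \<times> 'b \<Rightarrow>\<^sub>0 'k" and B
    using that Poly_Mapping.keys_diff[of u v] by blast
  show ?thesis
  proof
    fix u assume "u \<in> bilinear_relations X Y"
    then show "u \<in> carrier pairs"
      unfolding bilinear_relations_def
      by (elim UnE CollectE exE conjE; simp only: free_space_simps mem_Collect_eq)
        ((rule d)+; simp)+
  qed
qed

text \<open>Stated for any family of relations containing the bilinear ones, so as to cover the tensor
  products over the field and over an algebra at once.\<close>

lemma coset_bilinear:
  assumes R: "bilinear_relations X Y \<subseteq> R" "R \<subseteq> carrier pairs"
  defines "J \<equiv> linear_span pairs R"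
  defines "t \<equiv> \<lambda>x y. J +>\<^bsub>pairs\<^esub> Poly_Mapping.single (x, y) 1"
  shows "y \<in> carrier Y \<Longrightarrow> (\<lambda>x. t x y) \<in> linear_maps X (quotient_space pairs J)" (is "_ \<Longrightarrow> ?A")
    and "x \<in> carrier X \<Longrightarrow> t x \<in> linear_maps Y (quotient_space pairs J)" (is "_ \<Longrightarrow> ?B")
    and "kspace (quotient_space pairs J)" (is "?C")
proof -
  interpret F: kspace pairs by (rule kspace_free_space)
  have J: "submodule J scalar_ring pairs" unfolding J_def by (rule F.span_subspace[OF R(2)])
  show ?C by (rule F.kspace_quotient[OF J])
  have eq: "J +>\<^bsub>pairs\<^esub> u = J +>\<^bsub>pairs\<^esub> v"
    if "u - v \<in> bilinear_relations X Y" "u \<in> carrier pairs" "v \<in> carrier pairs" for u v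
    unfolding F.coset_eq_iff[OF J that(2,3)] free_space_minus[OF that(2,3)]
    unfolding J_def by (rule subsetD[OF F.span_superset subsetD[OF R(1) that(1)]])
  note lin = linear_mapsD[OF F.coset_linear[OF J]]
  have s: "Poly_Mapping.single (x, y) c \<in> carrier pairs" if "x \<in> carrier X" "y \<in> carrier Y" for x y c
    using that by simp
  have ss: "Poly_Mapping.single (x, y) 1 + Poly_Mapping.single (x', y') 1 \<in> carrier pairs"
    if "x \<in> carrier X" "y \<in> carrier Y" "x' \<in> carrier X" "y' \<in> carrier Y" for x y x' y'
    using F.a_closed[OF s[OF that(1,2), of 1] s[OF that(3,4), of 1]] by simp
  have sum: "t x y \<oplus>\<^bsub>quotient_space pairs J\<^esub> t x' y'
      = J +>\<^bsub>pairs\<^esub> (Poly_Mapping.single (x, y) 1 + Poly_Mapping.single (x', y') 1)"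
    if "x \<in> carrier X" "y \<in> carrier Y" "x' \<in> carrier X" "y' \<in> carrier Y" for x y x' y'
    unfolding t_def using lin(2)[OF s[OF that(1,2), of 1] s[OF that(3,4), of 1]] by simp
  have scale: "c \<odot>\<^bsub>quotient_space pairs J\<^esub> t x y = J +>\<^bsub>pairs\<^esub> (Poly_Mapping.single (x, y) c)"
    if "x \<in> carrier X" "y \<in> carrier Y" for x y c
    unfolding t_def using lin(3)[OF s[OF that, of 1], of c] by (simp add: scale_single)
  have closed: "t x y \<in> carrier (quotient_space pairs J)"
    if "x \<in> carrier X" "y \<in> carrier Y" for x y
    unfolding t_def using lin(1)[OF s[OF that, of 1]] by simp
  show ?A if y: "y \<in> carrier Y"
  proof (rule linear_mapsI)
    fix x x' assume *: "x \<in> carrier X" "x' \<in> carrier X"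
    show "t (x \<oplus>\<^bsub>X\<^esub> x') y = t x y \<oplus>\<^bsub>quotient_space pairs J\<^esub> t x' y"
      unfolding sum[OF *(1) y *(2) y] unfolding t_def
    proof (rule eq[OF _ s[OF _ y] ss[OF *(1) y *(2) y]])
      show "Poly_Mapping.single (x \<oplus>\<^bsub>X\<^esub> x', y) 1
        - (Poly_Mapping.single (x, y) 1 + Poly_Mapping.single (x', y) 1) \<in> bilinear_relations X Y"
        unfolding diff_diff_eq[symmetric] bilinear_relations_def using * y by blast
    qed (use * in simp)
  next
    fix c x assume *: "x \<in> carrier X"
    show "t (c \<odot>\<^bsub>X\<^esub> x) y = c \<odot>\<^bsub>quotient_space pairs J\<^esub> t x y"
      unfolding scale[OF * y] unfolding t_def
    proof (rule eq[OF _ s[OF _ y] s[OF * y]])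
      show "Poly_Mapping.single (c \<odot>\<^bsub>X\<^esub> x, y) 1 - Poly_Mapping.single (x, y) c
          \<in> bilinear_relations X Y"
        unfolding bilinear_relations_def using * y by blast
    qed (use * in simp)
  qed (use y closed in auto)
  show ?B if x: "x \<in> carrier X"
  proof (rule linear_mapsI)
    fix y y' assume *: "y \<in> carrier Y" "y' \<in> carrier Y"
    show "t x (y \<oplus>\<^bsub>Y\<^esub> y') = t x y \<oplus>\<^bsub>quotient_space pairs J\<^esub> t x y'"
      unfolding sum[OF x *(1) x *(2)] unfolding t_def
    proof (rule eq[OF _ s[OF x] ss[OF x *(1) x *(2)]])
      show "Poly_Mapping.single (x, y \<oplus>\<^bsub>Y\<^esub> y') 1
        - (Poly_Mapping.single (x, y) 1 + Poly_Mapping.single (x, y') 1) \<in> bilinear_relations X Y"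
        unfolding diff_diff_eq[symmetric] bilinear_relations_def using * x by blast
    qed (use * in simp)
  next
    fix c y assume *: "y \<in> carrier Y"
    show "t x (c \<odot>\<^bsub>Y\<^esub> y) = c \<odot>\<^bsub>quotient_space pairs J\<^esub> t x y"
      unfolding scale[OF x *] unfolding t_def
    proof (rule eq[OF _ s[OF x] s[OF x *]])
      show "Poly_Mapping.single (x, c \<odot>\<^bsub>Y\<^esub> y) 1 - Poly_Mapping.single (x, y) c
          \<in> bilinear_relations X Y"
        unfolding bilinear_relations_def using * x by blast
    qed (use * in simp)
  qed (use x closed in auto)
qed

lemma kspace_tensor_product: "kspace (tensor_product X Y)"
  using coset_bilinear(3)[OF subset_refl bilinear_relations_closed]
  by (simp add: tensor_product_def tensor_kernel_def)

lemma pure_tensor_linear_left: "y \<in> carrier Y \<Longrightarrow> (\<lambda>x. pure_tensor X Y x y) \<in> linear_maps X (tensor_product X Y)"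
  using coset_bilinear(1)[OF subset_refl bilinear_relations_closed]
  by (simp add: tensor_product_def tensor_kernel_def pure_tensor_def)

lemma pure_tensor_linear_right: "x \<in> carrier X \<Longrightarrow> pure_tensor X Y x \<in> linear_maps Y (tensor_product X Y)"
  using coset_bilinear(2)[OF subset_refl bilinear_relations_closed]
  by (simp add: tensor_product_def tensor_kernel_def pure_tensor_def[abs_def])

lemma pure_tensor_closed:
  "x \<in> carrier X \<Longrightarrow> y \<in> carrier Y \<Longrightarrow> pure_tensor X Y x y \<in> carrier (tensor_product X Y)"
  using linear_closed[OF pure_tensor_linear_right] .

lemma tensor_kernel_subspace: "submodule (tensor_kernel X Y) scalar_ring pairs"
  unfolding tensor_kernel_def
  by (rule kspace.span_subspace[OF kspace_free_space bilinear_relations_closed])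

lemma pure_tensor_span:
  "carrier (tensor_product X Y)
    = linear_span (tensor_product X Y) {pure_tensor X Y x y | x y. x \<in> carrier X \<and> y \<in> carrier Y}"
  (is "_ = linear_span _ ?S")
proof
  interpret T: kspace "tensor_product X Y" by (rule kspace_tensor_product)
  interpret F: kspace pairs by (rule kspace_free_space)
  have S: "?S \<subseteq> carrier (tensor_product X Y)" using pure_tensor_closed by auto
  show "linear_span (tensor_product X Y) ?S \<subseteq> carrier (tensor_product X Y)"
    by (rule T.span_subset_carrier[OF S])
  show "carrier (tensor_product X Y) \<subseteq> linear_span (tensor_product X Y) ?S"
  proof
    fix C assume "C \<in> carrier (tensor_product X Y)"
    then obtain p where p: "p \<in> carrier pairs" and C: "C = tensor_kernel X Y +>\<^bsub>pairs\<^esub> p"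
      by (auto simp: tensor_product_def)
    have "C \<in> linear_span (tensor_product X Y) ((\<lambda>x. tensor_kernel X Y +>\<^bsub>pairs\<^esub> x) `
        (\<lambda>b. Poly_Mapping.single b 1) ` (carrier X \<times> carrier Y))"
      unfolding C tensor_product_def
      by (rule linear_image_span[OF F.kspace_axioms _ F.coset_linear[OF tensor_kernel_subspace]])
        (use p F.kspace_quotient[OF tensor_kernel_subspace] free_space_span[of "carrier X \<times> carrier Y"]
          in auto)
    also have "(\<lambda>x. tensor_kernel X Y +>\<^bsub>pairs\<^esub> x) ` (\<lambda>b. Poly_Mapping.single b 1) `
        (carrier X \<times> carrier Y) = ?S"
      by (auto simp: pure_tensor_def image_iff)
    finally show "C \<in> linear_span (tensor_product X Y) ?S" .
  qed
qed

lemma tensor_product_eqI: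
  assumes "kspace Z" "g \<in> linear_maps (tensor_product X Y) Z" "h \<in> linear_maps (tensor_product X Y) Z"
    and "\<And>x y. x \<in> carrier X \<Longrightarrow> y \<in> carrier Y \<Longrightarrow> g (pure_tensor X Y x y) = h (pure_tensor X Y x y)"
    and "t \<in> carrier (tensor_product X Y)"
  shows "g t = h t"
proof -
  let ?S = "{pure_tensor X Y x y | x y. x \<in> carrier X \<and> y \<in> carrier Y}"
  have eq: "(tensor_product X Y)\<lparr>carrier := linear_span (tensor_product X Y) ?S\<rparr> = tensor_product X Y"
    unfolding pure_tensor_span[symmetric] by simp
  show ?thesis
    by (rule linear_eq_on_span[OF kspace_tensor_product assms(1), of ?S])
      (use assms pure_tensor_closed in \<open>auto simp: eq pure_tensor_span[symmetric]\<close>)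
qed

text \<open>The linear extension of \<open>b\<close> to formal combinations of pairs kills each of the bilinear relations,
  hence the kernel spanned by them.\<close>

lemma tensor_product_lift:
  assumes "kspace Z" and l: "\<And>y. y \<in> carrier Y \<Longrightarrow> (\<lambda>x. b x y) \<in> linear_maps X Z"
    and r: "\<And>x. x \<in> carrier X \<Longrightarrow> b x \<in> linear_maps Y Z"
  obtains g where "g \<in> linear_maps (tensor_product X Y) Z"
    "\<And>x y. x \<in> carrier X \<Longrightarrow> y \<in> carrier Y \<Longrightarrow> g (pure_tensor X Y x y) = b x y"
proof -
  interpret F: kspace pairs by (rule kspace_free_space)
  interpret Z: kspace Z by fact
  have "case_prod b z \<in> carrier Z" if "z \<in> carrier X \<times> carrier Y" for z
    using that linear_closed[OF r] by auto
  then obtain g where g: "g \<in> linear_maps pairs Z"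
    "\<And>x y. x \<in> carrier X \<Longrightarrow> y \<in> carrier Y \<Longrightarrow> g (Poly_Mapping.single (x, y) 1) = b x y"
    using free_space_lift[OF assms(1), of "carrier X \<times> carrier Y" "case_prod b"] by (metis (no_types, lifting) SigmaI case_prod_conv)
  have s: "Poly_Mapping.single (x, y) c \<in> carrier pairs" if "x \<in> carrier X" "y \<in> carrier Y" for x y c
    using that by simp
  have gs: "g (Poly_Mapping.single (x, y) c) = c \<odot>\<^bsub>Z\<^esub> b x y" if "x \<in> carrier X" "y \<in> carrier Y" for x y c
    using linear_smult[OF g(1) s[OF that, of 1], of c] g(2)[OF that] by (simp add: scale_single)
  note minus = free_space_linear_minus[OF assms(1) g(1)]
  have cl: "u - v \<in> carrier pairs" if "u \<in> carrier pairs" "v \<in> carrier pairs" for u v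
    using F.minus_closed[OF that] free_space_minus[OF that] by simp
  have b: "b x y \<in> carrier Z" if "x \<in> carrier X" "y \<in> carrier Y" for x y
    using linear_closed[OF r[OF that(1)] that(2)] .
  note cancel = Z.sum_minus_terms
  have "g u = \<zero>\<^bsub>Z\<^esub>" if "u \<in> bilinear_relations X Y" for u
    using that unfolding bilinear_relations_def
  proof (elim UnE CollectE exE conjE; hypsubst)
    fix x x' y assume *: "x \<in> carrier X" "x' \<in> carrier X" "y \<in> carrier Y"
    then show "g (Poly_Mapping.single (x \<oplus>\<^bsub>X\<^esub> x', y) 1 - Poly_Mapping.single (x, y) 1
       - Poly_Mapping.single (x', y) 1) = \<zero>\<^bsub>Z\<^esub>"
      by (simp only: minus cl s X.a_closed g(2) linear_add[OF l] cancel b)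
  next
    fix x y y' assume *: "x \<in> carrier X" "y \<in> carrier Y" "y' \<in> carrier Y"
    then show "g (Poly_Mapping.single (x, y \<oplus>\<^bsub>Y\<^esub> y') 1 - Poly_Mapping.single (x, y) 1
       - Poly_Mapping.single (x, y') 1) = \<zero>\<^bsub>Z\<^esub>"
      by (simp only: minus cl s Y.a_closed g(2) linear_add[OF r] cancel b)
  next
    fix c x y assume *: "x \<in> carrier X" "y \<in> carrier Y"
    then show "g (Poly_Mapping.single (c \<odot>\<^bsub>X\<^esub> x, y) 1 - Poly_Mapping.single (x, y) c) = \<zero>\<^bsub>Z\<^esub>"
      by (simp only: minus s X.smult_in gs Z.one_smult linear_smult[OF l] Z.smult_in b
          a_minus_def Z.r_neg)
  next
    fix c x y assume *: "x \<in> carrier X" "y \<in> carrier Y"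
    then show "g (Poly_Mapping.single (x, c \<odot>\<^bsub>Y\<^esub> y) 1 - Poly_Mapping.single (x, y) c) = \<zero>\<^bsub>Z\<^esub>"
      by (simp only: minus s Y.smult_in gs Z.one_smult linear_smult[OF r] Z.smult_in b
          a_minus_def Z.r_neg)
  qed
  then have "tensor_kernel X Y \<subseteq> {p \<in> carrier pairs. g p = \<zero>\<^bsub>Z\<^esub>}"
    unfolding tensor_kernel_def
    by (intro F.span_least[OF linear_kernel_subspace[OF F.kspace_axioms assms(1) g(1)]])
      (use bilinear_relations_closed in blast)
  then obtain h where "h \<in> linear_maps (tensor_product X Y) Z"
    "\<And>p. p \<in> carrier pairs \<Longrightarrow> h (tensor_kernel X Y +>\<^bsub>pairs\<^esub> p) = g p"
    using F.quotient_lift[OF tensor_kernel_subspace assms(1) g(1)]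
    unfolding tensor_product_def by blast
  then show ?thesis
    using that[of h] g(2) s unfolding pure_tensor_def by metis
qed

end

lemma id_tensor_map_linear:
  assumes "kspace X" "kspace Y" "kspace Z" "h \<in> linear_maps Y Z"
  shows "id_tensor_map X Y Z h \<in> linear_maps (tensor_product X Y) (tensor_product X Z)" (is ?A)
    and "x \<in> carrier X \<Longrightarrow> y \<in> carrier Y \<Longrightarrow>
      id_tensor_map X Y Z h (pure_tensor X Y x y) = pure_tensor X Z x (h y)" (is "_ \<Longrightarrow> _ \<Longrightarrow> ?B")
proof -
  interpret XY: kspace_pair X Y using assms by (simp add: kspace_pair_def)
  interpret XZ: kspace_pair X Z using assms by (simp add: kspace_pair_def)
  obtain g where g: "g \<in> linear_maps (tensor_product X Y) (tensor_product X Z)"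
    "\<And>x y. x \<in> carrier X \<Longrightarrow> y \<in> carrier Y \<Longrightarrow> g (pure_tensor X Y x y) = pure_tensor X Z x (h y)"
    by (rule XY.tensor_product_lift[OF XZ.kspace_tensor_product, of "\<lambda>x y. pure_tensor X Z x (h y)"])
      (auto intro: XZ.pure_tensor_linear_left linear_closed[OF assms(4)]
        linear_comp[OF assms(4) XZ.pure_tensor_linear_right])
  have eq: "id_tensor_map X Y Z h = restrict g (carrier (tensor_product X Y))"
    unfolding id_tensor_map_def
    by (rule the_linear_map_eq[OF XY.kspace_tensor_product g(1)])
      (use g(2) XY.pure_tensor_closed XY.tensor_product_eqI[OF XZ.kspace_tensor_product _ g(1)]
        in auto)
  show ?A unfolding eq by (rule linear_cong[OF g(1) XY.kspace_tensor_product]) simp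
  show ?B if "x \<in> carrier X" "y \<in> carrier Y"
    unfolding eq using that XY.pure_tensor_closed g(2) by simp
qed

text \<open>A left inverse of \<open>h\<close> gives one of \<open>id \<otimes> h\<close>, so no exactness of the tensor product is involved.\<close>

lemma id_tensor_map_inj:
  assumes "kspace X" "kspace Y" "kspace Z" "h \<in> linear_maps Y Z" "l \<in> linear_maps Z Y"
    and "\<And>y. y \<in> carrier Y \<Longrightarrow> l (h y) = y"
  shows "inj_on (id_tensor_map X Y Z h) (carrier (tensor_product X Y))"
proof (rule inj_on_inverseI)
  interpret XY: kspace_pair X Y using assms by (simp add: kspace_pair_def)
  note h = id_tensor_map_linear[OF assms(1-4)] and l = id_tensor_map_linear[OF assms(1,3,2,5)]
  show "id_tensor_map X Z Y l (id_tensor_map X Y Z h t) = t"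
    if "t \<in> carrier (tensor_product X Y)" for t
    by (rule XY.tensor_product_eqI[OF XY.kspace_tensor_product linear_comp[OF h(1) l(1)] linear_maps_id])
      (use that assms(6) h(2) l(2) linear_closed[OF assms(4)] in auto)
qed

lemma tensor_product_over_bilinear:
  assumes "kspace M" "kspace P" and closed: "balanced_relations A M P \<subseteq> carrier (free_space (carrier M \<times> carrier P))"
  shows "kspace (tensor_product_over A M P)"
    and "y \<in> carrier P \<Longrightarrow> (\<lambda>x. pure_tensor_over A M P x y) \<in> linear_maps M (tensor_product_over A M P)"
    and "x \<in> carrier M \<Longrightarrow> pure_tensor_over A M P x \<in> linear_maps P (tensor_product_over A M P)"
proof -
  interpret kspace_pair M P using assms by (simp add: kspace_pair_def)
  note b = coset_bilinear[of "bilinear_relations M P \<union> balanced_relations A M P",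
      OF Un_upper1 Un_least[OF bilinear_relations_closed closed]]
  show "kspace (tensor_product_over A M P)"
    and "y \<in> carrier P \<Longrightarrow> (\<lambda>x. pure_tensor_over A M P x y) \<in> linear_maps M (tensor_product_over A M P)"
    and "x \<in> carrier M \<Longrightarrow> pure_tensor_over A M P x \<in> linear_maps P (tensor_product_over A M P)"
    using b by (simp_all add: tensor_product_over_def tensor_kernel_over_def pure_tensor_over_def[abs_def])
qed

section \<open>Algebras, ideals and the tensor and exterior algebras\<close>

locale kalgebra = kspace X + ring X for X :: "('k::field, 'a, 'z) module_scheme" (structure) +
  assumes smult_mult_left: "x \<in> carrier X \<Longrightarrow> y \<in> carrier X \<Longrightarrow> (c \<odot> x) \<otimes> y = c \<odot> (x \<otimes> y)"
    and smult_mult_right: "x \<in> carrier X \<Longrightarrow> y \<in> carrier X \<Longrightarrow> x \<otimes> (c \<odot> y) = c \<odot> (x \<otimes> y)"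
begin

lemma mult_linear_left: "y \<in> carrier X \<Longrightarrow> (\<lambda>x. x \<otimes> y) \<in> linear_maps X X"
  by (rule linear_mapsI) (auto simp: l_distr smult_mult_left)

lemma mult_linear_right: "x \<in> carrier X \<Longrightarrow> (\<otimes>) x \<in> linear_maps X X"
  by (rule linear_mapsI) (auto simp: r_distr smult_mult_right)

lemma ideal_subspace:
  assumes "ideal I X"
  shows "submodule I scalar_ring X"
proof -
  interpret I: ideal I X by fact
  show ?thesis
  proof (rule subspaceI)
    fix c a assume a: "a \<in> I"
    have "c \<odot> a = (c \<odot> \<one>) \<otimes> a"
      using a I.a_subset by (auto simp: smult_mult_left)
    then show "c \<odot> a \<in> I" using a by (simp add: I.I_l_closed)
  qed (use I.a_subset I.a_closed in auto)
qed

lemma coset_mult: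
  assumes "ideal I X" "x \<in> carrier X" "y \<in> carrier X"
  shows "I +> (x \<otimes> y) = (I +> x) \<otimes>\<^bsub>quotient_space X I\<^esub> (I +> y)"
  using ideal.rcoset_mult_add[OF assms] by simp

lemma kalgebra_quotient:
  assumes "ideal I X"
  shows "kalgebra (quotient_space X I)"
proof -
  let ?Q = "quotient_space X I"
  interpret Q: kspace ?Q by (rule kspace_quotient[OF ideal_subspace[OF assms]])
  have one: "\<one>\<^bsub>?Q\<^esub> = I +> \<one>" by simp
  note rev = coset_mult[OF assms, symmetric] coset_add[OF ideal_subspace[OF assms], symmetric]
    coset_smult[OF ideal_subspace[OF assms], symmetric] one
  note [simp del] = quotient_space_simps(2-)
  show ?thesis
  proof (intro kalgebra.intro kalgebra_axioms.intro ringI)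
    show "abelian_group ?Q" by (rule Q.abelian_group_axioms)
    show "Group.monoid ?Q"
      by (rule monoidI) (auto simp: rev m_assoc)
    show "kspace ?Q" by (rule Q.kspace_axioms)
  qed (auto simp: rev l_distr r_distr smult_mult_left smult_mult_right)
qed

lemma coset_list_product:
  assumes "ideal I X" "\<And>v. h v \<in> carrier X"
  shows "list_product (quotient_space X I) (map (\<lambda>v. I +> h v) vs) = I +> list_product X (map h vs)"
    and "list_product X (map h vs) \<in> carrier X"
proof (induction vs)
  case (Cons v vs)
  {
    case 1
    then show ?case using Cons assms(2)
      by (simp add: list_product_def coset_mult[OF assms(1)] del: quotient_space_simps)
  next
    case 2
    then show ?case using Cons assms(2) by (simp add: list_product_def)
  }
qed (simp_all add: list_product_def)

text \<open>With a multiplicatively closed spanning set \<open>D\<close>, the span of the products \<open>a s b\<close>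
  is already stable under multiplication on both sides.\<close>

lemma genideal_subset_span:
  assumes D: "D \<subseteq> carrier X" "\<one> \<in> D" "\<And>a b. a \<in> D \<Longrightarrow> b \<in> D \<Longrightarrow> a \<otimes> b \<in> D"
      "carrier X \<subseteq> linear_span X D"
    and S: "S \<subseteq> carrier X"
  shows "genideal X S \<subseteq> linear_span X {a \<otimes> s \<otimes> b | a s b. a \<in> D \<and> s \<in> S \<and> b \<in> D}"
    (is "_ \<subseteq> linear_span X ?G")
proof (rule genideal_minimal)
  have G: "?G \<subseteq> carrier X" using D(1) S by blast
  note sub = subspaceD[OF span_subspace[OF G]]
  let ?H = "linear_span X ?G"
  have l: "a \<otimes> h \<in> ?H" if "a \<in> D" "h \<in> ?H" for a h
  proof -
    have a: "a \<in> carrier X" using that D(1) by auto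
    have "a \<otimes> h \<in> linear_span X ((\<otimes>) a ` ?G)"
      by (rule linear_image_span[OF kspace_axioms kspace_axioms mult_linear_right[OF a] G that(2)])
    moreover have "(\<otimes>) a ` ?G \<subseteq> ?G"
    proof clarify
      fix b s c assume *: "b \<in> D" "s \<in> S" "c \<in> D"
      then have "a \<otimes> (b \<otimes> s \<otimes> c) = (a \<otimes> b) \<otimes> s \<otimes> c"
        using D(1) S a by (simp add: m_assoc subset_iff)
      then show "\<exists>a' s' b'. a \<otimes> (b \<otimes> s \<otimes> c) = a' \<otimes> s' \<otimes> b' \<and> a' \<in> D \<and> s' \<in> S \<and> b' \<in> D"
        using * D(3)[OF that(1) *(1)] by blast
    qed
    ultimately show ?thesis
      using span_mono[OF subset_trans[OF _ span_superset] G] by blast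
  qed
  have r: "h \<otimes> a \<in> ?H" if "a \<in> D" "h \<in> ?H" for a h
  proof -
    have a: "a \<in> carrier X" using that D(1) by auto
    have "h \<otimes> a \<in> linear_span X ((\<lambda>h. h \<otimes> a) ` ?G)"
      by (rule linear_image_span[OF kspace_axioms kspace_axioms mult_linear_left[OF a] G that(2)])
    moreover have "(\<lambda>h. h \<otimes> a) ` ?G \<subseteq> ?G"
    proof clarify
      fix b s c assume *: "b \<in> D" "s \<in> S" "c \<in> D"
      then have "(b \<otimes> s \<otimes> c) \<otimes> a = b \<otimes> s \<otimes> (c \<otimes> a)"
        using D(1) S a by (simp add: m_assoc subset_iff)
      then show "\<exists>a' s' b'. (b \<otimes> s \<otimes> c) \<otimes> a = a' \<otimes> s' \<otimes> b' \<and> a' \<in> D \<and> s' \<in> S \<and> b' \<in> D"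
        using * D(3)[OF *(3) that(1)] by blast
    qed
    ultimately show ?thesis
      using span_mono[OF subset_trans[OF _ span_superset] G] by blast
  qed
  have lr: "x \<otimes> h \<in> ?H \<and> h \<otimes> x \<in> ?H" if x: "x \<in> carrier X" and h: "h \<in> ?H" for x h
  proof -
    have "x \<in> linear_span X D" using x D(4) by blast
    then show ?thesis using D(1)
    proof (induction rule: span_induct)
      case zero
      then show ?case using h sub by simp
    qed (use h l r sub in \<open>auto simp: l_distr r_distr smult_mult_left smult_mult_right\<close>)
  qed
  show "ideal ?H X"
    by (rule idealI[OF ring_axioms submodule.axioms(1)[OF span_subspace[OF G]]]) (use lr in auto)
  show "S \<subseteq> ?H"
  proof
    fix s assume s: "s \<in> S"
    then have "s = \<one> \<otimes> s \<otimes> \<one>" using S by auto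
    then have "s \<in> ?G" using s D(2) by blast
    then show "s \<in> ?H" by (rule subsetD[OF span_superset])
  qed
qed

end

subsection \<open>Tensors\<close>

lemma free_algebra_simps [simp]:
  "carrier free_algebra = UNIV" "zero free_algebra = 0" "add free_algebra = (+)"
  "one free_algebra = 1" "monoid.mult free_algebra = (*)"
  "smult free_algebra = (\<lambda>c. Poly_Mapping.map ((*) c))"
  by (simp_all add: free_algebra_def)

lemma linear_maps_free_algebra: "linear_maps free_algebra Z = linear_maps (free_space UNIV) Z"
  by (auto simp: linear_maps_def hom_def)

lemma kalgebra_free_algebra: "kalgebra (free_algebra :: ('k::field, 'v word \<Rightarrow>\<^sub>0 'k) module)"
proof -
  let ?F = "free_algebra :: ('k, 'v word \<Rightarrow>\<^sub>0 'k) module"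
  have k: "kspace ?F"
    by (rule kspace_image[OF kspace_free_space[of UNIV], where h = "\<lambda>x. x"]) auto
  have comm: "p * Poly_Mapping.single 0 c = Poly_Mapping.single 0 c * p" for p :: "'v word \<Rightarrow>\<^sub>0 'k" and c
  proof -
    have "(\<Sum>b\<in>Poly_Mapping.keys p. Poly_Mapping.single b (Poly_Mapping.lookup p b)) * Poly_Mapping.single 0 c
      = Poly_Mapping.single 0 c * (\<Sum>b\<in>Poly_Mapping.keys p. Poly_Mapping.single b (Poly_Mapping.lookup p b))"
      by (simp add: sum_distrib_left sum_distrib_right mult_single mult.commute)
    then show ?thesis by (simp add: sum_monomials)
  qed
  have "ring ?F"
  proof (rule ringI)
    show "abelian_group ?F" using k by (simp add: kspace_def module_def)
    show "Group.monoid ?F" by (rule monoidI) (auto simp: mult.assoc)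
  qed (auto simp: algebra_simps)
  moreover have "kalgebra_axioms ?F"
    by (rule kalgebra_axioms.intro) (simp_all add: mult_map_scale_conv_mult, (metis comm mult.assoc)+)
  ultimately show ?thesis
    by (intro kalgebra.intro k)
qed

lemma free_algebra_span:
  fixes p :: "'v word \<Rightarrow>\<^sub>0 'k::field"
  shows "p \<in> linear_span free_algebra (range (\<lambda>w. Poly_Mapping.single w 1))"
proof -
  interpret FA: kalgebra "free_algebra :: ('k, 'v word \<Rightarrow>\<^sub>0 'k) module" by (rule kalgebra_free_algebra)
  have id: "(\<lambda>p. p) \<in> linear_maps (free_space UNIV) (free_algebra :: ('k, 'v word \<Rightarrow>\<^sub>0 'k) module)"
    by (rule linear_mapsI) auto
  have "p \<in> linear_span free_algebra ((\<lambda>p. p) ` (\<lambda>w. Poly_Mapping.single w 1) ` UNIV)"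
    by (rule linear_image_span[OF kspace_free_space FA.kspace_axioms id]) (simp_all add: free_space_span)
  then show ?thesis by simp
qed

text \<open>Multilinearity in every slot, for functions on lists of all lengths together: this is what
  determines a linear map on the whole tensor algebra.\<close>

definition multilinear ::
    "('k::field \<Rightarrow> 'v::ab_group_add \<Rightarrow> 'v) \<Rightarrow> ('k, 'b, 'z) module_scheme \<Rightarrow> ('v list \<Rightarrow> 'b) \<Rightarrow> bool" where
  "multilinear scale Z F \<longleftrightarrow> (\<forall>vs. F vs \<in> carrier Z) \<and>
     (\<forall>xs v w ys. F (xs @ (v + w) # ys) = F (xs @ v # ys) \<oplus>\<^bsub>Z\<^esub> F (xs @ w # ys)) \<and>
     (\<forall>xs c v ys. F (xs @ scale c v # ys) = c \<odot>\<^bsub>Z\<^esub> F (xs @ v # ys))"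

lemma multilinear_linear_image:
  assumes "multilinear scale Y F" "g \<in> linear_maps Y Z"
  shows "multilinear scale Z (\<lambda>vs. g (F vs))"
  using assms(1) by (auto simp: multilinear_def linear_mapsD[OF assms(2)])

locale tensors =
  fixes scale :: "'k::field \<Rightarrow> 'v::ab_group_add \<Rightarrow> 'v"
begin

abbreviation "T \<equiv> tensor_algebra scale"
abbreviation "tw \<equiv> tensor_word scale"
abbreviation "V \<equiv> tensor_power scale"

definition letter_relations :: "('v word \<Rightarrow>\<^sub>0 'k) set" where
  "letter_relations =
     ({Poly_Mapping.single (Word [v + w]) 1 - Poly_Mapping.single (Word [v]) 1
         - Poly_Mapping.single (Word [w]) 1 | v w. True} \<union>
      {Poly_Mapping.single (Word [scale c v]) 1 - Poly_Mapping.single (Word [v]) c | c v. True})"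

lemma linearity_ideal_alt: "linearity_ideal scale = genideal free_algebra letter_relations"
  by (simp add: linearity_ideal_def letter_relations_def)

sublocale FA: kalgebra "free_algebra :: ('k, 'v word \<Rightarrow>\<^sub>0 'k) module"
  by (rule kalgebra_free_algebra)

lemma linearity_ideal: "ideal (linearity_ideal scale) free_algebra"
  unfolding linearity_ideal_alt by (rule FA.genideal_ideal) simp

lemma linearity_ideal_subspace: "submodule (linearity_ideal scale) scalar_ring free_algebra"
  by (rule FA.ideal_subspace[OF linearity_ideal])

sublocale T: kalgebra T
  unfolding tensor_algebra_def by (rule FA.kalgebra_quotient[OF linearity_ideal])

lemma tensor_word_coset: "tw vs = linearity_ideal scale +>\<^bsub>free_algebra\<^esub> Poly_Mapping.single (Word vs) 1"
proof -
  have "list_product free_algebra (map (\<lambda>v. Poly_Mapping.single (Word [v]) 1) vs)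
      = Poly_Mapping.single (Word vs) (1 :: 'k)"
    by (induction vs) (simp_all add: list_product_def mult_single plus_word_def zero_word_def[symmetric])
  then show ?thesis
    unfolding tensor_word_def tensor_algebra_def tensor_letter_def
    using FA.coset_list_product(1)[OF linearity_ideal, of "\<lambda>v. Poly_Mapping.single (Word [v]) 1" vs] by simp
qed

lemma coset_linearity_linear: "(\<lambda>p. linearity_ideal scale +>\<^bsub>free_algebra\<^esub> p) \<in> linear_maps free_algebra T"
  unfolding tensor_algebra_def by (rule FA.coset_linear[OF linearity_ideal_subspace])

lemma carrier_tensor_algebra: "carrier T = range (\<lambda>p. linearity_ideal scale +>\<^bsub>free_algebra\<^esub> p)"
  by (simp add: tensor_algebra_def)

lemma tensor_word_closed [simp]: "tw vs \<in> carrier T"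
  by (simp add: tensor_word_coset carrier_tensor_algebra)

lemma tensor_word_append: "tw (xs @ ys) = tw xs \<otimes>\<^bsub>T\<^esub> tw ys"
  unfolding tensor_word_coset tensor_algebra_def
  using FA.coset_mult[OF linearity_ideal, of "Poly_Mapping.single (Word xs) 1" "Poly_Mapping.single (Word ys) 1"]
  by (simp add: mult_single plus_word_def)

lemma tensor_word_Nil: "tw [] = \<one>\<^bsub>T\<^esub>"
  by (simp add: tensor_word_def list_product_def)

lemma free_algebra_minus: "x \<ominus>\<^bsub>free_algebra\<^esub> y = x - (y :: 'v word \<Rightarrow>\<^sub>0 'k)"
proof -
  have "\<ominus>\<^bsub>free_algebra\<^esub> y = (- 1) \<odot>\<^bsub>free_algebra\<^esub> y"
    using FA.minus_one_smult[of y] by simp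
  also have "\<dots> = - y" by (auto intro!: poly_mapping_eqI)
  finally show ?thesis by (simp add: a_minus_def)
qed

lemma letter_relation_eq:
  assumes "p - q \<in> letter_relations"
  shows "linearity_ideal scale +>\<^bsub>free_algebra\<^esub> p = linearity_ideal scale +>\<^bsub>free_algebra\<^esub> q"
  using FA.coset_eq_iff[OF linearity_ideal_subspace, of p q] assms FA.genideal_self[of letter_relations]
  by (auto simp: free_algebra_minus linearity_ideal_alt)

lemma tensor_letter_linear:
  "tw [v + w] = tw [v] \<oplus>\<^bsub>T\<^esub> tw [w]" "tw [scale c v] = c \<odot>\<^bsub>T\<^esub> tw [v]"
proof -
  note lin = linear_mapsD[OF coset_linearity_linear]
  have "tw [v + w] = linearity_ideal scale +>\<^bsub>free_algebra\<^esub>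
      (Poly_Mapping.single (Word [v]) 1 + Poly_Mapping.single (Word [w]) 1)"
    unfolding tensor_word_coset
    by (rule letter_relation_eq) (auto simp: letter_relations_def diff_diff_eq[symmetric])
  then show "tw [v + w] = tw [v] \<oplus>\<^bsub>T\<^esub> tw [w]"
    unfolding tensor_word_coset using lin(2) by simp
  have "tw [scale c v] = linearity_ideal scale +>\<^bsub>free_algebra\<^esub> (Poly_Mapping.single (Word [v]) c)"
    unfolding tensor_word_coset
    by (rule letter_relation_eq) (auto simp: letter_relations_def)
  then show "tw [scale c v] = c \<odot>\<^bsub>T\<^esub> tw [v]"
    unfolding tensor_word_coset using lin(3)[of "Poly_Mapping.single (Word [v]) 1" c]
    by (simp add: scale_single)
qed

lemma tensor_word_split: "tw (xs @ v # ys) = tw xs \<otimes>\<^bsub>T\<^esub> tw [v] \<otimes>\<^bsub>T\<^esub> tw ys"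
  using tensor_word_append[of xs "[v] @ ys"] tensor_word_append[of "[v]" ys] by (simp add: T.m_assoc)

lemma tensor_word_multilinear: "multilinear scale T tw"
  unfolding multilinear_def
  by (auto simp: tensor_word_split tensor_letter_linear T.l_distr T.r_distr
      T.smult_mult_left T.smult_mult_right)

lemma tensor_word_span: "carrier T \<subseteq> linear_span T (range tw)"
proof
  fix C assume "C \<in> carrier T"
  then obtain p where C: "C = linearity_ideal scale +>\<^bsub>free_algebra\<^esub> p"
    by (auto simp: carrier_tensor_algebra)
  from linear_image_span[OF FA.kspace_axioms T.kspace_axioms coset_linearity_linear _ free_algebra_span]
  have "C \<in> linear_span T ((\<lambda>p. linearity_ideal scale +>\<^bsub>free_algebra\<^esub> p) `
      range (\<lambda>b. Poly_Mapping.single b 1))"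
    unfolding C by simp
  moreover have "(\<lambda>p. linearity_ideal scale +>\<^bsub>free_algebra\<^esub> p) ` range (\<lambda>b. Poly_Mapping.single b 1)
      = range tw"
    by (auto simp: tensor_word_coset image_iff) (metis word.exhaust)
  ultimately show "C \<in> linear_span T (range tw)" by simp
qed

text \<open>The universal property: the linearity ideal is spanned by its generators multiplied by words
  on both sides, and on these a multilinear function vanishes.\<close>

lemma tensor_algebra_lift:
  assumes "kspace Z" "multilinear scale Z F"
  obtains g where "g \<in> linear_maps T Z" "\<And>vs. g (tw vs) = F vs"
proof -
  interpret Z: kspace Z by fact
  note F = assms(2)[unfolded multilinear_def]
  have Fc [simp]: "F vs \<in> carrier Z" for vs using F by blast
  obtain g where g0: "g \<in> linear_maps (free_space UNIV) Z"
    "\<And>w. w \<in> UNIV \<Longrightarrow> g (Poly_Mapping.single w 1) = F (letters w)"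
    by (rule free_space_lift[OF assms(1), of UNIV "\<lambda>w. F (letters w)"]) simp_all
  have g: "g \<in> linear_maps free_algebra Z" "g (Poly_Mapping.single w 1) = F (letters w)" for w
    using g0 by (simp_all add: linear_maps_free_algebra)
  have gs: "g (Poly_Mapping.single w c) = c \<odot>\<^bsub>Z\<^esub> F (letters w)" for w c
    using linear_smult[OF g(1), of "Poly_Mapping.single w 1" c] g(2)[of w] by (simp add: scale_single)
  have minus: "g (u - v) = g u \<ominus>\<^bsub>Z\<^esub> g v" for u v
    using free_space_linear_minus[OF assms(1) g0(1)] by simp
  note cancel = Z.sum_minus_terms
  let ?D = "range (\<lambda>w. Poly_Mapping.single w (1::'k)) :: ('v word \<Rightarrow>\<^sub>0 'k) set"
  have "linearity_ideal scale \<subseteq> linear_span free_algebra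
     {a \<otimes>\<^bsub>free_algebra\<^esub> s \<otimes>\<^bsub>free_algebra\<^esub> b | a s b. a \<in> ?D \<and> s \<in> letter_relations \<and> b \<in> ?D}"
    unfolding linearity_ideal_alt
  proof (rule FA.genideal_subset_span)
    show "\<one>\<^bsub>free_algebra\<^esub> \<in> ?D"
      by (auto simp: image_iff intro!: exI[of _ 0])
    show "carrier free_algebra \<subseteq> linear_span free_algebra ?D"
      using free_algebra_span by blast
  qed (auto simp: mult_single)
  also have "\<dots> \<subseteq> {p \<in> carrier free_algebra. g p = \<zero>\<^bsub>Z\<^esub>}"
  proof (rule FA.span_least[OF linear_kernel_subspace[OF FA.kspace_axioms assms(1) g(1)]], clarsimp)
    fix s and wa wb :: "'v word" assume s: "s \<in> letter_relations"
    obtain xs ys where w: "wa = Word xs" "wb = Word ys" by (metis word.exhaust)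
    from s show "g (Poly_Mapping.single wa 1 * s * Poly_Mapping.single wb 1) = \<zero>\<^bsub>Z\<^esub>"
      unfolding letter_relations_def
    proof (elim UnE CollectE exE conjE; hypsubst)
      fix v w
      show "g (Poly_Mapping.single wa 1 * (Poly_Mapping.single (Word [v + w]) 1 - Poly_Mapping.single (Word [v]) 1
         - Poly_Mapping.single (Word [w]) 1) * Poly_Mapping.single wb 1) = \<zero>\<^bsub>Z\<^esub>"
        using F by (simp add: w algebra_simps mult_single plus_word_def minus gs cancel
            diff_diff_eq[symmetric] del: diff_diff_eq)
    next
      fix c v
      show "g (Poly_Mapping.single wa 1 * (Poly_Mapping.single (Word [scale c v]) 1 - Poly_Mapping.single (Word [v]) c)
         * Poly_Mapping.single wb 1) = \<zero>\<^bsub>Z\<^esub>"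
        using F by (simp add: w algebra_simps mult_single plus_word_def minus gs a_minus_def Z.r_neg)
    qed
  qed
  finally have "\<And>p. p \<in> linearity_ideal scale \<Longrightarrow> g p = \<zero>\<^bsub>Z\<^esub>" by blast
  from FA.quotient_lift[OF linearity_ideal_subspace assms(1) g(1) this]
  obtain h where "h \<in> linear_maps T Z" "\<And>p. h (linearity_ideal scale +>\<^bsub>free_algebra\<^esub> p) = g p"
    unfolding tensor_algebra_def by auto
  then show ?thesis using that[of h] g(2) by (simp add: tensor_word_coset)
qed

subsection \<open>Exterior algebra\<close>

abbreviation "Ext \<equiv> exterior_algebra scale"

lemma exterior_ideal: "ideal (exterior_ideal scale) T"
  unfolding exterior_ideal_def by (rule T.genideal_ideal) auto

lemma exterior_ideal_subspace: "submodule (exterior_ideal scale) scalar_ring T"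
  by (rule T.ideal_subspace[OF exterior_ideal])

sublocale Ext: kalgebra Ext
  unfolding exterior_algebra_def by (rule T.kalgebra_quotient[OF exterior_ideal])

lemma tensor_letter_word: "tensor_letter scale v = tw [v]"
  by (simp add: tensor_word_coset tensor_letter_def)

lemma tensor_word_letters: "tw vs = list_product T (map (\<lambda>v. tw [v]) vs)"
  unfolding tensor_letter_word[symmetric] by (simp add: tensor_word_def)

lemma wedge_coset: "wedge scale vs = exterior_ideal scale +>\<^bsub>T\<^esub> tw vs"
  unfolding wedge_def exterior_algebra_def
  using T.coset_list_product(1)[OF exterior_ideal, of "\<lambda>v. tw [v]" vs]
  by (simp add: tensor_word_letters[symmetric] tensor_letter_word)

lemma wedge_projection: "(\<lambda>t. exterior_ideal scale +>\<^bsub>T\<^esub> t) \<in> linear_maps T Ext"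
  unfolding exterior_algebra_def by (rule T.coset_linear[OF exterior_ideal_subspace])

lemma wedge_closed [simp]: "wedge scale vs \<in> carrier Ext"
  using linear_closed[OF wedge_projection tensor_word_closed] by (simp add: wedge_coset)

lemma wedge_multilinear: "multilinear scale Ext (wedge scale)"
  unfolding wedge_coset[abs_def]
  by (rule multilinear_linear_image[OF tensor_word_multilinear wedge_projection])

lemma wedge_adjacent_equal: "wedge scale (xs @ v # v # ys) = \<zero>\<^bsub>Ext\<^esub>"
proof -
  interpret I: ideal "exterior_ideal scale" T by (rule exterior_ideal)
  have "tw [v, v] \<in> exterior_ideal scale"
    unfolding exterior_ideal_def by (rule subsetD[OF T.genideal_self]) auto
  then have "tw xs \<otimes>\<^bsub>T\<^esub> tw [v, v] \<otimes>\<^bsub>T\<^esub> tw ys \<in> exterior_ideal scale"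
    by (simp add: I.I_l_closed I.I_r_closed)
  also have "tw xs \<otimes>\<^bsub>T\<^esub> tw [v, v] \<otimes>\<^bsub>T\<^esub> tw ys = tw (xs @ v # v # ys)"
    by (simp add: tensor_word_append[symmetric])
  finally show ?thesis
    unfolding wedge_coset by (simp add: T.coset_zero[OF exterior_ideal_subspace] exterior_algebra_def)
qed

text \<open>The exterior ideal is spanned by the words with two equal neighbouring letters, for the same reason
  for which the linearity ideal is spanned by the relations between words.\<close>

lemma exterior_algebra_lift:
  assumes "kspace Z" "multilinear scale Z F" and alt: "\<And>xs v ys. F (xs @ v # v # ys) = \<zero>\<^bsub>Z\<^esub>"
  obtains g where "g \<in> linear_maps Ext Z" "\<And>vs. g (wedge scale vs) = F vs"
proof -
  interpret Z: kspace Z by fact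
  obtain h where h: "h \<in> linear_maps T Z" "\<And>vs. h (tw vs) = F vs"
    using tensor_algebra_lift[OF assms(1,2)] by blast
  have "exterior_ideal scale \<subseteq> linear_span T {a \<otimes>\<^bsub>T\<^esub> s \<otimes>\<^bsub>T\<^esub> b | a s b.
      a \<in> range tw \<and> s \<in> {tw [v, v] | v. True} \<and> b \<in> range tw}"
    unfolding exterior_ideal_def
  proof (rule T.genideal_subset_span[OF _ _ _ tensor_word_span])
    show "\<one>\<^bsub>T\<^esub> \<in> range tw" by (metis tensor_word_Nil rangeI)
    show "a \<otimes>\<^bsub>T\<^esub> b \<in> range tw" if "a \<in> range tw" "b \<in> range tw" for a b
      using that by (auto simp: tensor_word_append[symmetric])
  qed auto
  also have "\<dots> \<subseteq> {t \<in> carrier T. h t = \<zero>\<^bsub>Z\<^esub>}"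
    by (rule T.span_least[OF linear_kernel_subspace[OF T.kspace_axioms assms(1) h(1)]])
      (auto simp: tensor_word_append[symmetric] h(2) alt)
  finally have "\<And>t. t \<in> exterior_ideal scale \<Longrightarrow> h t = \<zero>\<^bsub>Z\<^esub>" by blast
  from T.quotient_lift[OF exterior_ideal_subspace assms(1) h(1) this]
  obtain g where "g \<in> linear_maps Ext Z" "\<And>t. t \<in> carrier T \<Longrightarrow> g (exterior_ideal scale +>\<^bsub>T\<^esub> t) = h t"
    unfolding exterior_algebra_def by auto
  then show ?thesis using that[of g] h(2) by (simp add: wedge_coset)
qed

subsection \<open>Homogeneous components\<close>

lemma words_closed: "{tw vs | vs. length vs = r} \<subseteq> carrier T"
  by auto

lemma tensor_power_subset: "V r \<subseteq> carrier T"
  unfolding tensor_power_def by (rule T.span_subset_carrier) auto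

lemma tensor_power_subspace: "submodule (V r) scalar_ring T"
  unfolding tensor_power_def by (rule T.span_subspace) auto

lemma tensor_word_in_power: "length vs = r \<Longrightarrow> tw vs \<in> V r"
  unfolding tensor_power_def by (rule subsetD[OF T.span_superset]) auto

lemma tensor_power_eqI:
  assumes "kspace Z" "g \<in> linear_maps T Z" "h \<in> linear_maps T Z"
    and "\<And>vs. length vs = r \<Longrightarrow> g (tw vs) = h (tw vs)" and "t \<in> V r"
  shows "g t = h t"
  by (rule linear_eq_on_span[OF T.kspace_axioms assms(1), of "{tw vs | vs. length vs = r}"])
    (use assms tensor_power_subset[of r] in \<open>auto simp: tensor_power_def[symmetric] intro!: linear_restrict_domain\<close>)

lemma tensor_power_mult:
  assumes "s \<in> V a" "t \<in> V b"
  shows "s \<otimes>\<^bsub>T\<^esub> t \<in> V (a + b)"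
proof -
  note sub = T.subspaceD[OF tensor_power_subspace[of "a + b"]]
  have 1: "tw xs \<otimes>\<^bsub>T\<^esub> t \<in> V (a + b)" if "length xs = a" for xs
    using assms(2)[unfolded tensor_power_def] words_closed
  proof (induction rule: T.span_induct)
    case (base x)
    then show ?case using that by (auto simp: tensor_word_append[symmetric] intro!: tensor_word_in_power)
  qed (auto simp: sub T.r_distr T.smult_mult_right)
  have t: "t \<in> carrier T" using assms(2) tensor_power_subset by blast
  show ?thesis
    using assms(1)[unfolded tensor_power_def] words_closed
  proof (induction rule: T.span_induct)
    case (base x)
    then show ?case using 1 by auto
  qed (use t in \<open>auto simp: sub T.l_distr T.smult_mult_left\<close>)
qed

lemma tensor_power_zero:
  assumes "t \<in> V 0"
  obtains c where "t = c \<odot>\<^bsub>T\<^esub> \<one>\<^bsub>T\<^esub>"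
proof -
  have "\<exists>c. t = c \<odot>\<^bsub>T\<^esub> \<one>\<^bsub>T\<^esub>"
    using assms[unfolded tensor_power_def] words_closed
  proof (induction rule: T.span_induct)
    case (base x)
    then show ?case by (auto simp: tensor_word_Nil intro!: exI[of _ 1])
  next
    case zero
    then show ?case by (auto intro!: exI[of _ 0])
  next
    case (add x y)
    then show ?case using T.smult_add_left[of "\<one>\<^bsub>T\<^esub>"] by (metis T.one_closed)
  next
    case (smult c x)
    then show ?case using T.smult_smult[of "\<one>\<^bsub>T\<^esub>"] by (metis T.one_closed)
  qed
  then show ?thesis using that by blast
qed

lemma wedge_span_subspace: "submodule (linear_span Ext {wedge scale vs | vs. length vs = r}) scalar_ring Ext"
  by (rule Ext.span_subspace) auto

lemma carrier_exterior_power: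
  "carrier (exterior_power scale r) = linear_span Ext {wedge scale vs | vs. length vs = r}"
  by (simp add: exterior_power_def)

lemma exterior_power_subset: "carrier (exterior_power scale r) \<subseteq> carrier Ext"
  unfolding carrier_exterior_power by (rule Ext.span_subset_carrier) auto

lemma kspace_exterior_power: "kspace (exterior_power scale r)"
  unfolding exterior_power_def by (rule Ext.subspace_kspace[OF wedge_span_subspace])

lemma wedge_in_power: "length vs = r \<Longrightarrow> wedge scale vs \<in> carrier (exterior_power scale r)"
  unfolding carrier_exterior_power by (rule subsetD[OF Ext.span_superset]) auto

end

section \<open>Permutations of an initial segment\<close>

abbreviation perms :: "nat \<Rightarrow> (nat \<Rightarrow> nat) set" where
  "perms r \<equiv> {\<sigma>. \<sigma> permutes {1..r}}"

abbreviation swap_adj :: "nat \<Rightarrow> nat \<Rightarrow> nat" where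
  "swap_adj i \<equiv> Transposition.transpose i (Suc i)"

lemma finite_perms [simp]: "finite (perms r)"
  by (simp add: finite_permutations)

lemmas finite_perms_Suc [simp] = finite_perms[unfolded One_nat_def]

lemma permutation_if_permutes: "\<sigma> permutes {1..r} \<Longrightarrow> permutation \<sigma>" for r :: nat
  using permutes_imp_permutation[of "{1..r}" \<sigma>] by simp

lemma swap_adj_permutes: "1 \<le> i \<Longrightarrow> i < r \<Longrightarrow> swap_adj i permutes {1..r}"
  by (rule permutes_swap_id) auto

lemma sign_comp_swap_adj: "permutation \<sigma> \<Longrightarrow> sign (\<sigma> \<circ> swap_adj i) = - sign \<sigma>"
  by (simp only: sign_compose permutation_swap_id sign_swap_id) simp

text \<open>Every transposition is a product of neighbouring ones, and a property that is passed
  on by right multiplication with \<open>\<tau>\<close> and with \<open>\<tau>'\<close> is passed on by right multiplication with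
  \<open>\<tau> \<tau>'\<close>.\<close>

lemma permutes_adjacent_induct [consumes 1, case_names id swap]:
  fixes r :: nat
  assumes "\<sigma> permutes {1..r}" and "Q id"
    and step: "\<And>\<sigma> i. \<sigma> permutes {1..r} \<Longrightarrow> Q \<sigma> \<Longrightarrow> 1 \<le> i \<Longrightarrow> i < r \<Longrightarrow> Q (\<sigma> \<circ> swap_adj i)"
  shows "Q \<sigma>"
proof -
  define S where "S \<tau> \<longleftrightarrow> \<tau> permutes {1..r} \<and> (\<forall>\<sigma>. \<sigma> permutes {1..r} \<longrightarrow> Q \<sigma> \<longrightarrow> Q (\<sigma> \<circ> \<tau>))" for \<tau>
  have comp: "S (\<tau> \<circ> \<tau>')" if "S \<tau>" "S \<tau>'" for \<tau> \<tau>'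
    using that unfolding S_def by (metis comp_assoc permutes_compose)
  have adj: "S (swap_adj i)" if "1 \<le> i" "i < r" for i
    using that step swap_adj_permutes unfolding S_def by blast
  have seq: "S (apply_adj_transps xs)" if "set xs \<subseteq> {1..<r}" for xs
    using that
  proof (induction xs)
    case Nil
    show ?case unfolding S_def apply_adj_transps_Nil by (simp only: permutes_id comp_id) blast
  next
    case (Cons x xs)
    then have "S (swap_adj x \<circ> apply_adj_transps xs)" by (intro comp adj) auto
    then show ?case by (simp only: apply_adj_transps_Cons Suc_eq_plus1)
  qed
  have less: "S (Transposition.transpose a b)" if "a \<in> {1..r}" "b \<in> {1..r}" "a < b" for a b
    using seq[of "adj_transp_seq a b"] that
    by (auto simp: adj_transp_seq_correct[OF that(3)] set_adj_transp_seq[OF that(3)])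
  have all: "S (Transposition.transpose a b)" if "a \<in> {1..r}" "b \<in> {1..r}" "a \<noteq> b" for a b
    using less[of a b] less[of b a] that by (metis linorder_neqE_nat transpose_commute)
  show ?thesis
  proof (rule permutes_rev_induct[of "{1..r}" \<sigma> Q])
    show "Q (p \<circ> Transposition.transpose a b)"
      if "a \<in> {1..r}" "b \<in> {1..r}" "a \<noteq> b" "Q p" "p permutes {1..r}" for a b p
      using all[OF that(1-3)] that unfolding S_def by blast
  qed (use assms in auto)
qed

text \<open>An increasing enumeration of a finite set is unique; this gives the uniqueness of sorting
  permutations and of shuffles.\<close>

lemma strict_mono_on_same_image:
  fixes f g :: "nat \<Rightarrow> nat"
  assumes "strict_mono_on {a..b} f" "strict_mono_on {a..b} g" "f ` {a..b} = g ` {a..b}"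
    and "j \<in> {a..b}"
  shows "f j = g j"
proof -
  have srt: "sorted (map h [a..<Suc b]) \<and> distinct (map h [a..<Suc b])"
    if "strict_mono_on {a..b} h" for h :: "nat \<Rightarrow> nat"
  proof -
    have "sorted_wrt (<) (map h [a..<Suc b])"
      unfolding sorted_wrt_map
      by (rule sorted_wrt_mono_rel[OF _ sorted_wrt_upt]) (use that in \<open>auto simp: strict_mono_on_def\<close>)
    then show ?thesis by (simp add: strict_sorted_iff)
  qed
  have "set [a..<Suc b] = {a..b}" by auto
  then have "map f [a..<Suc b] = map g [a..<Suc b]"
    using srt[OF assms(1)] srt[OF assms(2)] assms(3)
    by (intro sorted_distinct_set_unique) (simp_all only: set_map)
  then have "\<forall>x\<in>set [a..<Suc b]. f x = g x" by (simp only: map_eq_conv)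
  then show ?thesis using assms(4) \<open>set [a..<Suc b] = {a..b}\<close> by blast
qed

lemma permutes_strict_mono_id:
  fixes r :: nat
  assumes "\<sigma> permutes {1..r}" "strict_mono_on {1..r} \<sigma>"
  shows "\<sigma> = id"
proof
  fix j
  show "\<sigma> j = id j"
  proof (cases "j \<in> {1..r}")
    case True
    have "\<sigma> ` {1..r} = id ` {1..r}" using permutes_image[OF assms(1)] by simp
    then show ?thesis
      using strict_mono_on_same_image[OF assms(2) _ _ True, of id] by (simp add: strict_mono_on_def)
  next
    case False
    then show ?thesis using permutes_not_in[OF assms(1)] by simp
  qed
qed

lemma ex_sorting_permutation:
  fixes u :: "nat \<Rightarrow> nat"
  assumes "inj_on u {1..r}"
  obtains \<sigma> where "\<sigma> permutes {1..r}" "strict_mono_on {1..r} (u \<circ> \<sigma>)"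
proof -
  define xs where "xs = sorted_list_of_set (u ` {1..r})"
  have xs: "sorted_wrt (<) xs" "set xs = u ` {1..r}" "length xs = r"
    using card_image[OF assms] by (simp_all add: xs_def)
  define \<sigma> where "\<sigma> j = (if j \<in> {1..r} then inv_into {1..r} u (xs ! (j - 1)) else j)" for j
  have in_img: "xs ! (j - 1) \<in> u ` {1..r}" if "j \<in> {1..r}" for j
    using that xs(2,3) nth_mem[of "j - 1" xs] by auto
  have u\<sigma>: "u (\<sigma> j) = xs ! (j - 1)" if "j \<in> {1..r}" for j
    using that f_inv_into_f[OF in_img[OF that]] by (simp add: \<sigma>_def)
  have mono: "strict_mono_on {1..r} (u \<circ> \<sigma>)"
  proof (rule strict_mono_onI)
    fix i j assume *: "i \<in> {1..r}" "j \<in> {1..r}" "i < j"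
    then have "xs ! (i - 1) < xs ! (j - 1)"
      using sorted_wrt_nth_less[OF xs(1), of "i - 1" "j - 1"] xs(3) by auto
    then show "(u \<circ> \<sigma>) i < (u \<circ> \<sigma>) j" using u\<sigma> * by simp
  qed
  have "inj_on \<sigma> {1..r}"
    using strict_mono_on_imp_inj_on[OF mono] inj_on_imageI2 by blast
  moreover have "\<sigma> ` {1..r} \<subseteq> {1..r}"
    using inv_into_into[OF in_img] by (auto simp: \<sigma>_def)
  ultimately have "bij_betw \<sigma> {1..r} {1..r}"
    by (simp add: bij_betw_def endo_inj_surj)
  then have "\<sigma> permutes {1..r}"
    by (rule bij_imp_permutes) (simp only: \<sigma>_def if_False)
  with mono that show ?thesis by blast
qed

subsection \<open>Shuffles as coset representatives\<close>

definition shift_perm :: "nat \<Rightarrow> (nat \<Rightarrow> nat) \<Rightarrow> nat \<Rightarrow> nat" where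
  "shift_perm a \<beta> j = (if a < j then a + \<beta> (j - a) else j)"

lemma perms_less_iff: "\<beta> permutes {1..b} \<Longrightarrow> 0 < \<beta> j \<longleftrightarrow> 0 < j" for b :: nat
  using permutes_in_image[of \<beta> "{1..b}" j] permutes_not_in[of \<beta> "{1..b}" j] by (cases "j \<in> {1..b}") auto

lemma shift_perm_eq:
  assumes "\<beta> permutes {1..b}"
  shows "shift_perm a \<beta> = map_permutation {1..b} ((+) a) \<beta>"
proof
  have inj: "inj_on ((+) a) {1..b}" by simp
  have perm: "map_permutation {1..b} ((+) a) \<beta> permutes (+) a ` {1..b}"
    by (rule map_permutation_permutes[OF inj_on_imp_bij_betw[OF inj] assms])
  fix x
  show "shift_perm a \<beta> x = map_permutation {1..b} ((+) a) \<beta> x"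
  proof (cases "x \<in> (+) a ` {1..b}")
    case True
    then obtain j where "j \<in> {1..b}" "x = a + j" by blast
    then show ?thesis using map_permutation_apply[OF inj] by (simp add: shift_perm_def)
  next
    case False
    then have "a < x \<Longrightarrow> x - a \<notin> {1..b}" by (auto simp: image_iff)
    then show ?thesis
      using permutes_not_in[OF perm False] permutes_not_in[OF assms, of "x - a"]
      by (auto simp: shift_perm_def)
  qed
qed

lemma shift_perm_permutes: "\<beta> permutes {1..b} \<Longrightarrow> shift_perm a \<beta> permutes {a + 1..a + b}"
  unfolding shift_perm_eq by (rule map_permutation_permutes) (simp add: bij_betw_def)

lemma sign_shift_perm: "\<beta> permutes {1..b} \<Longrightarrow> sign (shift_perm a \<beta>) = sign \<beta>"
  unfolding shift_perm_eq by (rule sign_map_permutation) simp_all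

definition unshuffle :: "nat \<Rightarrow> (nat \<Rightarrow> nat) \<times> (nat \<Rightarrow> nat) \<times> (nat \<Rightarrow> nat) \<Rightarrow> nat \<Rightarrow> nat" where
  "unshuffle a = (\<lambda>(\<tau>, \<alpha>, \<beta>). \<tau> \<circ> (\<alpha> \<circ> shift_perm a \<beta>))"

lemma shuffle_perms_subset: "shuffle_perms a b \<subseteq> perms (a + b)"
  by (auto simp: shuffle_perms_def)

lemma finite_shuffle_perms [simp]: "finite (shuffle_perms a b)"
  by (rule finite_subset[OF shuffle_perms_subset finite_perms])

lemma block_permutes:
  assumes "\<alpha> permutes {1..a}" "\<beta> permutes {1..b}"
  shows "\<alpha> \<circ> shift_perm a \<beta> permutes {1..a + b}"
  by (intro permutes_compose permutes_subset[OF shift_perm_permutes[OF assms(2)]]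
      permutes_subset[OF assms(1)]) auto

lemma block_apply:
  assumes "\<alpha> permutes {1..a}" "\<beta> permutes {1..b}"
  shows "j \<le> a \<Longrightarrow> (\<alpha> \<circ> shift_perm a \<beta>) j = \<alpha> j"
    and "0 < j \<Longrightarrow> (\<alpha> \<circ> shift_perm a \<beta>) (a + j) = a + \<beta> j"
  using permutes_not_in[OF assms(1), of "a + \<beta> j"] perms_less_iff[OF assms(2), of j]
  by (auto simp: shift_perm_def)

lemma sign_unshuffle:
  assumes "\<tau> \<in> shuffle_perms a b" "\<alpha> permutes {1..a}" "\<beta> permutes {1..b}"
  shows "sign (unshuffle a (\<tau>, \<alpha>, \<beta>)) = sign \<tau> * (sign \<alpha> * sign \<beta>)"
proof -
  have "permutation \<tau>" "permutation \<alpha>" "permutation (\<alpha> \<circ> shift_perm a \<beta>)"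
    using assms shuffle_perms_subset[of a b] permutation_if_permutes block_permutes[OF assms(2,3)] by blast+
  moreover have "permutation (shift_perm a \<beta>)"
    using permutes_imp_permutation[OF _ shift_perm_permutes[OF assms(3)]] by simp
  ultimately show ?thesis
    by (simp add: unshuffle_def sign_compose sign_shift_perm[OF assms(3)])
qed

lemma block_image:
  assumes "\<alpha> permutes {1..a}" "\<beta> permutes {1..b}"
  shows "(\<alpha> \<circ> shift_perm a \<beta>) ` {1..a} = {1..a}"
    and "(\<alpha> \<circ> shift_perm a \<beta>) ` {a + 1..a + b} = {a + 1..a + b}"
proof -
  have "(\<alpha> \<circ> shift_perm a \<beta>) ` {1..a} = \<alpha> ` {1..a}"
    by (rule image_cong) (use block_apply(1)[OF assms] in auto)
  then show "(\<alpha> \<circ> shift_perm a \<beta>) ` {1..a} = {1..a}" using permutes_image[OF assms(1)] by simp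
  have "(\<alpha> \<circ> shift_perm a \<beta>) ` {a + 1..a + b} = shift_perm a \<beta> ` {a + 1..a + b}"
    by (rule image_cong) (use permutes_not_in[OF assms(1)] perms_less_iff[OF assms(2)] in \<open>auto simp: shift_perm_def\<close>)
  then show "(\<alpha> \<circ> shift_perm a \<beta>) ` {a + 1..a + b} = {a + 1..a + b}"
    using permutes_image[OF shift_perm_permutes[OF assms(2)]] by simp
qed

text \<open>Sorting the values of a permutation separately on the two blocks leaves a shuffle, and the
  two sorting permutations are unique.\<close>

lemma bij_unshuffle:
  "bij_betw (unshuffle a) (shuffle_perms a b \<times> perms a \<times> perms b) (perms (a + b))"
  (is "bij_betw _ ?D _")
  unfolding bij_betw_def
proof
  show "inj_on (unshuffle a) ?D"
  proof (rule inj_onI)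
    fix z z' assume z: "z \<in> ?D" "z' \<in> ?D" "unshuffle a z = unshuffle a z'"
    obtain \<tau> \<alpha> \<beta> \<tau>' \<alpha>' \<beta>' where zz: "z = (\<tau>, \<alpha>, \<beta>)" "z' = (\<tau>', \<alpha>', \<beta>')"
      by (metis prod_cases3)
    have \<tau>: "\<tau> \<in> shuffle_perms a b" "\<tau>' \<in> shuffle_perms a b"
      and \<alpha>: "\<alpha> permutes {1..a}" "\<alpha>' permutes {1..a}" and \<beta>: "\<beta> permutes {1..b}" "\<beta>' permutes {1..b}"
      and eq: "unshuffle a (\<tau>, \<alpha>, \<beta>) = unshuffle a (\<tau>', \<alpha>', \<beta>')"
      using z unfolding zz by blast+
    let ?g = "\<alpha> \<circ> shift_perm a \<beta>" and ?g' = "\<alpha>' \<circ> shift_perm a \<beta>'"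
    have eq: "\<tau> \<circ> ?g = \<tau>' \<circ> ?g'" using eq by (simp add: unshuffle_def)
    have img: "\<tau> ` S = \<tau>' ` S" if "?g ` S = S" "?g' ` S = S" for S
      using that eq by (metis image_comp)
    have "\<tau> j = \<tau>' j" for j
    proof -
      consider "j \<in> {1..a}" | "j \<in> {a + 1..a + b}" | "j \<notin> {1..a + b}" by fastforce
      then show ?thesis
      proof cases
        case 1
        then show ?thesis
          using strict_mono_on_same_image[of 1 a \<tau> \<tau>' j] \<tau> img[of "{1..a}"]
            block_image(1)[OF \<alpha>(1) \<beta>(1)] block_image(1)[OF \<alpha>(2) \<beta>(2)]
          unfolding shuffle_perms_def by blast
      next
        case 2
        then show ?thesis
          using strict_mono_on_same_image[of "a + 1" "a + b" \<tau> \<tau>' j] \<tau> img[of "{a + 1..a + b}"]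
            block_image(2)[OF \<alpha>(1) \<beta>(1)] block_image(2)[OF \<alpha>(2) \<beta>(2)]
          unfolding shuffle_perms_def by blast
      next
        case 3
        then show ?thesis
          using \<tau> permutes_not_in[of \<tau> "{1..a + b}" j] permutes_not_in[of \<tau>' "{1..a + b}" j]
          unfolding shuffle_perms_def by simp
      qed
    qed
    then have t: "\<tau> = \<tau>'" by blast
    have "inj \<tau>'" using \<tau>(2) permutes_inj unfolding shuffle_perms_def by blast
    then have g: "?g j = ?g' j" for j
      using fun_cong[OF eq, of j] unfolding t by (simp add: inj_eq)
    have "\<alpha> j = \<alpha>' j" for j
    proof (cases "j \<le> a")
      case True
      then show ?thesis using g[of j] block_apply(1)[OF \<alpha>(1) \<beta>(1)] block_apply(1)[OF \<alpha>(2) \<beta>(2)] by simp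
    next
      case False
      then show ?thesis using permutes_not_in[OF \<alpha>(1), of j] permutes_not_in[OF \<alpha>(2), of j] by simp
    qed
    moreover have "\<beta> j = \<beta>' j" for j
    proof (cases "0 < j")
      case True
      then show ?thesis
        using g[of "a + j"] block_apply(2)[OF \<alpha>(1) \<beta>(1)] block_apply(2)[OF \<alpha>(2) \<beta>(2)] by simp
    next
      case False
      then show ?thesis using permutes_not_in[OF \<beta>(1), of j] permutes_not_in[OF \<beta>(2), of j] by simp
    qed
    ultimately show "z = z'" using t unfolding zz by blast
  qed
  show "unshuffle a ` ?D = perms (a + b)"
  proof
    show "unshuffle a ` ?D \<subseteq> perms (a + b)"
      using permutes_compose[OF block_permutes] shuffle_perms_subset[of a b]
      by (fastforce simp: unshuffle_def)
    show "perms (a + b) \<subseteq> unshuffle a ` ?D"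
    proof
      fix \<sigma> assume "\<sigma> \<in> perms (a + b)"
      then have \<sigma>: "\<sigma> permutes {1..a + b}" by simp
      have inj: "inj \<sigma>" by (rule permutes_inj[OF \<sigma>])
      have "inj_on \<sigma> {1..a}" by (rule inj_on_subset[OF inj]) simp
      then obtain \<alpha> where \<alpha>: "\<alpha> permutes {1..a}" "strict_mono_on {1..a} (\<sigma> \<circ> \<alpha>)"
        by (rule ex_sorting_permutation)
      have "inj_on (\<lambda>j. \<sigma> (a + j)) {1..b}"
        by (rule inj_onI) (use inj in \<open>auto simp: inj_eq\<close>)
      then obtain \<beta> where \<beta>: "\<beta> permutes {1..b}" "strict_mono_on {1..b} ((\<lambda>j. \<sigma> (a + j)) \<circ> \<beta>)"
        by (rule ex_sorting_permutation)
      let ?g = "\<alpha> \<circ> shift_perm a \<beta>" and ?g' = "inv_into UNIV \<alpha> \<circ> shift_perm a (inv_into UNIV \<beta>)"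
      have \<alpha>': "inv_into UNIV \<alpha> permutes {1..a}" and \<beta>': "inv_into UNIV \<beta> permutes {1..b}"
        using \<alpha> \<beta> permutes_inv by blast+
      have "(?g \<circ> ?g') j = j" for j
      proof (cases "j \<le> a")
        case True
        have "inv_into UNIV \<alpha> j \<le> a" using True permutes_in_image[OF \<alpha>', of j] permutes_not_in[OF \<alpha>', of j]
          by (cases "j \<in> {1..a}") auto
        then show ?thesis
          using True block_apply(1)[OF \<alpha>(1) \<beta>(1), of "inv_into UNIV \<alpha> j"] block_apply(1)[OF \<alpha>' \<beta>', of j]
            permutes_inverses(1)[OF \<alpha>(1)] by simp
      next
        case False
        then obtain i where i: "j = a + i" "0 < i" by (metis less_imp_add_positive not_le)
        then show ?thesis
          using block_apply(2)[OF \<alpha>(1) \<beta>(1), of "inv_into UNIV \<beta> i"] block_apply(2)[OF \<alpha>' \<beta>', of i]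
            permutes_inverses(1)[OF \<beta>(1)] perms_less_iff[OF \<beta>', of i] by simp
      qed
      then have gg: "?g \<circ> ?g' = id" by auto
      have "strict_mono_on {1..a} (\<sigma> \<circ> ?g)"
        using \<alpha>(2) block_apply(1)[OF \<alpha>(1) \<beta>(1)] by (auto simp: strict_mono_on_def)
      moreover have "strict_mono_on {a + 1..a + b} (\<sigma> \<circ> ?g)"
      proof (rule strict_mono_onI)
        fix i j assume *: "i \<in> {a + 1..a + b}" "j \<in> {a + 1..a + b}" "i < j"
        define i' j' where "i' = i - a" and "j' = j - a"
        have ij: "i = a + i'" "j = a + j'" "i' \<in> {1..b}" "j' \<in> {1..b}" "i' < j'"
          using * by (auto simp: i'_def j'_def)
        show "(\<sigma> \<circ> ?g) i < (\<sigma> \<circ> ?g) j"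
          using strict_mono_onD[OF \<beta>(2) ij(3-5)] block_apply(2)[OF \<alpha>(1) \<beta>(1), of i']
            block_apply(2)[OF \<alpha>(1) \<beta>(1), of j'] ij by simp
      qed
      ultimately have "\<sigma> \<circ> ?g \<in> shuffle_perms a b"
        using permutes_compose[OF block_permutes[OF \<alpha>(1) \<beta>(1)] \<sigma>] by (simp add: shuffle_perms_def)
      moreover have "\<sigma> = unshuffle a (\<sigma> \<circ> ?g, inv_into UNIV \<alpha>, inv_into UNIV \<beta>)"
        unfolding unshuffle_def using gg by (simp add: comp_assoc)
      ultimately show "\<sigma> \<in> unshuffle a ` ?D" using \<alpha>' \<beta>' by blast
    qed
  qed
qed

subsection \<open>Alternating functions and sums\<close>

context kspace
begin

text \<open>The terms are cancelled in pairs. Comparing the sum with its negative would only give twice the sum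
  equal to zero, which says nothing in characteristic two.\<close>

lemma finsum_involution_zero:
  assumes "finite S" and \<rho>: "\<And>x. x \<in> S \<Longrightarrow> \<rho> x \<in> S \<and> \<rho> (\<rho> x) = x \<and> \<rho> x \<noteq> x"
    and g: "\<And>x. x \<in> S \<Longrightarrow> g x \<in> carrier X" "\<And>x. x \<in> S \<Longrightarrow> g (\<rho> x) = \<ominus> g x"
  shows "(\<Oplus>x\<in>S. g x) = \<zero>"
  using assms
proof (induction "card S" arbitrary: S rule: less_induct)
  case less
  show ?case
  proof (cases "S = {}")
    case False
    then obtain x where x: "x \<in> S" by blast
    let ?S = "S - {x, \<rho> x}"
    have \<rho>x: "\<rho> x \<in> S" "\<rho> (\<rho> x) = x" "\<rho> x \<noteq> x" using less.prems(2)[OF x] by auto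
    have "(\<Oplus>y\<in>?S. g y) = \<zero>"
    proof (rule less.hyps)
      show "card ?S < card S" using x less.prems(1) by (intro psubset_card_mono) auto
      fix y assume y: "y \<in> ?S"
      then have "\<rho> y \<in> S" "\<rho> (\<rho> y) = y" "\<rho> y \<noteq> y" using less.prems(2) by auto
      moreover have "\<rho> y \<noteq> x" "\<rho> y \<noteq> \<rho> x" using y calculation \<rho>x by auto
      ultimately show "\<rho> y \<in> ?S \<and> \<rho> (\<rho> y) = y \<and> \<rho> y \<noteq> y" by auto
    qed (use less.prems in auto)
    moreover have "S = insert x (insert (\<rho> x) ?S)" using x \<rho>x by auto
    moreover have "(\<Oplus>y\<in>insert x (insert (\<rho> x) ?S). g y) = g x \<oplus> (g (\<rho> x) \<oplus> (\<Oplus>y\<in>?S. g y))"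
      using less.prems(1,3) x \<rho>x by (subst finsum_insert; (subst finsum_insert)?; auto)
    ultimately have "(\<Oplus>y\<in>S. g y) = g x \<oplus> (g (\<rho> x) \<oplus> \<zero>)" by simp
    also have "\<dots> = \<zero>" using less.prems(3,4)[OF x] by (simp add: r_neg)
    finally show ?thesis .
  qed simp
qed

lemma sign_smult_cancel:
  assumes "x \<in> carrier X" "of_int (sign \<sigma>) \<odot> x = \<zero>"
  shows "x = \<zero>"
proof -
  have "x = (of_int (sign \<sigma>) * of_int (sign \<sigma>)) \<odot> x"
    using assms(1) by (simp flip: of_int_mult)
  also have "\<dots> = \<zero>" using assms by (simp flip: smult_smult)
  finally show ?thesis .
qed

text \<open>Neighbouring transpositions generate the symmetric group, and two equal values can be brought next
  to each other by a transposition.\<close>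

lemma alternating_from_adjacent:
  fixes F :: "(nat \<Rightarrow> 'b) \<Rightarrow> 'a"
  assumes closed: "\<And>v. F v \<in> carrier X"
    and adjacent: "\<And>v i. 1 \<le> i \<Longrightarrow> i < r \<Longrightarrow> F (v \<circ> swap_adj i) = (- 1) \<odot> F v"
    and equal: "\<And>v i. 1 \<le> i \<Longrightarrow> i < r \<Longrightarrow> v i = v (Suc i) \<Longrightarrow> F v = \<zero>"
  shows "\<sigma> permutes {1..r} \<Longrightarrow> F (v \<circ> \<sigma>) = of_int (sign \<sigma>) \<odot> F v"
    and "\<not> inj_on v {1..r} \<Longrightarrow> F v = \<zero>"
proof -
  show perm: "F (v \<circ> \<sigma>) = of_int (sign \<sigma>) \<odot> F v" if "\<sigma> permutes {1..r}" for \<sigma> v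
    using that
  proof (induction rule: permutes_adjacent_induct)
    case (swap \<sigma> i)
    have "F (v \<circ> (\<sigma> \<circ> swap_adj i)) = (- 1) \<odot> F (v \<circ> \<sigma>)"
      using adjacent[OF swap.hyps(2,3), of "v \<circ> \<sigma>"] by (simp only: comp_assoc)
    also have "\<dots> = of_int (sign (\<sigma> \<circ> swap_adj i)) \<odot> F v"
      using swap.IH closed
      by (simp only: sign_comp_swap_adj[OF permutation_if_permutes[OF swap.hyps(1)]] smult_smult) simp
    finally show ?case .
  qed (simp add: closed)
  assume "\<not> inj_on v {1..r}"
  then obtain i j where ij: "i \<in> {1..r}" "j \<in> {1..r}" "i < j" "v i = v j"
    unfolding inj_on_def by (metis linorder_neqE_nat)
  \<comment> \<open>moves the value at \<open>j\<close> to the place after \<open>i\<close>; it is the identity if it is there already\<close>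
  let ?t = "Transposition.transpose j (Suc i)"
  have t: "?t permutes {1..r}" using ij by (intro permutes_swap_id) auto
  have "F (v \<circ> ?t) = \<zero>"
    by (rule equal[of i]) (use ij in auto)
  then have "of_int (sign ?t) \<odot> F v = \<zero>" using perm[OF t] by simp
  then show "F v = \<zero>" using sign_smult_cancel closed by blast
qed

end

lemma finsum_field_space: "finsum field_space g S = sum g S"
proof (induction S rule: infinite_finite_induct)
  case (insert x S)
  interpret kspace "field_space :: ('a, 'a) module" by simp
  show ?case using insert finsum_insert[of S x g] by simp
next
  case (infinite S)
  interpret kspace "field_space :: ('a, 'a) module" by simp
  show ?case using infinite finsum_infinite[of S g] by simp
next
  case empty
  interpret kspace "field_space :: ('a, 'a) module" by simp
  show ?case using finsum_empty[of g] by simp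
qed

section \<open>Antisymmetrization\<close>

text \<open>A word as a function on positions starting from \<open>1\<close>, so that permutations of the positions act by
  composition.\<close>

definition wd :: "nat \<Rightarrow> (nat \<Rightarrow> 'b) \<Rightarrow> 'b list" where
  "wd r v = map v [1..<Suc r]"

lemma length_wd [simp]: "length (wd r v) = r"
  by (simp add: wd_def)

lemma nth_wd [simp]: "k < r \<Longrightarrow> wd r v ! k = v (Suc k)"
  by (simp add: wd_def del: upt_Suc)

lemma wd_cong: "(\<And>j. j \<in> {1..r} \<Longrightarrow> v j = w j) \<Longrightarrow> wd r v = wd r w"
  by (auto simp: wd_def)

lemma list_eq_wd: "length vs = r \<Longrightarrow> vs = wd r (\<lambda>j. vs ! (j - 1))"
  by (rule nth_equalityI) auto

lemma wd_append: "wd (a + b) v = wd a v @ wd b (\<lambda>j. v (a + j))"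
  by (rule nth_equalityI) (auto simp: nth_append)

text \<open>The action of a permutation on words that underlies \<open>permute_tensor\<close>.\<close>

definition permuted :: "nat \<Rightarrow> (nat \<Rightarrow> nat) \<Rightarrow> 'b list \<Rightarrow> 'b list" where
  "permuted r \<sigma> vs = map (\<lambda>i. vs ! (inv_into UNIV \<sigma> i - 1)) [1..<Suc r]"

lemma length_permuted [simp]: "length (permuted r \<sigma> vs) = r"
  by (simp add: permuted_def del: upt_Suc)

lemma permuted_wd:
  assumes "\<sigma> permutes {1..r}"
  shows "permuted r \<sigma> (wd r v) = wd r (v \<circ> inv_into UNIV \<sigma>)"
proof -
  have "wd r v ! (inv_into UNIV \<sigma> i - 1) = (v \<circ> inv_into UNIV \<sigma>) i" if "i \<in> {1..r}" for i
    using that permutes_in_image[OF permutes_inv[OF assms], of i] by auto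
  then show ?thesis by (auto simp: permuted_def wd_def[of r "v \<circ> _"])
qed

text \<open>A permuted word is still a word with the letter \<open>v\<close> in one slot and a context independent of \<open>v\<close>,
  so that permuting the letters preserves multilinearity.\<close>

lemma permuted_slot:
  fixes u v :: 'b and xs ys :: "'b list"
  assumes "\<sigma> permutes {1..r}" "Suc (length xs + length ys) = r"
  defines "k \<equiv> \<sigma> (Suc (length xs)) - 1" and "zs \<equiv> permuted r \<sigma> (xs @ u # ys)"
  shows "permuted r \<sigma> (xs @ v # ys) = take k zs @ v # drop (Suc k) zs"
proof -
  have \<sigma>: "\<sigma> (Suc (length xs)) \<in> {1..r}"
    using permutes_in_image[OF assms(1), of "Suc (length xs)"] assms(2) by auto
  have len: "length zs = r" by (simp add: zs_def)
  have "permuted r \<sigma> (xs @ v # ys) = zs[k := v]"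
  proof (rule nth_equalityI)
    fix i assume "i < length (permuted r \<sigma> (xs @ v # ys))"
    then have i: "i < r" by simp
    have in_range: "inv_into UNIV \<sigma> (Suc i) \<in> {1..r}"
      using permutes_in_image[OF permutes_inv[OF assms(1)], of "Suc i"] i by auto
    have eq: "permuted r \<sigma> (xs @ w # ys) ! i = (xs @ w # ys) ! (inv_into UNIV \<sigma> (Suc i) - 1)" for w
      using i by (simp add: permuted_def del: upt_Suc)
    show "permuted r \<sigma> (xs @ v # ys) ! i = zs[k := v] ! i"
    proof (cases "i = k")
      case True
      then have "Suc i = \<sigma> (Suc (length xs))" using \<sigma> by (auto simp: k_def)
      then have "inv_into UNIV \<sigma> (Suc i) = Suc (length xs)"
        using permutes_inverses(2)[OF assms(1)] by simp
      then show ?thesis using True i len eq by simp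
    next
      case False
      have "inv_into UNIV \<sigma> (Suc i) \<noteq> Suc (length xs)"
      proof
        assume "inv_into UNIV \<sigma> (Suc i) = Suc (length xs)"
        then have "Suc i = \<sigma> (Suc (length xs))" using permutes_inverses(1)[OF assms(1)] by metis
        with False show False unfolding k_def by (metis diff_Suc_1)
      qed
      then have "inv_into UNIV \<sigma> (Suc i) - 1 \<noteq> length xs" using in_range by auto
      then have "(xs @ v # ys) ! (inv_into UNIV \<sigma> (Suc i) - 1) = (xs @ u # ys) ! (inv_into UNIV \<sigma> (Suc i) - 1)"
        by (auto simp: nth_append nth_Cons')
      then show ?thesis using False i eq by (simp add: zs_def)
    qed
  qed (simp add: len)
  also have "\<dots> = take k zs @ v # drop (Suc k) zs"
    by (rule upd_conv_take_nth_drop) (use \<sigma> len in \<open>auto simp: k_def\<close>)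
  finally show ?thesis .
qed

context tensors
begin

lemma linear_on_words_closed:
  assumes "kspace Y" "g \<in> linear_maps (T\<lparr>carrier := V r\<rparr>) Y" "submodule H scalar_ring Y"
    and "\<And>vs. length vs = r \<Longrightarrow> g (tw vs) \<in> H" and "t \<in> V r"
  shows "g t \<in> H"
proof -
  interpret Y: kspace Y by fact
  interpret Vr: kspace "T\<lparr>carrier := V r\<rparr>" by (rule T.subspace_kspace[OF tensor_power_subspace])
  note sub = T.subspaceD[OF tensor_power_subspace[of r]] and subH = Y.subspaceD[OF assms(3)]
  have "g t \<in> H \<and> t \<in> V r"
    using assms(5)[unfolded tensor_power_def] words_closed
  proof (induction rule: T.span_induct)
    case (base x)
    then show ?case using assms(4) tensor_word_in_power by blast
  next
    case zero
    then show ?case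
      using linear_maps_zero[OF assms(2) Vr.kspace_axioms assms(1)] sub subH by simp
  next
    case (add x y)
    then show ?case using linear_add[OF assms(2), of x y] sub subH by simp
  next
    case (smult c x)
    then show ?case using linear_smult[OF assms(2), of x c] sub subH by simp
  qed
  then show ?thesis by simp
qed

lemma permuted_multilinear:
  assumes "\<sigma> permutes {1..r}"
  shows "multilinear scale T (\<lambda>vs. if length vs = r then tw (permuted r \<sigma> vs) else \<zero>\<^bsub>T\<^esub>)"
  unfolding multilinear_def
proof (intro conjI allI)
  fix xs ys :: "'v list" and v w c
  note ml = tensor_word_multilinear[unfolded multilinear_def]
  note slot = permuted_slot[OF assms, where xs = xs and ys = ys and u = 0]
  show "(if length (xs @ (v + w) # ys) = r then tw (permuted r \<sigma> (xs @ (v + w) # ys)) else \<zero>\<^bsub>T\<^esub>)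
    = (if length (xs @ v # ys) = r then tw (permuted r \<sigma> (xs @ v # ys)) else \<zero>\<^bsub>T\<^esub>) \<oplus>\<^bsub>T\<^esub>
      (if length (xs @ w # ys) = r then tw (permuted r \<sigma> (xs @ w # ys)) else \<zero>\<^bsub>T\<^esub>)"
    using ml slot[of "v + w"] slot[of v] slot[of w] by simp
  show "(if length (xs @ scale c v # ys) = r then tw (permuted r \<sigma> (xs @ scale c v # ys)) else \<zero>\<^bsub>T\<^esub>)
    = c \<odot>\<^bsub>T\<^esub> (if length (xs @ v # ys) = r then tw (permuted r \<sigma> (xs @ v # ys)) else \<zero>\<^bsub>T\<^esub>)"
    using ml slot[of "scale c v"] slot[of v] by simp
qed simp

lemma permute_tensor:
  assumes "\<sigma> permutes {1..r}"
  shows "permute_tensor scale r \<sigma> \<in> linear_maps (T\<lparr>carrier := V r\<rparr>) (T\<lparr>carrier := V r\<rparr>)" (is ?A)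
    and "permute_tensor scale r \<sigma> (tw (wd r v)) = tw (wd r (v \<circ> inv_into UNIV \<sigma>))" (is ?B)
proof -
  let ?V = "T\<lparr>carrier := V r\<rparr>"
  interpret Vr: kspace ?V by (rule T.subspace_kspace[OF tensor_power_subspace])
  obtain g where g: "g \<in> linear_maps T T"
    "\<And>vs. g (tw vs) = (if length vs = r then tw (permuted r \<sigma> vs) else \<zero>\<^bsub>T\<^esub>)"
    using tensor_algebra_lift[OF T.kspace_axioms permuted_multilinear[OF assms]] by blast
  have gV: "g \<in> linear_maps ?V T" by (rule linear_restrict_domain[OF g(1) tensor_power_subset])
  have "g t \<in> V r" if "t \<in> V r" for t
    by (rule linear_on_words_closed[OF T.kspace_axioms gV tensor_power_subspace[of r] _ that])
      (simp add: g(2) tensor_word_in_power)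
  then have "g ` carrier ?V \<subseteq> V r" by auto
  then have gVV: "g \<in> linear_maps ?V ?V" by (rule linear_restrict_range[OF gV])
  have eq: "permute_tensor scale r \<sigma> = restrict g (V r)"
  proof -
    have "h t = g t" if "h \<in> linear_maps ?V ?V" "t \<in> V r"
      "\<And>vs. length vs = r \<Longrightarrow> h (tw vs) = tw (permuted r \<sigma> vs)" for h t
      by (rule linear_eq_on_span[OF T.kspace_axioms T.kspace_axioms words_closed[of r]])
        (use that g(2) gV linear_extend_range[OF that(1) tensor_power_subset]
          in \<open>auto simp: tensor_power_def[symmetric]\<close>)
    then show ?thesis
      unfolding permute_tensor_def permuted_def[symmetric]
      by (subst the_linear_map_eq[OF Vr.kspace_axioms gVV])
        (use g(2) in \<open>auto simp: tensor_word_in_power\<close>)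
  qed
  show ?A unfolding eq by (rule linear_cong[OF gVV Vr.kspace_axioms]) simp
  show ?B unfolding eq by (simp add: g(2) permuted_wd[OF assms] tensor_word_in_power)
qed

lemma Ant_linear: "Ant scale r \<in> linear_maps (T\<lparr>carrier := V r\<rparr>) T"
  unfolding Ant_def[abs_def]
  by (intro linear_sum_map[OF T.subspace_kspace[OF tensor_power_subspace] T.kspace_axioms]
      linear_smult_map[OF T.kspace_axioms] linear_extend_range[OF permute_tensor(1) tensor_power_subset]) simp

lemma Ant_in_power: "z \<in> V r \<Longrightarrow> Ant scale r z \<in> V r"
  unfolding Ant_def
  by (rule T.subspace_finsum[OF tensor_power_subspace])
    (use linear_closed[OF permute_tensor(1)] in \<open>auto intro!: T.subspaceD(4)[OF tensor_power_subspace]\<close>)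

text \<open>The action permutes words by the inverse permutation; since inversion preserves signs, the sum may
  be taken over the inverses instead.\<close>

lemma Ant_word:
  "Ant scale r (tw (wd r v)) = (\<Oplus>\<^bsub>T\<^esub>\<sigma>\<in>perms r. of_int (sign \<sigma>) \<odot>\<^bsub>T\<^esub> tw (wd r (v \<circ> \<sigma>)))"
proof -
  have img: "inv_into UNIV ` perms r = perms r"
  proof
    show "inv_into UNIV ` perms r \<subseteq> perms r" using permutes_inv by auto
    show "perms r \<subseteq> inv_into UNIV ` perms r"
    proof
      fix \<sigma> assume "\<sigma> \<in> perms r"
      then have "\<sigma> = inv_into UNIV (inv_into UNIV \<sigma>)" "inv_into UNIV \<sigma> \<in> perms r"
        using permutes_inv by (simp_all add: permutes_inv_inv)
      then show "\<sigma> \<in> inv_into UNIV ` perms r" by (rule image_eqI)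
    qed
  qed
  have inj: "inj_on (inv_into UNIV) (perms r)"
    by (rule inj_on_inverseI[of _ "inv_into UNIV"]) (simp add: permutes_inv_inv)
  have "Ant scale r (tw (wd r v))
    = (\<Oplus>\<^bsub>T\<^esub>\<sigma>\<in>perms r. of_int (sign (inv_into UNIV \<sigma>)) \<odot>\<^bsub>T\<^esub> tw (wd r (v \<circ> inv_into UNIV \<sigma>)))"
    unfolding Ant_def
    by (rule T.finsum_cong')
      (auto simp: permute_tensor(2) sign_inverse[OF permutation_if_permutes])
  also have "\<dots> = (\<Oplus>\<^bsub>T\<^esub>\<sigma>\<in>inv_into UNIV ` perms r. of_int (sign \<sigma>) \<odot>\<^bsub>T\<^esub> tw (wd r (v \<circ> \<sigma>)))"
    by (rule T.finsum_reindex[OF _ inj, symmetric]) auto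
  finally show ?thesis by (simp only: img)
qed

text \<open>Exchanging the two equal letters does not change a word but changes the sign of the permutation that
  produced it.\<close>

lemma Ant_word_repeated:
  assumes "i \<in> {1..r}" "j \<in> {1..r}" "i \<noteq> j" "v i = v j"
  shows "Ant scale r (tw (wd r v)) = \<zero>\<^bsub>T\<^esub>"
  unfolding Ant_word
proof (rule T.finsum_involution_zero[where \<rho> = "\<lambda>\<sigma>. Transposition.transpose i j \<circ> \<sigma>"])
  let ?t = "Transposition.transpose i j"
  have t: "?t permutes {1..r}" using assms by (intro permutes_swap_id) auto
  have vt: "v \<circ> (?t \<circ> \<sigma>) = v \<circ> \<sigma>" for \<sigma>
    using assms(4) by (auto simp: fun_eq_iff Transposition.transpose_def)
  fix \<sigma> assume "\<sigma> \<in> perms r"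
  then have \<sigma>: "\<sigma> permutes {1..r}" by simp
  have "?t \<circ> \<sigma> \<noteq> \<sigma>"
  proof
    assume "?t \<circ> \<sigma> = \<sigma>"
    then have "?t (\<sigma> (inv_into UNIV \<sigma> i)) = \<sigma> (inv_into UNIV \<sigma> i)" by (metis comp_apply)
    then show False using permutes_inverses(1)[OF \<sigma>] assms(3) by simp
  qed
  moreover have "?t \<circ> (?t \<circ> \<sigma>) = \<sigma>"
    by (simp add: fun_eq_iff)
  ultimately show "?t \<circ> \<sigma> \<in> perms r \<and> ?t \<circ> (?t \<circ> \<sigma>) = \<sigma> \<and> ?t \<circ> \<sigma> \<noteq> \<sigma>"
    using permutes_compose[OF \<sigma> t] by blast
  have "sign (?t \<circ> \<sigma>) = - sign \<sigma>"
    using sign_compose[OF permutation_swap_id permutation_if_permutes[OF \<sigma>], of i j]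
      sign_swap_id[of i j] assms(3) by simp
  then show "of_int (sign (?t \<circ> \<sigma>)) \<odot>\<^bsub>T\<^esub> tw (wd r (v \<circ> (?t \<circ> \<sigma>))) = \<ominus>\<^bsub>T\<^esub> (of_int (sign \<sigma>) \<odot>\<^bsub>T\<^esub> tw (wd r (v \<circ> \<sigma>)))"
    unfolding vt by (simp add: T.minus_one_smult[symmetric] T.smult_smult)
qed auto

lemma Ant_multilinear:
  "multilinear scale T (\<lambda>vs. if length vs = r then Ant scale r (tw vs) else \<zero>\<^bsub>T\<^esub>)"
  unfolding multilinear_def
proof (intro conjI allI)
  note ml = tensor_word_multilinear[unfolded multilinear_def]
  note lin = linear_mapsD[OF Ant_linear[of r]]
  fix vs xs ys :: "'v list" and v w c
  show "(if length vs = r then Ant scale r (tw vs) else \<zero>\<^bsub>T\<^esub>) \<in> carrier T"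
    using lin(1)[of "tw vs"] by (simp add: tensor_word_in_power)
  show "(if length (xs @ (v + w) # ys) = r then Ant scale r (tw (xs @ (v + w) # ys)) else \<zero>\<^bsub>T\<^esub>)
    = (if length (xs @ v # ys) = r then Ant scale r (tw (xs @ v # ys)) else \<zero>\<^bsub>T\<^esub>) \<oplus>\<^bsub>T\<^esub>
      (if length (xs @ w # ys) = r then Ant scale r (tw (xs @ w # ys)) else \<zero>\<^bsub>T\<^esub>)"
    using ml lin(2)[of "tw (xs @ v # ys)" "tw (xs @ w # ys)"] by (simp add: tensor_word_in_power)
  show "(if length (xs @ scale c v # ys) = r then Ant scale r (tw (xs @ scale c v # ys)) else \<zero>\<^bsub>T\<^esub>)
    = c \<odot>\<^bsub>T\<^esub> (if length (xs @ v # ys) = r then Ant scale r (tw (xs @ v # ys)) else \<zero>\<^bsub>T\<^esub>)"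
    using ml lin(3)[of "tw (xs @ v # ys)" c] by (simp add: tensor_word_in_power)
qed

text \<open>Antisymmetrization factors through the exterior power, without any choice of a basis.\<close>

lemma Ant_on_wedges:
  obtains g where "g \<in> linear_maps Ext T" "\<And>vs. length vs = r \<Longrightarrow> g (wedge scale vs) = Ant scale r (tw vs)"
proof -
  have "(if length (xs @ v # v # ys) = r then Ant scale r (tw (xs @ v # v # ys)) else \<zero>\<^bsub>T\<^esub>) = \<zero>\<^bsub>T\<^esub>" for xs v ys
  proof -
    have "Ant scale r (tw (wd r (\<lambda>j. (xs @ v # v # ys) ! (j - 1)))) = \<zero>\<^bsub>T\<^esub>" if "length (xs @ v # v # ys) = r"
      by (rule Ant_word_repeated[of "Suc (length xs)" _ "Suc (Suc (length xs))"])
        (use that in \<open>auto simp: nth_append\<close>)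
    then show ?thesis using list_eq_wd[of "xs @ v # v # ys" r] by metis
  qed
  from exterior_algebra_lift[OF T.kspace_axioms Ant_multilinear this]
  show ?thesis using that by (metis (no_types, lifting))
qed

text \<open>The sum over all permutations, grouped by the cosets of the Young subgroup of the two
  blocks, each represented by a shuffle.\<close>

theorem Ant_shuffle:
  "Ant scale (a + b) (tw (wd (a + b) v))
    = (\<Oplus>\<^bsub>T\<^esub>\<tau>\<in>shuffle_perms a b. of_int (sign \<tau>) \<odot>\<^bsub>T\<^esub>
        (Ant scale a (tw (wd a (v \<circ> \<tau>))) \<otimes>\<^bsub>T\<^esub> Ant scale b (tw (wd b (\<lambda>j. v (\<tau> (a + j)))))))"
proof -
  let ?D = "shuffle_perms a b \<times> perms a \<times> perms b"
  let ?G = "\<lambda>\<sigma>. of_int (sign \<sigma>) \<odot>\<^bsub>T\<^esub> tw (wd (a + b) (v \<circ> \<sigma>))"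
  let ?A = "\<lambda>\<tau> \<alpha>. of_int (sign \<alpha>) \<odot>\<^bsub>T\<^esub> tw (wd a ((v \<circ> \<tau>) \<circ> \<alpha>))"
  let ?B = "\<lambda>\<tau> \<beta>. of_int (sign \<beta>) \<odot>\<^bsub>T\<^esub> tw (wd b ((\<lambda>j. v (\<tau> (a + j))) \<circ> \<beta>))"
  have G: "?G (unshuffle a (\<tau>, \<alpha>, \<beta>)) = of_int (sign \<tau>) \<odot>\<^bsub>T\<^esub> (?A \<tau> \<alpha> \<otimes>\<^bsub>T\<^esub> ?B \<tau> \<beta>)"
    if "\<tau> \<in> shuffle_perms a b" "\<alpha> permutes {1..a}" "\<beta> permutes {1..b}" for \<tau> \<alpha> \<beta>
  proof -
    have "wd a (v \<circ> unshuffle a (\<tau>, \<alpha>, \<beta>)) = wd a ((v \<circ> \<tau>) \<circ> \<alpha>)"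
      by (rule wd_cong) (use block_apply(1)[OF that(2,3)] in \<open>auto simp: unshuffle_def\<close>)
    moreover have "wd b (\<lambda>j. (v \<circ> unshuffle a (\<tau>, \<alpha>, \<beta>)) (a + j)) = wd b ((\<lambda>j. v (\<tau> (a + j))) \<circ> \<beta>)"
      by (rule wd_cong) (use block_apply(2)[OF that(2,3)] in \<open>auto simp: unshuffle_def\<close>)
    ultimately show ?thesis
      by (simp add: sign_unshuffle[OF that] wd_append tensor_word_append T.smult_mult_left
          T.smult_mult_right T.smult_smult mult_ac)
  qed
  have bij: "inj_on (unshuffle a) ?D" "unshuffle a ` ?D = perms (a + b)"
    using bij_unshuffle[of a b] by (simp_all add: bij_betw_def)
  have fin: "finite (perms a \<times> perms b)" by (simp only: finite_cartesian_product finite_perms)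
  have inner: "(\<Oplus>\<^bsub>T\<^esub>\<alpha>\<in>perms a. \<Oplus>\<^bsub>T\<^esub>\<beta>\<in>perms b. of_int (sign \<tau>) \<odot>\<^bsub>T\<^esub> (?A \<tau> \<alpha> \<otimes>\<^bsub>T\<^esub> ?B \<tau> \<beta>))
      = of_int (sign \<tau>) \<odot>\<^bsub>T\<^esub> ((\<Oplus>\<^bsub>T\<^esub>\<alpha>\<in>perms a. ?A \<tau> \<alpha>) \<otimes>\<^bsub>T\<^esub> (\<Oplus>\<^bsub>T\<^esub>\<beta>\<in>perms b. ?B \<tau> \<beta>))" for \<tau>
  proof -
    let ?SB = "\<Oplus>\<^bsub>T\<^esub>\<beta>\<in>perms b. ?B \<tau> \<beta>"
    have SB: "?SB \<in> carrier T" by (rule T.finsum_closed) auto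
    have "(\<Oplus>\<^bsub>T\<^esub>\<beta>\<in>perms b. of_int (sign \<tau>) \<odot>\<^bsub>T\<^esub> (?A \<tau> \<alpha> \<otimes>\<^bsub>T\<^esub> ?B \<tau> \<beta>))
        = of_int (sign \<tau>) \<odot>\<^bsub>T\<^esub> (?A \<tau> \<alpha> \<otimes>\<^bsub>T\<^esub> ?SB)" for \<alpha>
    proof -
      have "?A \<tau> \<alpha> \<otimes>\<^bsub>T\<^esub> ?SB = (\<Oplus>\<^bsub>T\<^esub>\<beta>\<in>perms b. ?A \<tau> \<alpha> \<otimes>\<^bsub>T\<^esub> ?B \<tau> \<beta>)"
        by (rule linear_finsum[OF T.mult_linear_right T.kspace_axioms T.kspace_axioms]) auto
      then show ?thesis by (simp only: T.smult_finsum Pi_def) (rule T.smult_finsum[symmetric], auto)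
    qed
    moreover have "(\<Oplus>\<^bsub>T\<^esub>\<alpha>\<in>perms a. of_int (sign \<tau>) \<odot>\<^bsub>T\<^esub> (?A \<tau> \<alpha> \<otimes>\<^bsub>T\<^esub> ?SB))
        = of_int (sign \<tau>) \<odot>\<^bsub>T\<^esub> (\<Oplus>\<^bsub>T\<^esub>\<alpha>\<in>perms a. ?A \<tau> \<alpha> \<otimes>\<^bsub>T\<^esub> ?SB)"
      by (rule T.smult_finsum[symmetric]) (use SB in auto)
    moreover have "(\<Oplus>\<^bsub>T\<^esub>\<alpha>\<in>perms a. ?A \<tau> \<alpha> \<otimes>\<^bsub>T\<^esub> ?SB) = (\<Oplus>\<^bsub>T\<^esub>\<alpha>\<in>perms a. ?A \<tau> \<alpha>) \<otimes>\<^bsub>T\<^esub> ?SB"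
      by (rule linear_finsum[OF T.mult_linear_left[OF SB] T.kspace_axioms T.kspace_axioms, symmetric]) auto
    ultimately show ?thesis by (simp only:)
  qed
  have "Ant scale (a + b) (tw (wd (a + b) v)) = (\<Oplus>\<^bsub>T\<^esub>\<sigma>\<in>unshuffle a ` ?D. ?G \<sigma>)"
    unfolding Ant_word bij(2) ..
  also have "\<dots> = (\<Oplus>\<^bsub>T\<^esub>z\<in>?D. ?G (unshuffle a z))"
    by (rule T.finsum_reindex[OF _ bij(1)]) auto
  also have "\<dots> = (\<Oplus>\<^bsub>T\<^esub>\<tau>\<in>shuffle_perms a b. \<Oplus>\<^bsub>T\<^esub>z\<in>perms a \<times> perms b. ?G (unshuffle a (\<tau>, z)))"
    by (rule T.finsum_times[OF finite_shuffle_perms fin]) auto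
  also have "\<dots> = (\<Oplus>\<^bsub>T\<^esub>\<tau>\<in>shuffle_perms a b. \<Oplus>\<^bsub>T\<^esub>\<alpha>\<in>perms a. \<Oplus>\<^bsub>T\<^esub>\<beta>\<in>perms b. ?G (unshuffle a (\<tau>, \<alpha>, \<beta>)))"
    by (rule T.finsum_cong'[OF refl _ T.finsum_times[OF finite_perms finite_perms]])
      (auto intro!: T.finsum_closed)
  also have "\<dots> = (\<Oplus>\<^bsub>T\<^esub>\<tau>\<in>shuffle_perms a b. \<Oplus>\<^bsub>T\<^esub>\<alpha>\<in>perms a. \<Oplus>\<^bsub>T\<^esub>\<beta>\<in>perms b.
      of_int (sign \<tau>) \<odot>\<^bsub>T\<^esub> (?A \<tau> \<alpha> \<otimes>\<^bsub>T\<^esub> ?B \<tau> \<beta>))"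
    by (intro T.finsum_cong'[OF refl] G) (auto intro!: T.finsum_closed)
  finally show ?thesis unfolding inner Ant_word .
qed

lemma Ant_split_span:
  assumes "t \<in> Ant scale (a + b) ` V (a + b)"
  shows "t \<in> linear_span T {x \<otimes>\<^bsub>T\<^esub> y | x y. x \<in> Ant scale a ` V a \<and> y \<in> Ant scale b ` V b}"
    (is "_ \<in> linear_span T ?S")
proof -
  have S: "?S \<subseteq> carrier T"
    using Ant_in_power tensor_power_subset by (auto intro!: T.m_closed)
  note sub = T.subspaceD[OF T.span_subspace[OF S]]
  from assms obtain z where z: "z \<in> V (a + b)" "t = Ant scale (a + b) z" by blast
  show ?thesis unfolding z(2)
  proof (rule linear_on_words_closed[OF T.kspace_axioms Ant_linear T.span_subspace[OF S] _ z(1)])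
    fix vs :: "'v list" assume "length vs = a + b"
    then obtain v where v: "vs = wd (a + b) v" using list_eq_wd by blast
    show "Ant scale (a + b) (tw vs) \<in> linear_span T ?S"
      unfolding v Ant_shuffle
    proof (intro T.subspace_finsum[OF T.span_subspace[OF S]] funcsetI sub(4))
      fix \<tau>
      have "Ant scale a (tw (wd a (v \<circ> \<tau>))) \<otimes>\<^bsub>T\<^esub> Ant scale b (tw (wd b (\<lambda>j. v (\<tau> (a + j))))) \<in> ?S"
        by (auto intro!: exI imageI tensor_word_in_power)
      then show "Ant scale a (tw (wd a (v \<circ> \<tau>))) \<otimes>\<^bsub>T\<^esub> Ant scale b (tw (wd b (\<lambda>j. v (\<tau> (a + j))))) \<in> linear_span T ?S"
        by (rule subsetD[OF T.span_superset])
    qed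
  qed
qed

lemma Ant_image_subspace: "submodule (Ant scale r ` V r) scalar_ring T"
proof -
  note sub = T.subspaceD[OF tensor_power_subspace[of r]] and lin = linear_mapsD[OF Ant_linear[of r]]
  show ?thesis
  proof (rule T.subspaceI)
    show "Ant scale r ` V r \<subseteq> carrier T" using lin(1) by auto
    show "\<zero>\<^bsub>T\<^esub> \<in> Ant scale r ` V r"
      using linear_maps_zero[OF Ant_linear T.subspace_kspace[OF tensor_power_subspace] T.kspace_axioms, of r] sub(2)
      by (intro image_eqI[of _ _ "\<zero>\<^bsub>T\<^esub>"]) auto
    show "a \<oplus>\<^bsub>T\<^esub> b \<in> Ant scale r ` V r" if ab: "a \<in> Ant scale r ` V r" "b \<in> Ant scale r ` V r" for a b
    proof -
      obtain x y where "x \<in> V r" "y \<in> V r" "a = Ant scale r x" "b = Ant scale r y" using ab by blast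
      then show ?thesis using lin(2)[of x y] sub(3)[of x y] by (intro image_eqI[of _ _ "x \<oplus>\<^bsub>T\<^esub> y"]) auto
    qed
    show "c \<odot>\<^bsub>T\<^esub> a \<in> Ant scale r ` V r" if a: "a \<in> Ant scale r ` V r" for c a
    proof -
      obtain x where "x \<in> V r" "a = Ant scale r x" using a by blast
      then show ?thesis using lin(3)[of x c] sub(4)[of x c] by (intro image_eqI[of _ _ "c \<odot>\<^bsub>T\<^esub> x"]) auto
    qed
  qed
qed

text \<open>Two applications of the shuffle expansion exhibit an antisymmetrized tensor of degree \<open>i + N + j\<close>
  as a sum of products with the middle factor in \<open>R\<close>.\<close>

lemma Ant_subset_koszul_W: "Ant scale r ` V r \<subseteq> koszul_W scale N r"
proof
  fix t assume t: "t \<in> Ant scale r ` V r"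
  have "t \<in> linear_span T {a \<otimes>\<^bsub>T\<^esub> b \<otimes>\<^bsub>T\<^esub> c | a b c.
      a \<in> V i \<and> b \<in> sym_relations scale N \<and> c \<in> V j}" (is "_ \<in> linear_span T ?S")
    if r: "i + N + j = r" for i j
  proof -
    have S: "?S \<subseteq> carrier T"
      using Ant_in_power tensor_power_subset by (auto intro!: T.m_closed simp: sym_relations_def)
    have "x \<otimes>\<^bsub>T\<^esub> y \<in> linear_span T ?S" if x: "x \<in> Ant scale (i + N) ` V (i + N)" and y: "y \<in> V j" for x y
    proof -
      let ?U = "{x \<otimes>\<^bsub>T\<^esub> y | x y. x \<in> Ant scale i ` V i \<and> y \<in> Ant scale N ` V N}"
      have yc: "y \<in> carrier T" using y tensor_power_subset by blast
      have A: "x \<otimes>\<^bsub>T\<^esub> y \<in> linear_span T ((\<lambda>x. x \<otimes>\<^bsub>T\<^esub> y) ` ?U)"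
        by (rule linear_image_span[OF T.kspace_axioms T.kspace_axioms T.mult_linear_left[OF yc] _ Ant_split_span[OF x]])
          (use Ant_in_power tensor_power_subset in \<open>auto intro!: T.m_closed\<close>)
      have B: "(\<lambda>x. x \<otimes>\<^bsub>T\<^esub> y) ` ?U \<subseteq> ?S"
        unfolding sym_relations_def using y Ant_in_power by blast
      show ?thesis
        by (rule subsetD[OF T.span_mono[OF subset_trans[OF B T.span_superset] S] A])
    qed
    then have "{x \<otimes>\<^bsub>T\<^esub> y | x y. x \<in> Ant scale (i + N) ` V (i + N) \<and> y \<in> Ant scale j ` V j} \<subseteq> linear_span T ?S"
      using Ant_in_power by blast
    from subsetD[OF T.span_mono[OF this S] Ant_split_span] show ?thesis
      using t unfolding r[symmetric] .
  qed
  moreover have "t \<in> V r" using t Ant_in_power by blast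
  ultimately show "t \<in> koszul_W scale N r" unfolding koszul_W_def by simp
qed

lemma koszul_W_subset: "koszul_W scale N r \<subseteq> V r"
  unfolding koszul_W_def by blast

subsection \<open>The symmetric algebra\<close>

lemma sym_ideal: "ideal (sym_ideal scale N) T"
  unfolding sym_ideal_def
  by (rule T.genideal_ideal) (use Ant_in_power tensor_power_subset in \<open>auto simp: sym_relations_def\<close>)

lemma to_sym_scalar:
  "to_sym scale N (c \<odot>\<^bsub>T\<^esub> \<one>\<^bsub>T\<^esub>) = c \<odot>\<^bsub>sym_algebra scale N\<^esub> \<one>\<^bsub>sym_algebra scale N\<^esub>"
  unfolding to_sym_def sym_algebra_def
  using T.coset_smult[OF T.ideal_subspace[OF sym_ideal], of "\<one>\<^bsub>T\<^esub>"] by simp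

end

section \<open>Coordinates\<close>

locale based_tensors = tensors scale + finite_dimensional_vector_space scale "e ` {1..n}"
  for scale :: "'k::field \<Rightarrow> 'v::ab_group_add \<Rightarrow> 'v" and e :: "nat \<Rightarrow> 'v" and n :: nat +
  assumes inj_e: "inj_on e {1..n}"
begin

definition coord :: "nat \<Rightarrow> 'v \<Rightarrow> 'k" where
  "coord i v = representation (e ` {1..n}) v (e i)"

lemma coord_add: "coord i (v + w) = coord i v + coord i w"
  unfolding coord_def by (subst representation_add[OF independent_Basis]) (simp_all only: span_Basis UNIV_I)

lemma coord_scale: "coord i (scale c v) = c * coord i v"
  unfolding coord_def by (subst representation_scale[OF independent_Basis]) (simp_all only: span_Basis UNIV_I)

lemma coord_basis: "i \<in> {1..n} \<Longrightarrow> j \<in> {1..n} \<Longrightarrow> coord i (e j) = (if i = j then 1 else 0)"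
  using representation_basis[OF independent_Basis, of "e j"] inj_onD[OF inj_e, of i j]
  by (auto simp: coord_def)

definition coord_product :: "nat \<Rightarrow> (nat \<Rightarrow> nat) \<Rightarrow> 'v list \<Rightarrow> 'k" where
  "coord_product r u vs = (if length vs = r then \<Prod>j\<in>{1..r}. coord (u j) (vs ! (j - 1)) else 0)"

lemma coord_product_slot:
  assumes "Suc (length xs + length ys) = r"
  shows "coord_product r u (xs @ v # ys) = coord (u (Suc (length xs))) v *
    (\<Prod>j\<in>{1..r} - {Suc (length xs)}. coord (u j) ((xs @ 0 # ys) ! (j - 1)))"
proof -
  let ?k = "Suc (length xs)"
  have "(\<Prod>j\<in>{1..r}. coord (u j) ((xs @ v # ys) ! (j - 1))) =
     coord (u ?k) ((xs @ v # ys) ! (?k - 1)) * (\<Prod>j\<in>{1..r} - {?k}. coord (u j) ((xs @ v # ys) ! (j - 1)))"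
    by (rule prod.remove) (use assms in auto)
  also have "(\<Prod>j\<in>{1..r} - {?k}. coord (u j) ((xs @ v # ys) ! (j - 1)))
     = (\<Prod>j\<in>{1..r} - {?k}. coord (u j) ((xs @ 0 # ys) ! (j - 1)))"
  proof (rule prod.cong[OF refl])
    fix j assume "j \<in> {1..r} - {?k}"
    then have "j - 1 \<noteq> length xs" by auto
    then show "coord (u j) ((xs @ v # ys) ! (j - 1)) = coord (u j) ((xs @ 0 # ys) ! (j - 1))"
      by (auto simp: nth_append nth_Cons')
  qed
  finally show ?thesis using assms by (simp add: coord_product_def)
qed

lemma coord_product_multilinear: "multilinear scale field_space (coord_product r u)"
  unfolding multilinear_def
proof (intro conjI allI)
  fix xs ys :: "'v list" and v w c
  show "coord_product r u (xs @ (v + w) # ys)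
      = coord_product r u (xs @ v # ys) \<oplus>\<^bsub>field_space\<^esub> coord_product r u (xs @ w # ys)"
    by (cases "Suc (length xs + length ys) = r")
      (simp_all add: coord_product_slot coord_add distrib_right, simp add: coord_product_def)
  show "coord_product r u (xs @ scale c v # ys) = c \<odot>\<^bsub>field_space\<^esub> coord_product r u (xs @ v # ys)"
    by (cases "Suc (length xs + length ys) = r")
      (simp_all add: coord_product_slot coord_scale, simp add: coord_product_def)
qed simp

definition coeff :: "nat \<Rightarrow> (nat \<Rightarrow> nat) \<Rightarrow> ('k, 'v) tensor \<Rightarrow> 'k" where
  "coeff r u = (SOME g. g \<in> linear_maps T field_space \<and> (\<forall>vs. g (tw vs) = coord_product r u vs))"

lemma coeff: "coeff r u \<in> linear_maps T field_space" "coeff r u (tw vs) = coord_product r u vs"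
proof -
  have "\<exists>g. g \<in> linear_maps T field_space \<and> (\<forall>vs. g (tw vs) = coord_product r u vs)"
    using tensor_algebra_lift[OF kspace_field_space coord_product_multilinear] by metis
  from someI_ex[OF this] show "coeff r u \<in> linear_maps T field_space" "coeff r u (tw vs) = coord_product r u vs"
    unfolding coeff_def by auto
qed

lemma coeff_cong:
  assumes "\<And>j. j \<in> {1..r} \<Longrightarrow> u j = w j"
  shows "coeff r u = coeff r w"
proof -
  have "coord_product r u = coord_product r w"
    by (rule ext) (use assms in \<open>auto simp: coord_product_def intro!: prod.cong\<close>)
  then show ?thesis unfolding coeff_def by simp
qed

lemma coeff_word: "coeff r u (tw (wd r v)) = (\<Prod>j\<in>{1..r}. coord (u j) (v j))"
  by (auto simp: coeff(2) coord_product_def intro!: prod.cong)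

lemma coeff_basis_word:
  assumes "u ` {1..r} \<subseteq> {1..n}" "w ` {1..r} \<subseteq> {1..n}"
  shows "coeff r u (tw (wd r (e \<circ> w))) = (if \<forall>j\<in>{1..r}. u j = w j then 1 else 0)"
proof -
  have "coord (u j) ((e \<circ> w) j) = (if u j = w j then 1 else 0)" if "j \<in> {1..r}" for j
    using coord_basis[of "u j" "w j"] assms[THEN subsetD, OF imageI[OF that]] by simp
  then have "coeff r u (tw (wd r (e \<circ> w))) = (\<Prod>j\<in>{1..r}. if u j = w j then 1 else 0)"
    unfolding coeff_word by (rule prod.cong[OF refl])
  also have "\<dots> = (if \<forall>j\<in>{1..r}. u j = w j then 1 else 0)"
    by (auto simp: prod_zero_iff)
  finally show ?thesis .
qed

lemmas coeff_simps = linear_mapsD(2,3)[OF coeff(1), simplified]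

lemma coeff_zero: "coeff r u \<zero>\<^bsub>T\<^esub> = 0"
  using linear_maps_zero[OF coeff(1) T.kspace_axioms kspace_field_space] by simp

lemma coeff_mult:
  assumes "s \<in> V a" "t \<in> V b"
  shows "coeff (a + b) u (s \<otimes>\<^bsub>T\<^esub> t) = coeff a u s * coeff b (\<lambda>j. u (a + j)) t"
proof -
  have sc: "s \<in> carrier T" and tc: "t \<in> carrier T" using assms tensor_power_subset by blast+
  have words: "coeff (a + b) u (tw xs \<otimes>\<^bsub>T\<^esub> tw ys) = coeff a u (tw xs) * coeff b (\<lambda>j. u (a + j)) (tw ys)"
    if "length xs = a" "length ys = b" for xs ys
  proof -
    define x y where "x = (\<lambda>j. xs ! (j - 1))" and "y = (\<lambda>j. ys ! (j - 1))"
    have xy: "xs = wd a x" "ys = wd b y"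
      unfolding x_def y_def by (rule list_eq_wd[OF that(1)], rule list_eq_wd[OF that(2)])
    let ?v = "\<lambda>j. if j \<le> a then x j else y (j - a)"
    have "tw xs \<otimes>\<^bsub>T\<^esub> tw ys = tw (wd (a + b) ?v)"
      unfolding wd_append tensor_word_append xy
      by (rule arg_cong2[where f = "(\<otimes>\<^bsub>T\<^esub>)"]) (auto intro!: arg_cong[where f = tw] wd_cong)
    moreover have "(\<Prod>j\<in>{1..a + b}. coord (u j) (?v j))
      = (\<Prod>j\<in>{1..a}. coord (u j) (?v j)) * (\<Prod>j\<in>{a + 1..a + b}. coord (u j) (?v j))"
      by (subst prod.union_disjoint[symmetric]) (auto intro!: prod.cong)
    moreover have "(\<Prod>j\<in>{a + 1..a + b}. coord (u j) (?v j)) = (\<Prod>j\<in>{1..b}. coord (u (a + j)) (y j))"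
      by (rule prod.reindex_bij_witness[of _ "\<lambda>j. a + j" "\<lambda>j. j - a"]) auto
    moreover have "(\<Prod>j\<in>{1..a}. coord (u j) (?v j)) = (\<Prod>j\<in>{1..a}. coord (u j) (x j))"
      by (rule prod.cong) auto
    ultimately show ?thesis
      unfolding xy by (simp only: coeff_word)
  qed
  note tms = linear_functional_times[OF kspace_field_space coeff(1), simplified]
  have 1: "coeff (a + b) u (tw xs \<otimes>\<^bsub>T\<^esub> t) = coeff a u (tw xs) * coeff b (\<lambda>j. u (a + j)) t"
    if "length xs = a" for xs
  proof (rule tensor_power_eqI[OF kspace_field_space _ _ _ assms(2)])
    show "(\<lambda>t. coeff (a + b) u (tw xs \<otimes>\<^bsub>T\<^esub> t)) \<in> linear_maps T field_space"
      by (rule linear_comp[OF T.mult_linear_right coeff(1)]) simp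
    show "(\<lambda>t. coeff a u (tw xs) * coeff b (\<lambda>j. u (a + j)) t) \<in> linear_maps T field_space"
      using tms[of b "\<lambda>j. u (a + j)" "coeff a u (tw xs)"] by (simp add: mult.commute)
  qed (use words that in auto)
  show ?thesis
  proof (rule tensor_power_eqI[OF kspace_field_space _ _ _ assms(1)])
    show "(\<lambda>s. coeff (a + b) u (s \<otimes>\<^bsub>T\<^esub> t)) \<in> linear_maps T field_space"
      by (rule linear_comp[OF T.mult_linear_left coeff(1)]) (rule tc)
    show "(\<lambda>s. coeff a u s * coeff b (\<lambda>j. u (a + j)) t) \<in> linear_maps T field_space"
      by (rule tms)
  qed (use 1 in auto)
qed

subsection \<open>Words in the basis\<close>

definition index_functions :: "nat \<Rightarrow> (nat \<Rightarrow> nat) set" where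
  "index_functions r = PiE {1..r} (\<lambda>_. {1..n})"

lemma finite_index_functions [simp]: "finite (index_functions r)"
  unfolding index_functions_def by (rule finite_PiE) auto

lemma index_functions_image: "u \<in> index_functions r \<Longrightarrow> u ` {1..r} \<subseteq> {1..n}"
  by (auto simp: index_functions_def)

lemma index_functions_eq: "u \<in> index_functions r \<Longrightarrow> w \<in> index_functions r \<Longrightarrow>
    (\<forall>j\<in>{1..r}. u j = w j) \<longleftrightarrow> u = w"
  unfolding index_functions_def by (auto intro: PiE_ext)

lemma restrict_index_function:
  "u ` {1..r} \<subseteq> {1..n} \<Longrightarrow> restrict u {1..r} \<in> index_functions r"
  by (auto simp: index_functions_def)

lemma wd_restrict: "wd r (f \<circ> restrict u {1..r}) = wd r (f \<circ> u)"
  by (rule wd_cong) simp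

lemma word_in_basis_span:
  "tw vs \<in> linear_span T {tw (map e is) | is. length is = length vs \<and> set is \<subseteq> {1..n}}"
proof (induction vs)
  case Nil
  show ?case by (rule subsetD[OF T.span_superset]) simp
next
  case (Cons v vs)
  let ?S = "\<lambda>r. {tw (map e is) | is. length is = r \<and> set is \<subseteq> {1..n}}"
  let ?r = "length vs"
  have S: "?S r \<subseteq> carrier T" for r by auto
  note sub = T.subspaceD[OF T.span_subspace[OF S[of "Suc ?r"]]]
  have vsc: "tw vs \<in> carrier T" by simp
  have "tw [v] \<otimes>\<^bsub>T\<^esub> tw vs \<in> linear_span T (?S (Suc ?r))"
  proof (rule span_induct[where S = "e ` {1..n}" and x = v])
    show "v \<in> span (e ` {1..n})" using span_Basis by simp
    have "tw [0] = \<zero>\<^bsub>T\<^esub>"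
      using tensor_letter_linear(2)[of 0 0] by simp
    then show "subspace {v. tw [v] \<otimes>\<^bsub>T\<^esub> tw vs \<in> linear_span T (?S (Suc ?r))}"
      by (auto simp: subspace_def tensor_letter_linear T.l_distr T.smult_mult_left sub simp del: One_nat_def)
    fix x assume "x \<in> e ` {1..n}"
    then obtain i where i: "i \<in> {1..n}" "x = e i" by blast
    have img: "tw [x] \<otimes>\<^bsub>T\<^esub> tw vs \<in> linear_span T ((\<otimes>\<^bsub>T\<^esub>) (tw [x]) ` ?S ?r)"
      by (rule linear_image_span[OF T.kspace_axioms T.kspace_axioms T.mult_linear_right _ Cons.IH]) auto
    have sub: "(\<otimes>\<^bsub>T\<^esub>) (tw [x]) ` ?S ?r \<subseteq> ?S (Suc ?r)"
    proof clarify
      fix "is" assume "length is = ?r" "set is \<subseteq> {1..n}"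
      moreover have "tw [x] \<otimes>\<^bsub>T\<^esub> tw (map e is) = tw (map e (i # is))"
        using tensor_word_append[of "[x]" "map e is"] i by simp
      ultimately show "\<exists>is'. tw [x] \<otimes>\<^bsub>T\<^esub> tw (map e is) = tw (map e is') \<and> length is' = Suc ?r \<and> set is' \<subseteq> {1..n}"
        using i by (intro exI[of _ "i # is"]) auto
    qed
    show "tw [x] \<otimes>\<^bsub>T\<^esub> tw vs \<in> linear_span T (?S (Suc ?r))"
      by (rule subsetD[OF T.span_mono[OF subset_trans[OF sub T.span_superset] S] img])
  qed
  then show ?case using tensor_word_append[of "[v]" vs] by simp
qed

lemma tensor_power_basis_span:
  "V r \<subseteq> linear_span T {tw (wd r (e \<circ> u)) | u. u \<in> index_functions r}"
  (is "_ \<subseteq> linear_span T ?S")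
proof -
  have S: "?S \<subseteq> carrier T" by auto
  have "{tw (map e is) | is. length is = r \<and> set is \<subseteq> {1..n}} \<subseteq> ?S"
  proof
    fix t assume "t \<in> {tw (map e is) | is. length is = r \<and> set is \<subseteq> {1..n}}"
    then obtain "is" where *: "t = tw (map e is)" "length is = r" "set is \<subseteq> {1..n}" by blast
    let ?u = "\<lambda>j. is ! (j - 1)"
    have "?u ` {1..r} \<subseteq> {1..n}"
    proof (rule image_subsetI)
      fix j assume "j \<in> {1..r}"
      then have "is ! (j - 1) \<in> set is" using *(2) by (intro nth_mem) auto
      then show "is ! (j - 1) \<in> {1..n}" using *(3) by blast
    qed
    then have "restrict ?u {1..r} \<in> index_functions r" by (rule restrict_index_function)
    moreover have "map e is = wd r (e \<circ> restrict ?u {1..r})"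
      unfolding wd_restrict by (rule nth_equalityI) (use * in auto)
    ultimately show "t \<in> ?S" unfolding *(1) mem_Collect_eq by (metis (no_types))
  qed
  note sub = T.span_mono[OF subset_trans[OF this T.span_superset] S]
  have "tw vs \<in> linear_span T ?S" if "length vs = r" for vs
    using word_in_basis_span[of vs] sub unfolding that by blast
  then show ?thesis
    unfolding tensor_power_def by (intro T.span_mono[OF _ S]) blast
qed

text \<open>The words in the basis span the tensor power, and on such a word the expansion reduces to a single
  term. Consequently a tensor with vanishing coordinates is zero.\<close>

lemma tensor_expansion:
  assumes "t \<in> V r"
  shows "t = (\<Oplus>\<^bsub>T\<^esub>u\<in>index_functions r. coeff r u t \<odot>\<^bsub>T\<^esub> tw (wd r (e \<circ> u)))"
proof -
  let ?S = "{tw (wd r (e \<circ> u)) | u. u \<in> index_functions r}"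
  let ?X = "T\<lparr>carrier := linear_span T ?S\<rparr>"
  have S: "?S \<subseteq> carrier T" by auto
  note res = linear_restrict_domain[OF _ T.span_subset_carrier[OF S]]
  show ?thesis
  proof (rule linear_eq_on_span[OF T.kspace_axioms T.kspace_axioms S,
      where g = "\<lambda>t. t" and h = "\<lambda>t. \<Oplus>\<^bsub>T\<^esub>u\<in>index_functions r. coeff r u t \<odot>\<^bsub>T\<^esub> tw (wd r (e \<circ> u))"])
    show "(\<lambda>t. \<Oplus>\<^bsub>T\<^esub>u\<in>index_functions r. coeff r u t \<odot>\<^bsub>T\<^esub> tw (wd r (e \<circ> u))) \<in> linear_maps ?X T"
      by (intro res linear_sum_map T.kspace_axioms linear_functional_times coeff(1)) simp
    show "(\<lambda>t. t) \<in> linear_maps ?X T" by (rule res[OF linear_maps_id])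
    show "t \<in> linear_span T ?S" using assms tensor_power_basis_span by blast
    fix x assume "x \<in> ?S"
    then obtain w where w: "w \<in> index_functions r" "x = tw (wd r (e \<circ> w))" by blast
    have "coeff r u x \<odot>\<^bsub>T\<^esub> tw (wd r (e \<circ> u)) = (if w = u then tw (wd r (e \<circ> u)) else \<zero>\<^bsub>T\<^esub>)"
      if "u \<in> index_functions r" for u
      using coeff_basis_word[OF index_functions_image[OF that] index_functions_image[OF w(1)]]
        index_functions_eq[OF that w(1)] w(2) by auto
    then have "(\<Oplus>\<^bsub>T\<^esub>u\<in>index_functions r. coeff r u x \<odot>\<^bsub>T\<^esub> tw (wd r (e \<circ> u)))
      = (\<Oplus>\<^bsub>T\<^esub>u\<in>index_functions r. if w = u then tw (wd r (e \<circ> u)) else \<zero>\<^bsub>T\<^esub>)"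
      by (intro T.finsum_cong'[OF refl]) auto
    also have "\<dots> = tw (wd r (e \<circ> w))"
      by (rule T.finsum_singleton[OF w(1)]) auto
    finally show "x = (\<Oplus>\<^bsub>T\<^esub>u\<in>index_functions r. coeff r u x \<odot>\<^bsub>T\<^esub> tw (wd r (e \<circ> u)))"
      using w(2) by simp
  qed
qed

subsection \<open>Alternating tensors\<close>

text \<open>Only neighbouring positions occur, because these are what the windows of length \<open>N\<close> defining
  \<open>W\<close> control. The vanishing on repeated indices is a separate condition on account of
  characteristic two.\<close>

definition alternating_tensor :: "nat \<Rightarrow> ('k, 'v) tensor \<Rightarrow> bool" where
  "alternating_tensor r t \<longleftrightarrow> (\<forall>u i. 1 \<le> i \<longrightarrow> i < r \<longrightarrow>
     coeff r (u \<circ> swap_adj i) t = - coeff r u t \<and> (u i = u (Suc i) \<longrightarrow> coeff r u t = 0))"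

lemma alternating_tensorD:
  "alternating_tensor r t \<Longrightarrow> 1 \<le> i \<Longrightarrow> i < r \<Longrightarrow>
    coeff r (u \<circ> swap_adj i) t = - coeff r u t \<and> (u i = u (Suc i) \<longrightarrow> coeff r u t = 0)"
  by (simp add: alternating_tensor_def)

lemma alternating_subspace: "submodule {t \<in> carrier T. alternating_tensor r t} scalar_ring T"
  by (rule T.subspaceI) (auto simp: alternating_tensor_def coeff_simps coeff_zero)

lemma coeff_Ant_word:
  "coeff r u (Ant scale r (tw (wd r v))) = (\<Sum>\<sigma>\<in>perms r. of_int (sign \<sigma>) * (\<Prod>j\<in>{1..r}. coord (u j) (v (\<sigma> j))))"
proof -
  have "coeff r u (Ant scale r (tw (wd r v)))
      = (\<Oplus>\<^bsub>field_space\<^esub>\<sigma>\<in>perms r. coeff r u (of_int (sign \<sigma>) \<odot>\<^bsub>T\<^esub> tw (wd r (v \<circ> \<sigma>))))"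
    unfolding Ant_word
    by (rule linear_finsum[OF coeff(1) T.kspace_axioms kspace_field_space]) auto
  also have "\<dots> = (\<Sum>\<sigma>\<in>perms r. coeff r u (of_int (sign \<sigma>) \<odot>\<^bsub>T\<^esub> tw (wd r (v \<circ> \<sigma>))))"
    by (rule finsum_field_space)
  finally show ?thesis by (simp add: coeff_simps coeff_word)
qed

lemma field_space_minus: "\<ominus>\<^bsub>field_space\<^esub> x = - x"
proof -
  interpret F: kspace "field_space :: ('a, 'a) module" by simp
  show ?thesis using F.minus_one_smult[of x] by simp
qed

text \<open>Composing the index function with a neighbouring transposition permutes the factors of each
  product of coordinates, and amounts to reindexing the sum over permutations.\<close>

lemma Ant_alternating:
  assumes "t \<in> Ant scale r ` V r"
  shows "alternating_tensor r t"
proof -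
  from assms obtain z where z: "z \<in> V r" "t = Ant scale r z" by blast
  have "Ant scale r (tw vs) \<in> {t \<in> carrier T. alternating_tensor r t}" if "length vs = r" for vs
  proof -
    define v where "v = (\<lambda>j. vs ! (j - 1))"
    have v: "vs = wd r v" unfolding v_def by (rule list_eq_wd[OF that])
    have "coeff r (u \<circ> swap_adj i) (Ant scale r (tw vs)) = - coeff r u (Ant scale r (tw vs))
        \<and> (u i = u (Suc i) \<longrightarrow> coeff r u (Ant scale r (tw vs)) = 0)" if i: "1 \<le> i" "i < r" for u i
    proof -
      let ?s = "swap_adj i"
      let ?P = "\<lambda>\<sigma>. \<Prod>j\<in>{1..r}. coord (u j) (v (\<sigma> j))"
      have s: "?s permutes {1..r}" by (rule swap_adj_permutes[OF i])
      have prod: "(\<Prod>j\<in>{1..r}. coord ((u \<circ> ?s) j) (v (\<sigma> j))) = ?P (\<sigma> \<circ> ?s)" for \<sigma>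
        using prod.permute[OF s, of "\<lambda>j. coord ((u \<circ> ?s) j) (v (\<sigma> j))"] by (simp add: o_def)
      have sgn: "sign (\<sigma> \<circ> ?s) = - sign \<sigma>" if "\<sigma> \<in> perms r" for \<sigma>
        using sign_comp_swap_adj[OF permutation_if_permutes] that by blast
      have perm: "\<sigma> \<circ> ?s \<in> perms r" if "\<sigma> \<in> perms r" for \<sigma>
        using permutes_compose[OF s] that by blast
      have invol: "\<sigma> \<circ> ?s \<circ> ?s = \<sigma>" for \<sigma> :: "nat \<Rightarrow> nat"
        by (simp add: fun_eq_iff)
      have "coeff r (u \<circ> ?s) (Ant scale r (tw vs)) = (\<Sum>\<sigma>\<in>perms r. of_int (sign \<sigma>) * ?P (\<sigma> \<circ> ?s))"
        unfolding v coeff_Ant_word prod ..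
      also have "\<dots> = (\<Sum>\<sigma>\<in>perms r. - (of_int (sign \<sigma>) * ?P \<sigma>))"
        by (rule sum.reindex_bij_witness[of _ "\<lambda>\<sigma>. \<sigma> \<circ> ?s" "\<lambda>\<sigma>. \<sigma> \<circ> ?s"])
          (use perm invol sgn in \<open>simp_all only: of_int_minus minus_mult_left minus_minus\<close>)
      also have "\<dots> = - coeff r u (Ant scale r (tw vs))"
        unfolding v coeff_Ant_word sum_negf ..
      finally have 1: "coeff r (u \<circ> ?s) (Ant scale r (tw vs)) = - coeff r u (Ant scale r (tw vs))" .
      have 2: "coeff r u (Ant scale r (tw vs)) = 0" if eq: "u i = u (Suc i)"
      proof -
        interpret F: kspace "field_space :: ('k, 'k) module" by simp
        have us: "u \<circ> ?s = u" using eq by (auto simp: fun_eq_iff Transposition.transpose_def)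
        have "(\<Oplus>\<^bsub>field_space\<^esub>\<sigma>\<in>perms r. of_int (sign \<sigma>) * ?P \<sigma>) = \<zero>\<^bsub>field_space :: ('k, 'k) module\<^esub>"
        proof (rule F.finsum_involution_zero[where \<rho> = "\<lambda>\<sigma>. \<sigma> \<circ> ?s"])
          fix \<sigma> assume \<sigma>: "\<sigma> \<in> perms r"
          have "\<sigma> i \<noteq> \<sigma> (Suc i)" using permutes_inj[of \<sigma> "{1..r}"] \<sigma> by (auto simp: inj_eq)
          then have "\<sigma> \<circ> ?s \<noteq> \<sigma>" by (metis comp_apply transpose_apply_first)
          then show "\<sigma> \<circ> ?s \<in> perms r \<and> \<sigma> \<circ> ?s \<circ> ?s = \<sigma> \<and> \<sigma> \<circ> ?s \<noteq> \<sigma>"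
            using perm[OF \<sigma>] invol by blast
          have "?P (\<sigma> \<circ> ?s) = ?P \<sigma>" using prod[of \<sigma>] unfolding us by simp
          then show "of_int (sign (\<sigma> \<circ> ?s)) * ?P (\<sigma> \<circ> ?s) = \<ominus>\<^bsub>field_space\<^esub> (of_int (sign \<sigma>) * ?P \<sigma>)"
            unfolding field_space_minus by (simp only: sgn[OF \<sigma>]) simp
        qed simp_all
        then show ?thesis unfolding v coeff_Ant_word finsum_field_space by simp
      qed
      show ?thesis using 1 2 by blast
    qed
    moreover have "Ant scale r (tw vs) \<in> carrier T"
      using Ant_in_power[OF tensor_word_in_power[OF that]] tensor_power_subset by blast
    ultimately show ?thesis unfolding alternating_tensor_def by blast
  qed
  from linear_on_words_closed[OF T.kspace_axioms Ant_linear alternating_subspace this z(1)]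
  show ?thesis unfolding z(2) by blast
qed

text \<open>Each coordinate vanishes or, after sorting its index, is up to sign the coordinate of an increasing
  word.\<close>

lemma alternating_tensor_zero:
  assumes t: "t \<in> V r" "alternating_tensor r t"
    and zero: "\<And>s. strict_mono_on {1..r} s \<Longrightarrow> s ` {1..r} \<subseteq> {1..n} \<Longrightarrow> coeff r s t = 0"
  shows "t = \<zero>\<^bsub>T\<^esub>"
proof -
  interpret F: kspace "field_space :: ('k, 'k) module" by simp
  note alt = F.alternating_from_adjacent[where F = "\<lambda>u. coeff r u t" and r = r, simplified]
  have adj: "coeff r (u \<circ> swap_adj i) t = - coeff r u t" "u i = u (Suc i) \<Longrightarrow> coeff r u t = 0"
    if "Suc 0 \<le> i" "i < r" for u i
    using t(2) that unfolding alternating_tensor_def by auto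
  have "coeff r u t = 0" if u: "u \<in> index_functions r" for u
  proof (cases "inj_on u {1..r}")
    case True
    then obtain \<sigma> where \<sigma>: "\<sigma> permutes {1..r}" "strict_mono_on {1..r} (u \<circ> \<sigma>)"
      by (rule ex_sorting_permutation)
    have "(u \<circ> \<sigma>) ` {1..r} \<subseteq> {1..n}"
      using index_functions_image[OF u] permutes_image[OF \<sigma>(1)] by (simp only: image_comp[symmetric])
    then have "coeff r (u \<circ> \<sigma>) t = 0" using zero \<sigma>(2) by blast
    moreover have "coeff r (u \<circ> \<sigma>) t = of_int (sign \<sigma>) * coeff r u t"
      using alt(1)[OF adj] \<sigma>(1) by simp
    ultimately show ?thesis by (simp add: sign_def split: if_splits)
  next
    case False
    then show ?thesis using alt(2)[OF adj] by simp
  qed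
  then have "(\<Oplus>\<^bsub>T\<^esub>u\<in>index_functions r. coeff r u t \<odot>\<^bsub>T\<^esub> tw (wd r (e \<circ> u))) = \<zero>\<^bsub>T\<^esub>"
    by (intro T.add.finprod_one_eqI) auto
  then show ?thesis using tensor_expansion[OF t(1)] by simp
qed

definition increasing :: "nat \<Rightarrow> (nat \<Rightarrow> nat) set" where
  "increasing r = {s \<in> index_functions r. strict_mono_on {1..r} s}"

lemma finite_increasing [simp]: "finite (increasing r)"
  unfolding increasing_def by simp

lemma restrict_increasing:
  "strict_mono_on {1..r} s \<Longrightarrow> s ` {1..r} \<subseteq> {1..n} \<Longrightarrow> restrict s {1..r} \<in> increasing r"
  using restrict_index_function[of s r] by (auto simp: increasing_def strict_mono_on_def)

text \<open>If two increasing index functions differ by a permutation, this permutation is itself increasing,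
  hence trivial.\<close>

lemma coeff_Ant_basis_word:
  assumes s: "strict_mono_on {1..r} s" "s ` {1..r} \<subseteq> {1..n}"
    and s': "strict_mono_on {1..r} s'" "s' ` {1..r} \<subseteq> {1..n}"
  shows "coeff r s (Ant scale r (tw (wd r (e \<circ> s')))) = (if \<forall>j\<in>{1..r}. s j = s' j then 1 else 0)"
proof -
  have "of_int (sign \<sigma>) * (\<Prod>j\<in>{1..r}. coord (s j) ((e \<circ> s') (\<sigma> j)))
      = (if \<sigma> = id then if \<forall>j\<in>{1..r}. s j = s' j then 1 else 0 else 0)" if "\<sigma> \<in> perms r" for \<sigma>
  proof -
    have \<sigma>: "\<sigma> permutes {1..r}" using that by simp
    have "(s' \<circ> \<sigma>) ` {1..r} \<subseteq> {1..n}"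
      using s'(2) permutes_image[OF \<sigma>] by (simp only: image_comp[symmetric])
    then have prod: "(\<Prod>j\<in>{1..r}. coord (s j) ((e \<circ> s') (\<sigma> j)))
        = (if \<forall>j\<in>{1..r}. s j = (s' \<circ> \<sigma>) j then 1 else 0)"
      using coeff_basis_word[OF s(2), of "s' \<circ> \<sigma>"] coeff_word[of r s "e \<circ> (s' \<circ> \<sigma>)"] by (simp add: o_def)
    show ?thesis
    proof (cases "\<sigma> = id")
      case True
      then show ?thesis unfolding prod by simp
    next
      case False
      have differ: "\<not> (\<forall>j\<in>{1..r}. s j = (s' \<circ> \<sigma>) j)"
      proof
        assume eq: "\<forall>j\<in>{1..r}. s j = (s' \<circ> \<sigma>) j"
        have "strict_mono_on {1..r} \<sigma>"
        proof (rule strict_mono_onI)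
          fix i j assume ij: "i \<in> {1..r}" "j \<in> {1..r}" "i < j"
          have "s' (\<sigma> i) < s' (\<sigma> j)" using strict_mono_onD[OF s(1) ij] eq ij by simp
          moreover have "\<sigma> i \<in> {1..r}" "\<sigma> j \<in> {1..r}" using ij permutes_in_image[OF \<sigma>] by blast+
          ultimately show "\<sigma> i < \<sigma> j"
            using strict_mono_onD[OF s'(1), of "\<sigma> j" "\<sigma> i"] by (cases "\<sigma> i = \<sigma> j") force+
        qed
        then show False using permutes_strict_mono_id[OF \<sigma>] False by blast
      qed
      show ?thesis unfolding prod by (simp only: differ False if_False mult_zero_right)
    qed
  qed
  then have "coeff r s (Ant scale r (tw (wd r (e \<circ> s'))))
    = (\<Sum>\<sigma>\<in>perms r. if \<sigma> = id then if \<forall>j\<in>{1..r}. s j = s' j then 1 else 0 else 0)"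
    unfolding coeff_Ant_word by (rule sum.cong[OF refl])
  also have "\<dots> = (if \<forall>j\<in>{1..r}. s j = s' j then 1 else 0)"
    unfolding sum.delta[OF finite_perms] by (simp only: mem_Collect_eq permutes_id if_True)
  finally show ?thesis .
qed

text \<open>No division by factorials: the antisymmetrized increasing words already form a basis of the
  alternating tensors, whatever the characteristic.\<close>

lemma alternating_in_Ant:
  assumes t: "t \<in> V r" "alternating_tensor r t"
  shows "t \<in> Ant scale r ` V r"
proof -
  define t' where "t' = (\<Oplus>\<^bsub>T\<^esub>s\<in>increasing r. coeff r s t \<odot>\<^bsub>T\<^esub> Ant scale r (tw (wd r (e \<circ> s))))"
  have A: "Ant scale r (tw (wd r (e \<circ> s))) \<in> Ant scale r ` V r" for s
    by (intro imageI tensor_word_in_power) simp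
  then have Ac: "Ant scale r (tw (wd r (e \<circ> s))) \<in> carrier T" for s
    using T.subspaceD(1)[OF Ant_image_subspace] by blast
  have t': "t' \<in> Ant scale r ` V r"
    unfolding t'_def
    by (rule T.subspace_finsum[OF Ant_image_subspace]) (use A T.subspaceD(4)[OF Ant_image_subspace] in blast)
  have tc: "t \<in> carrier T" and t'c: "t' \<in> carrier T"
    using t(1) tensor_power_subset T.subspaceD(1)[OF Ant_image_subspace t'] by blast+
  let ?d = "t \<oplus>\<^bsub>T\<^esub> (- 1) \<odot>\<^bsub>T\<^esub> t'"
  have "?d \<in> V r"
    using t(1) t' Ant_in_power T.subspaceD(3,4)[OF tensor_power_subspace] by blast
  moreover have "alternating_tensor r ?d"
    using T.subspaceD(3,4)[OF alternating_subspace[of r]] t(2) tc t'c Ant_alternating[OF t'] by blast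
  moreover have "coeff r s ?d = 0" if s: "strict_mono_on {1..r} s" "s ` {1..r} \<subseteq> {1..n}" for s
  proof -
    let ?s = "restrict s {1..r}"
    have ins: "?s \<in> increasing r" by (rule restrict_increasing[OF s])
    have cs: "coeff r ?s = coeff r s" by (rule coeff_cong) simp
    have "coeff r s t' = (\<Oplus>\<^bsub>field_space\<^esub>w\<in>increasing r. coeff r s (coeff r w t \<odot>\<^bsub>T\<^esub> Ant scale r (tw (wd r (e \<circ> w)))))"
      unfolding t'_def by (rule linear_finsum[OF coeff(1) T.kspace_axioms kspace_field_space]) (use Ac in auto)
    also have "\<dots> = (\<Sum>w\<in>increasing r. coeff r w t * coeff r ?s (Ant scale r (tw (wd r (e \<circ> w)))))"
      unfolding finsum_field_space cs using Ac by (simp add: coeff_simps)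
    also have "\<dots> = (\<Sum>w\<in>increasing r. if w = ?s then coeff r ?s t else 0)"
    proof (rule sum.cong[OF refl])
      fix w assume w: "w \<in> increasing r"
      show "coeff r w t * coeff r ?s (Ant scale r (tw (wd r (e \<circ> w)))) = (if w = ?s then coeff r ?s t else 0)"
      proof -
        have ws: "w \<in> index_functions r" "strict_mono_on {1..r} w"
          and ss: "?s \<in> index_functions r" "strict_mono_on {1..r} ?s"
          using w ins unfolding increasing_def by blast+
        have "coeff r ?s (Ant scale r (tw (wd r (e \<circ> w)))) = (if ?s = w then 1 else 0)"
          unfolding coeff_Ant_basis_word[OF ss(2) index_functions_image[OF ss(1)] ws(2) index_functions_image[OF ws(1)]]
            index_functions_eq[OF ss(1) ws(1)] ..
        then show ?thesis by (cases "w = ?s") simp_all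
      qed
    qed
    also have "\<dots> = coeff r s t" using ins cs by simp
    finally show ?thesis using tc t'c by (simp add: coeff_simps)
  qed
  ultimately have "?d = \<zero>\<^bsub>T\<^esub>" by (rule alternating_tensor_zero)
  then have "t = t'"
    using T.minus_equality[of t "\<ominus>\<^bsub>T\<^esub> t'"] tc t'c by (simp add: T.minus_one_smult)
  then show ?thesis using t' by simp
qed

text \<open>Any two neighbouring positions lie in a common window of length \<open>N \<ge> 2\<close>, so a tensor in \<open>W\<^sub>r\<close>
  has alternating coordinates. In degrees \<open>0\<close> and \<open>1\<close>, where there is no window, there are no
  neighbouring positions either, and both sides are the full tensor power. The degrees between \<open>1\<close>
  and \<open>N\<close>, for which the equality fails in general, are not values of \<open>\<nu>\<close>.\<close>

theorem koszul_W_eq_Ant: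
  assumes "2 \<le> N" "N \<le> r \<or> r \<le> 1"
  shows "koszul_W scale N r = Ant scale r ` V r"
proof
  show "koszul_W scale N r \<subseteq> Ant scale r ` V r"
  proof
    fix t assume t: "t \<in> koszul_W scale N r"
    have "coeff r (u \<circ> swap_adj i) t = - coeff r u t \<and> (u i = u (Suc i) \<longrightarrow> coeff r u t = 0)"
      if i: "1 \<le> i" "i < r" for u i
    proof -
      have "N \<le> r" using assms(2) i by auto
      \<comment> \<open>a window of length \<open>N\<close> containing both positions \<open>i\<close> and \<open>i + 1\<close>\<close>
      define k where "k = min (i - 1) (r - N)"
      define l where "l = r - N - k"
      have r: "k + N + l = r" using \<open>N \<le> r\<close> by (simp add: k_def l_def)
      have ki: "k < i" "Suc i \<le> k + N" using i \<open>N \<le> r\<close> assms(1) by (auto simp: k_def)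
      let ?S = "{a \<otimes>\<^bsub>T\<^esub> b \<otimes>\<^bsub>T\<^esub> c | a b c. a \<in> V k \<and> b \<in> sym_relations scale N \<and> c \<in> V l}"
      have S: "?S \<subseteq> carrier T"
        using Ant_in_power tensor_power_subset by (auto intro!: T.m_closed simp: sym_relations_def)
      have "t \<in> linear_span T ?S"
        using t r unfolding koszul_W_def by auto
      then show ?thesis using S
      proof (induction rule: T.span_induct)
        case (base x)
        then obtain a b c where abc: "a \<in> V k" "b \<in> Ant scale N ` V N" "c \<in> V l" "x = a \<otimes>\<^bsub>T\<^esub> b \<otimes>\<^bsub>T\<^esub> c"
          unfolding sym_relations_def by blast
        have b: "b \<in> V N" using abc(2) Ant_in_power by blast
        have co: "coeff r w x = coeff k w a * coeff N (\<lambda>j. w (k + j)) b * coeff l (\<lambda>j. w (k + N + j)) c" for w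
          unfolding abc(4) r[symmetric]
          by (simp only: coeff_mult[OF tensor_power_mult[OF abc(1) b] abc(3)] coeff_mult[OF abc(1) b])
        let ?w = "\<lambda>j. u (k + j)" and ?i = "i - k"
        have alt: "coeff N (?w \<circ> swap_adj ?i) b = - coeff N ?w b \<and> (?w ?i = ?w (Suc ?i) \<longrightarrow> coeff N ?w b = 0)"
        proof -
          have "1 \<le> ?i" "?i < N" using ki by auto
          then show ?thesis by (rule alternating_tensorD[OF Ant_alternating[OF abc(2)]])
        qed
        have "coeff k (u \<circ> swap_adj i) = coeff k u"
          by (rule coeff_cong) (use ki in \<open>auto simp: Transposition.transpose_def\<close>)
        moreover have "coeff l (\<lambda>j. (u \<circ> swap_adj i) (k + N + j)) = coeff l (\<lambda>j. u (k + N + j))"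
          by (rule coeff_cong) (use ki in \<open>auto simp: Transposition.transpose_def\<close>)
        moreover have "(\<lambda>j. (u \<circ> swap_adj i) (k + j)) = ?w \<circ> swap_adj ?i"
          using ki by (auto simp: Transposition.transpose_def fun_eq_iff)
        ultimately have "coeff r (u \<circ> swap_adj i) x = - coeff r u x"
          using alt unfolding co by simp
        moreover have "coeff r u x = 0" if "u i = u (Suc i)"
          using alt that ki unfolding co by simp
        ultimately show ?case by blast
      qed (auto simp: coeff_simps coeff_zero)
    qed
    then have "alternating_tensor r t" unfolding alternating_tensor_def by blast
    then show "t \<in> Ant scale r ` V r"
      using t koszul_W_subset by (intro alternating_in_Ant) auto
  qed
qed (rule Ant_subset_koszul_W)

end

section \<open>The isomorphism between exterior powers and alternating tensors\<close>

lemma wd_split: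
  assumes "1 \<le> i" "i < r"
  shows "wd r v = wd (i - 1) v @ v i # v (Suc i) # map v [Suc (Suc i)..<Suc r]"
proof -
  have "[1..<Suc r] = [1..<i] @ [i..<Suc r]"
    using upt_add_eq_append[of 1 i "Suc r - i"] assms by simp
  moreover have "[i..<Suc r] = i # Suc i # [Suc (Suc i)..<Suc r]"
    using assms by (simp add: upt_conv_Cons del: upt_Suc)
  ultimately show ?thesis using assms by (simp add: wd_def del: upt_Suc)
qed

context tensors
begin

text \<open>Polarization of the relation \<open>v \<and> v = 0\<close> at \<open>v = a + b\<close>.\<close>

lemma wedge_swap: "wedge scale (xs @ a # b # ys) = (- 1) \<odot>\<^bsub>Ext\<^esub> wedge scale (xs @ b # a # ys)"
proof -
  note ml = wedge_multilinear[unfolded multilinear_def]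
  let ?F = "wedge scale"
  have "\<zero>\<^bsub>Ext\<^esub> = ?F (xs @ (a + b) # (a + b) # ys)"
    by (rule wedge_adjacent_equal[symmetric])
  also have "\<dots> = ?F ((xs @ [a]) @ (a + b) # ys) \<oplus>\<^bsub>Ext\<^esub> ?F ((xs @ [b]) @ (a + b) # ys)"
    using ml by simp
  also have "\<dots> = (?F ((xs @ [a]) @ a # ys) \<oplus>\<^bsub>Ext\<^esub> ?F ((xs @ [a]) @ b # ys)) \<oplus>\<^bsub>Ext\<^esub>
      (?F ((xs @ [b]) @ a # ys) \<oplus>\<^bsub>Ext\<^esub> ?F ((xs @ [b]) @ b # ys))"
    using ml by metis
  also have "\<dots> = ?F (xs @ a # b # ys) \<oplus>\<^bsub>Ext\<^esub> ?F (xs @ b # a # ys)"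
    by (simp add: wedge_adjacent_equal)
  finally have "?F (xs @ a # b # ys) \<oplus>\<^bsub>Ext\<^esub> ?F (xs @ b # a # ys) = \<zero>\<^bsub>Ext\<^esub>" ..
  from Ext.minus_equality[OF this] show ?thesis by (simp add: Ext.minus_one_smult)
qed

lemma wedge_swap_adj:
  assumes "1 \<le> i" "i < r"
  shows "wedge scale (wd r (v \<circ> swap_adj i)) = (- 1) \<odot>\<^bsub>Ext\<^esub> wedge scale (wd r v)"
proof -
  have "wd (i - 1) (v \<circ> swap_adj i) = wd (i - 1) v"
    by (rule wd_cong) (use assms in \<open>auto simp: Transposition.transpose_def\<close>)
  moreover have "map (v \<circ> swap_adj i) [Suc (Suc i)..<Suc r] = map v [Suc (Suc i)..<Suc r]"
    by (rule map_cong[OF refl]) (auto simp: Transposition.transpose_def)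
  ultimately have eq: "wd r (v \<circ> swap_adj i) = wd (i - 1) v @ v (Suc i) # v i # map v [Suc (Suc i)..<Suc r]"
    unfolding wd_split[OF assms] by simp
  show ?thesis unfolding eq unfolding wd_split[OF assms, of v] by (rule wedge_swap)
qed

lemma wedge_equal_adj:
  assumes "1 \<le> i" "i < r" "v i = v (Suc i)"
  shows "wedge scale (wd r v) = \<zero>\<^bsub>Ext\<^esub>"
  unfolding wd_split[OF assms(1,2)] assms(3) by (rule wedge_adjacent_equal)

lemma wedge_permute:
  "\<sigma> permutes {1..r} \<Longrightarrow> wedge scale (wd r (v \<circ> \<sigma>)) = of_int (sign \<sigma>) \<odot>\<^bsub>Ext\<^esub> wedge scale (wd r v)"
  by (rule Ext.alternating_from_adjacent(1)[where F = "\<lambda>v. wedge scale (wd r v)"])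
    (simp_all only: wedge_closed wedge_swap_adj wedge_equal_adj)

lemma wedge_repeated: "\<not> inj_on v {1..r} \<Longrightarrow> wedge scale (wd r v) = \<zero>\<^bsub>Ext\<^esub>"
  by (rule Ext.alternating_from_adjacent(2)[where F = "\<lambda>v. wedge scale (wd r v)"])
    (simp_all only: wedge_closed wedge_swap_adj wedge_equal_adj)

text \<open>Words are cut after the \<open>a\<close>-th letter; a bilinear map of the two pieces is multilinear in the
  letters.\<close>

lemma tensor_split_lift:
  assumes "kspace Z" and l: "\<And>t. t \<in> carrier T \<Longrightarrow> (\<lambda>s. K s t) \<in> linear_maps T Z"
    and r: "\<And>s. s \<in> carrier T \<Longrightarrow> K s \<in> linear_maps T Z"
  obtains G where "G \<in> linear_maps T Z" "\<And>s t. s \<in> V a \<Longrightarrow> t \<in> V b \<Longrightarrow> G (s \<otimes>\<^bsub>T\<^esub> t) = K s t"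
proof -
  interpret Z: kspace Z by fact
  let ?F = "\<lambda>vs. K (tw (take a vs)) (tw (drop a vs))"
  note ml = tensor_word_multilinear[unfolded multilinear_def]
  have Kc: "K (tw xs) (tw ys) \<in> carrier Z" for xs ys
    using linear_closed[OF r] by simp
  have first: "K (tw (xs @ (v + w) # zs)) (tw ys) = K (tw (xs @ v # zs)) (tw ys) \<oplus>\<^bsub>Z\<^esub> K (tw (xs @ w # zs)) (tw ys)"
    "K (tw (xs @ scale c v # zs)) (tw ys) = c \<odot>\<^bsub>Z\<^esub> K (tw (xs @ v # zs)) (tw ys)" for xs v w zs ys c
    using ml linear_add[OF l[OF tensor_word_closed]] linear_smult[OF l[OF tensor_word_closed]] by simp_all
  have second: "K (tw ys) (tw (xs @ (v + w) # zs)) = K (tw ys) (tw (xs @ v # zs)) \<oplus>\<^bsub>Z\<^esub> K (tw ys) (tw (xs @ w # zs))"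
    "K (tw ys) (tw (xs @ scale c v # zs)) = c \<odot>\<^bsub>Z\<^esub> K (tw ys) (tw (xs @ v # zs))" for xs v w zs ys c
    using ml linear_add[OF r[OF tensor_word_closed]] linear_smult[OF r[OF tensor_word_closed]] by simp_all
  have slots: "take a (xs @ v # ys) = xs @ v # take (a - Suc (length xs)) ys
      \<and> drop a (xs @ v # ys) = drop (a - Suc (length xs)) ys" if "length xs < a" for xs ys and v :: 'v
    using that by (simp add: take_Cons' drop_Cons')
  have "multilinear scale Z ?F"
    unfolding multilinear_def
  proof (intro conjI allI)
    fix xs ys :: "'v list" and v w c
    show "?F (xs @ (v + w) # ys) = ?F (xs @ v # ys) \<oplus>\<^bsub>Z\<^esub> ?F (xs @ w # ys)"
      by (cases "length xs < a") (simp_all only: slots first, simp add: second)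
    show "?F (xs @ scale c v # ys) = c \<odot>\<^bsub>Z\<^esub> ?F (xs @ v # ys)"
      by (cases "length xs < a") (simp_all only: slots first, simp add: second)
  qed (rule Kc)
  from tensor_algebra_lift[OF assms(1) this]
  obtain G where G: "G \<in> linear_maps T Z" "\<And>vs. G (tw vs) = ?F vs" by metis
  have 1: "G (tw xs \<otimes>\<^bsub>T\<^esub> t) = K (tw xs) t" if "length xs = a" "t \<in> V b" for xs t
  proof (rule tensor_power_eqI[OF assms(1) linear_comp[OF T.mult_linear_right G(1)] r _ that(2)])
    show "G (tw xs \<otimes>\<^bsub>T\<^esub> tw vs) = K (tw xs) (tw vs)" for vs
      using that(1) by (simp add: tensor_word_append[symmetric] G(2))
  qed simp_all
  have "G (s \<otimes>\<^bsub>T\<^esub> t) = K s t" if "s \<in> V a" "t \<in> V b" for s t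
  proof -
    have tc: "t \<in> carrier T" using that(2) tensor_power_subset by blast
    show ?thesis
      by (rule tensor_power_eqI[OF assms(1) linear_comp[OF T.mult_linear_left[OF tc] G(1)] l[OF tc] _ that(1)])
        (rule 1[OF _ that(2)])
  qed
  with G(1) that show ?thesis by blast
qed

end

context based_tensors
begin

abbreviation "E \<equiv> exterior_power scale"
abbreviation "basis_wedges r \<equiv> {wedge scale (wd r (e \<circ> s)) | s. s \<in> increasing r}"

lemma basis_wedges_closed: "basis_wedges r \<subseteq> carrier Ext"
  by auto

lemma basis_word_wedge_span:
  assumes u: "u \<in> index_functions r"
  shows "wedge scale (wd r (e \<circ> u)) \<in> linear_span Ext (basis_wedges r)"
proof (cases "inj_on u {1..r}")
  case True
  then obtain \<sigma> where \<sigma>: "\<sigma> permutes {1..r}" "strict_mono_on {1..r} (u \<circ> \<sigma>)"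
    by (rule ex_sorting_permutation)
  let ?w = "restrict (u \<circ> \<sigma>) {1..r}"
  have "(u \<circ> \<sigma>) ` {1..r} \<subseteq> {1..n}"
    using index_functions_image[OF u] permutes_image[OF \<sigma>(1)] by (simp only: image_comp[symmetric])
  then have w: "?w \<in> increasing r" using restrict_increasing \<sigma>(2) by blast
  have "wedge scale (wd r (e \<circ> ?w)) = of_int (sign \<sigma>) \<odot>\<^bsub>Ext\<^esub> wedge scale (wd r (e \<circ> u))"
    unfolding wd_restrict using wedge_permute[OF \<sigma>(1), of "e \<circ> u"] by (simp only: comp_assoc)
  then have "of_int (sign \<sigma>) \<odot>\<^bsub>Ext\<^esub> wedge scale (wd r (e \<circ> ?w))
      = of_int (sign \<sigma> * sign \<sigma>) \<odot>\<^bsub>Ext\<^esub> wedge scale (wd r (e \<circ> u))"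
    by (simp only: Ext.smult_smult[OF wedge_closed] of_int_mult)
  then have eq: "wedge scale (wd r (e \<circ> u)) = of_int (sign \<sigma>) \<odot>\<^bsub>Ext\<^esub> wedge scale (wd r (e \<circ> ?w))"
    by simp
  have "wedge scale (wd r (e \<circ> ?w)) \<in> linear_span Ext (basis_wedges r)"
    by (rule subsetD[OF Ext.span_superset]) (use w in blast)
  then show ?thesis
    unfolding eq by (rule Ext.subspaceD(4)[OF Ext.span_subspace[OF basis_wedges_closed]])
next
  case False
  then have "\<not> inj_on (e \<circ> u) {1..r}" using inj_on_imageI2 by blast
  from wedge_repeated[OF this] show ?thesis
    using Ext.subspaceD(2)[OF Ext.span_subspace[OF basis_wedges_closed]] by simp
qed

text \<open>Words in the basis span the tensor power, and the wedge of such a word is zero or, after sorting,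
  up to sign the wedge of an increasing word. This is why the prescription of \<open>\<phi>\<close> on increasing
  words determines it.\<close>

lemma exterior_power_basis: "carrier (E r) = linear_span Ext (basis_wedges r)"
proof
  have words: "{tw (wd r (e \<circ> u)) | u. u \<in> index_functions r} \<subseteq> carrier T" by auto
  have "wedge scale vs \<in> linear_span Ext (basis_wedges r)" if "length vs = r" for vs
  proof -
    have "tw vs \<in> linear_span T {tw (wd r (e \<circ> u)) | u. u \<in> index_functions r}"
      by (rule subsetD[OF tensor_power_basis_span tensor_word_in_power[OF that]])
    from linear_image_span[OF T.kspace_axioms Ext.kspace_axioms wedge_projection words this]
    have 1: "wedge scale vs \<in> linear_span Ext ((\<lambda>t. exterior_ideal scale +>\<^bsub>T\<^esub> t) `
        {tw (wd r (e \<circ> u)) | u. u \<in> index_functions r})"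
      by (simp only: wedge_coset)
    have 2: "(\<lambda>t. exterior_ideal scale +>\<^bsub>T\<^esub> t) ` {tw (wd r (e \<circ> u)) | u. u \<in> index_functions r}
        \<subseteq> linear_span Ext (basis_wedges r)"
    proof (rule image_subsetI)
      fix t assume "t \<in> {tw (wd r (e \<circ> u)) | u. u \<in> index_functions r}"
      then obtain u where "u \<in> index_functions r" "t = tw (wd r (e \<circ> u))" by blast
      then show "exterior_ideal scale +>\<^bsub>T\<^esub> t \<in> linear_span Ext (basis_wedges r)"
        using basis_word_wedge_span by (simp only: wedge_coset)
    qed
    show ?thesis by (rule subsetD[OF Ext.span_mono[OF 2 basis_wedges_closed] 1])
  qed
  then show "carrier (E r) \<subseteq> linear_span Ext (basis_wedges r)"
    unfolding carrier_exterior_power by (intro Ext.span_mono basis_wedges_closed) blast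
  show "linear_span Ext (basis_wedges r) \<subseteq> carrier (E r)"
    unfolding carrier_exterior_power by (rule Ext.span_least[OF wedge_span_subspace])
      (auto intro!: subsetD[OF Ext.span_superset])
qed

abbreviation "\<phi> \<equiv> ext_to_Ant scale n e"

lemma exterior_power_record: "E r = Ext\<lparr>carrier := linear_span Ext (basis_wedges r)\<rparr>"
  using exterior_power_basis[of r] by (simp add: exterior_power_def)

lemma exterior_power_eqI:
  assumes "kspace Z" "g \<in> linear_maps (E r) Z" "h \<in> linear_maps (E r) Z"
    and "\<And>s. s \<in> increasing r \<Longrightarrow> g (wedge scale (wd r (e \<circ> s))) = h (wedge scale (wd r (e \<circ> s)))"
    and "x \<in> carrier (E r)"
  shows "g x = h x"
  by (rule linear_eq_on_span[OF Ext.kspace_axioms assms(1) basis_wedges_closed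
        assms(2)[unfolded exterior_power_record] assms(3)[unfolded exterior_power_record]])
    (use assms(4,5) exterior_power_basis in blast)+

text \<open>The map induced by antisymmetrization on the exterior power has the prescribed values on increasing
  words, so it is \<open>\<phi>\<close>, and its values on all other wedges are known as well.\<close>

lemma phi_properties:
  shows phi_linear: "\<phi> r \<in> linear_maps (E r) (T\<lparr>carrier := Ant scale r ` V r\<rparr>)" (is ?A)
    and phi_wedge: "length vs = r \<Longrightarrow> \<phi> r (wedge scale vs) = Ant scale r (tw vs)" (is "_ \<Longrightarrow> ?B")
proof -
  let ?W = "T\<lparr>carrier := Ant scale r ` V r\<rparr>"
  interpret Er: kspace "E r" by (rule kspace_exterior_power)
  interpret W: kspace ?W by (rule T.subspace_kspace[OF Ant_image_subspace])
  obtain g where g: "g \<in> linear_maps Ext T" "\<And>vs. length vs = r \<Longrightarrow> g (wedge scale vs) = Ant scale r (tw vs)"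
    by (rule Ant_on_wedges[of r]) blast
  have gE: "g \<in> linear_maps (E r) T"
    unfolding exterior_power_def
    by (rule linear_restrict_domain[OF g(1)]) (use exterior_power_subset carrier_exterior_power in blast)
  have "g ` carrier (E r) \<subseteq> Ant scale r ` V r"
  proof (rule image_subsetI)
    fix x assume "x \<in> carrier (E r)"
    then have "x \<in> linear_span Ext {wedge scale vs | vs. length vs = r}" by (simp only: carrier_exterior_power)
    then have 1: "g x \<in> linear_span T (g ` {wedge scale vs | vs. length vs = r})"
      by (rule linear_image_span[OF Ext.kspace_axioms T.kspace_axioms g(1), rotated]) auto
    have 2: "g ` {wedge scale vs | vs. length vs = r} \<subseteq> Ant scale r ` V r"
      using g(2) tensor_word_in_power by auto
    show "g x \<in> Ant scale r ` V r" by (rule subsetD[OF T.span_least[OF Ant_image_subspace 2] 1])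
  qed
  then have gW: "g \<in> linear_maps (E r) ?W" by (rule linear_restrict_range[OF gE])
  have eq: "\<phi> r = restrict g (carrier (E r))"
    unfolding ext_to_Ant_def
  proof (rule the_linear_map_eq[OF Er.kspace_axioms gW])
    show "\<forall>s. strict_mono_on {1..r} s \<and> s ` {1..r} \<subseteq> {1..n} \<longrightarrow>
      restrict g (carrier (E r)) (wedge scale (map (\<lambda>j. e (s j)) [1..<Suc r]))
        = Ant scale r (tw (map (\<lambda>j. e (s j)) [1..<Suc r]))"
      using g(2) wedge_in_power[of _ r] by (simp del: upt_Suc)
    fix h x assume h: "h \<in> linear_maps (E r) ?W"
      "\<forall>s. strict_mono_on {1..r} s \<and> s ` {1..r} \<subseteq> {1..n} \<longrightarrow>
        h (wedge scale (map (\<lambda>j. e (s j)) [1..<Suc r])) = Ant scale r (tw (map (\<lambda>j. e (s j)) [1..<Suc r]))"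
      and x: "x \<in> carrier (E r)"
    show "h x = g x"
    proof (rule exterior_power_eqI[OF W.kspace_axioms h(1) gW _ x])
      fix s assume "s \<in> increasing r"
      then have "strict_mono_on {1..r} s" "s ` {1..r} \<subseteq> {1..n}"
        using index_functions_image unfolding increasing_def by blast+
      moreover have "wd r (e \<circ> s) = map (\<lambda>j. e (s j)) [1..<Suc r]"
        by (simp add: wd_def)
      ultimately show "h (wedge scale (wd r (e \<circ> s))) = g (wedge scale (wd r (e \<circ> s)))"
        using h(2) g(2)[of "wd r (e \<circ> s)"] by simp
    qed
  qed
  show ?A unfolding eq by (rule linear_cong[OF gW Er.kspace_axioms]) simp
  show ?B if "length vs = r" unfolding eq using g(2)[OF that] wedge_in_power[OF that] by simp
qed

text \<open>The projection that keeps only the increasing words: a left inverse of \<open>\<phi>\<close> on all of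
  \<open>V\<^sup>\<otimes>\<^sup>r\<close>, defined in any characteristic.\<close>

definition increasing_part :: "nat \<Rightarrow> ('k, 'v) tensor \<Rightarrow> ('k, 'v) tensor set" where
  "increasing_part r t = (\<Oplus>\<^bsub>Ext\<^esub>s\<in>increasing r. coeff r s t \<odot>\<^bsub>Ext\<^esub> wedge scale (wd r (e \<circ> s)))"

lemma increasing_part_linear: "increasing_part r \<in> linear_maps T (E r)"
  unfolding exterior_power_def
proof (rule linear_restrict_range)
  show "increasing_part r \<in> linear_maps T Ext"
    unfolding increasing_part_def[abs_def]
    by (intro linear_sum_map T.kspace_axioms Ext.kspace_axioms linear_functional_times coeff(1) wedge_closed)
  have "increasing_part r t \<in> linear_span Ext {wedge scale vs | vs. length vs = r}" for t
    unfolding increasing_part_def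
  proof (intro Ext.subspace_finsum[OF wedge_span_subspace] funcsetI Ext.subspaceD(4)[OF wedge_span_subspace])
    show "wedge scale (wd r (e \<circ> s)) \<in> linear_span Ext {wedge scale vs | vs. length vs = r}" for s
      by (rule subsetD[OF Ext.span_superset]) auto
  qed
  then show "increasing_part r ` carrier T \<subseteq> linear_span Ext {wedge scale vs | vs. length vs = r}" by blast
qed

lemma phi_linear_T: "\<phi> r \<in> linear_maps (E r) T"
  by (rule linear_extend_range[OF phi_linear]) (use T.subspaceD(1)[OF Ant_image_subspace] in blast)

lemma increasing_part_phi:
  assumes "x \<in> carrier (E r)"
  shows "increasing_part r (\<phi> r x) = x"
proof (rule exterior_power_eqI[OF kspace_exterior_power _ linear_maps_id _ assms])
  show "(\<lambda>x. increasing_part r (\<phi> r x)) \<in> linear_maps (E r) (E r)"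
    by (rule linear_comp[OF phi_linear_T increasing_part_linear])
  fix w assume w: "w \<in> increasing r"
  have ww: "w \<in> index_functions r" "strict_mono_on {1..r} w" using w unfolding increasing_def by blast+
  have "coeff r s (Ant scale r (tw (wd r (e \<circ> w)))) \<odot>\<^bsub>Ext\<^esub> wedge scale (wd r (e \<circ> s))
      = (if w = s then wedge scale (wd r (e \<circ> s)) else \<zero>\<^bsub>Ext\<^esub>)" if "s \<in> increasing r" for s
  proof -
    have ss: "s \<in> index_functions r" "strict_mono_on {1..r} s" using that unfolding increasing_def by blast+
    show ?thesis
      unfolding coeff_Ant_basis_word[OF ss(2) index_functions_image[OF ss(1)] ww(2) index_functions_image[OF ww(1)]]
        index_functions_eq[OF ss(1) ww(1)] by (cases "w = s") auto
  qed
  then have "increasing_part r (Ant scale r (tw (wd r (e \<circ> w))))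
      = (\<Oplus>\<^bsub>Ext\<^esub>s\<in>increasing r. if w = s then wedge scale (wd r (e \<circ> s)) else \<zero>\<^bsub>Ext\<^esub>)"
    unfolding increasing_part_def by (intro Ext.finsum_cong'[OF refl]) auto
  also have "\<dots> = wedge scale (wd r (e \<circ> w))"
    by (rule Ext.finsum_singleton[OF w]) auto
  finally show "increasing_part r (\<phi> r (wedge scale (wd r (e \<circ> w)))) = wedge scale (wd r (e \<circ> w))"
    by (simp add: phi_wedge)
qed

lemma phi_inj: "inj_on (\<phi> r) (carrier (E r))"
  by (rule inj_on_inverseI[where g = "increasing_part r"]) (rule increasing_part_phi)

lemma increasing_part_Ant:
  "length vs = r \<Longrightarrow> increasing_part r (Ant scale r (tw vs)) = wedge scale vs"
  using increasing_part_phi[OF wedge_in_power] phi_wedge by metis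

lemma phi_increasing_part:
  assumes "t \<in> Ant scale r ` V r"
  shows "\<phi> r (increasing_part r t) = t"
proof -
  from assms obtain z where z: "z \<in> V r" "t = Ant scale r z" by blast
  have A: "Ant scale r \<in> linear_maps (T\<lparr>carrier := linear_span T {tw vs | vs. length vs = r}\<rparr>) T"
    using Ant_linear[of r] by (simp only: tensor_power_def)
  show ?thesis
    unfolding z(2)
  proof (rule linear_eq_on_span[OF T.kspace_axioms T.kspace_axioms words_closed _ A])
    show "(\<lambda>z. \<phi> r (increasing_part r (Ant scale r z)))
        \<in> linear_maps (T\<lparr>carrier := linear_span T {tw vs | vs. length vs = r}\<rparr>) T"
      by (rule linear_comp[OF linear_comp[OF A increasing_part_linear] phi_linear_T])
    show "z \<in> linear_span T {tw vs |vs. length vs = r}" using z(1) by (simp only: tensor_power_def)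
    fix x assume "x \<in> {tw vs |vs. length vs = r}"
    then obtain vs where "x = tw vs" "length vs = r" by blast
    then show "\<phi> r (increasing_part r (Ant scale r x)) = Ant scale r x"
      using increasing_part_Ant[of vs r] phi_wedge[of vs r] by simp
  qed
qed

lemma inv_phi:
  assumes "t \<in> Ant scale r ` V r"
  shows "inv_into (carrier (E r)) (\<phi> r) t = increasing_part r t"
  by (rule inv_into_f_eq[OF phi_inj _ phi_increasing_part[OF assms]])
    (use linear_closed[OF increasing_part_linear] T.subspaceD(1)[OF Ant_image_subspace assms] in blast)

end

section \<open>The cap product\<close>

lemma kspace_bimodule: "algebra_bimodule A M \<Longrightarrow> kspace M"
  unfolding kspace_def by (rule algebra_bimodule.axioms(1))

lemma balanced_relations_closed:
  assumes "algebra_bimodule A M" "algebra_bimodule A P"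
  shows "balanced_relations A M P \<subseteq> carrier (free_space (carrier M \<times> carrier P))"
proof
  fix u assume "u \<in> balanced_relations A M P"
  then obtain x a y where u: "u = Poly_Mapping.single (ract M x a, y) 1 - Poly_Mapping.single (x, lact P a y) 1"
    and mem: "x \<in> carrier M" "a \<in> carrier A" "y \<in> carrier P"
    unfolding balanced_relations_def by blast
  have "Poly_Mapping.keys u \<subseteq> {(ract M x a, y), (x, lact P a y)}"
    unfolding u using Poly_Mapping.keys_diff by (rule order_trans) auto
  moreover have "(ract M x a, y) \<in> carrier M \<times> carrier P" "(x, lact P a y) \<in> carrier M \<times> carrier P"
    using algebra_bimodule.ract_closed[OF assms(1) mem(2,1)]
      algebra_bimodule.lact_closed[OF assms(2) mem(2,3)] mem by simp_all
  ultimately show "u \<in> carrier (free_space (carrier M \<times> carrier P))" by auto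
qed

lemma nu_window: "N \<le> nu N p \<or> nu N p \<le> 1"
proof (cases "p < 2")
  case True
  then have "p = 0 \<or> p = 1" by auto
  then show ?thesis by (auto simp: nu_def)
next
  case False
  then have "1 \<le> p div 2" by simp
  then have "N * 1 \<le> N * (p div 2)" by (rule mult_le_mono2)
  also have "\<dots> \<le> nu N p" by (simp add: nu_def)
  finally show ?thesis by simp
qed

lemma nu_mono:
  assumes "1 \<le> N" "p \<le> q"
  shows "nu N p \<le> nu N q"
proof (cases "p div 2 = q div 2")
  case True
  then have "odd p \<Longrightarrow> odd q" using assms(2) by presburger
  then show ?thesis using True by (simp add: nu_def)
next
  case False
  then have "Suc (p div 2) \<le> q div 2" using div_le_mono[OF assms(2), of 2] by simp
  then have "N * Suc (p div 2) \<le> N * (q div 2)" by (rule mult_le_mono2)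
  also have "\<dots> \<le> nu N q" by (simp add: nu_def)
  finally have "N * Suc (p div 2) \<le> nu N q" .
  moreover have "nu N p \<le> N * Suc (p div 2)" using assms(1) by (simp add: nu_def)
  ultimately show ?thesis by linarith
qed

text \<open>This reduces the second formula for the cap product to its term \<open>i = j = 0\<close>.\<close>

lemma nu_additive_odd:
  assumes "odd p" "odd d" "nu N (p + d) = nu N p + nu N d"
  shows "N = 2"
proof -
  obtain i j where "p = 2 * i + 1" "d = 2 * j + 1" using assms(1,2) by (metis oddE)
  then show ?thesis using assms(3) by (auto simp: nu_def algebra_simps)
qed

locale cap_setting = based_tensors scale e n
  for scale :: "'k::field \<Rightarrow> 'v::ab_group_add \<Rightarrow> 'v" and e :: "nat \<Rightarrow> 'v" and n :: nat +
  fixes N p q :: nat and M :: "('k, 'v, 'm) sym_bimodule" and P :: "('k, 'v, 'p) sym_bimodule"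
    and f :: "('k, 'v) tensor set \<Rightarrow> 'p"
  assumes N: "2 \<le> N"
    and bimodule_M: "algebra_bimodule (sym_algebra scale N) M"
    and bimodule_P: "algebra_bimodule (sym_algebra scale N) P"
    and le: "p \<le> q"
    and additive: "nu N q = nu N p + nu N (q - p)"
    and f: "f \<in> linear_maps (exterior_power scale (nu N p)) P"
begin

abbreviation "a \<equiv> nu N p"
abbreviation "b \<equiv> nu N (q - p)"
abbreviation "W \<equiv> koszul_W scale N"
abbreviation "Wsp \<equiv> koszul_space scale N"
abbreviation "MP \<equiv> tensor_product_over (sym_algebra scale N) M P"
abbreviation "C \<equiv> tensor_product MP (E b)"
abbreviation "C' \<equiv> tensor_product MP (Wsp b)"
abbreviation "f' \<equiv> \<lambda>w. f (inv_into (carrier (E a)) (\<phi> a) w)"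
abbreviation "pure' \<equiv> pure_tensor MP (Wsp b)"
abbreviation "pure_over \<equiv> pure_tensor_over (sym_algebra scale N) M P"

sublocale M: algebra_bimodule "sym_algebra scale N" M by (rule bimodule_M)
sublocale P: algebra_bimodule "sym_algebra scale N" P by (rule bimodule_P)
sublocale MK: kspace M by (rule kspace_bimodule[OF bimodule_M])
sublocale PK: kspace P by (rule kspace_bimodule[OF bimodule_P])

lemma W_eq: "W (nu N k) = Ant scale (nu N k) ` V (nu N k)"
  by (rule koszul_W_eq_Ant[OF N nu_window])

lemma Wsp_eq: "Wsp (nu N k) = T\<lparr>carrier := Ant scale (nu N k) ` V (nu N k)\<rparr>"
  by (simp add: koszul_space_def W_eq)

lemma carrier_Wsp [simp]: "carrier (Wsp r) = W r"
  by (simp add: koszul_space_def)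

lemma kspace_Wsp: "kspace (Wsp (nu N k))"
  unfolding Wsp_eq by (rule T.subspace_kspace[OF Ant_image_subspace])

lemmas over = tensor_product_over_bilinear[OF MK.kspace_axioms PK.kspace_axioms
    balanced_relations_closed[OF bimodule_M bimodule_P]]

lemma kspace_MP: "kspace MP" by (rule over(1))

sublocale C': kspace_pair MP "Wsp b"
  by (simp add: kspace_pair_def kspace_MP kspace_Wsp)

sublocale C: kspace_pair MP "E b"
  by (simp add: kspace_pair_def kspace_MP kspace_exterior_power)

sublocale chains: kspace_pair M "Wsp (nu N q)"
  by (simp add: kspace_pair_def MK.kspace_axioms kspace_Wsp)

sublocale C'K: kspace C' by (rule C'.kspace_tensor_product)
sublocale CK: kspace C by (rule C.kspace_tensor_product)

lemma phi_Wsp: "\<phi> (nu N k) \<in> linear_maps (E (nu N k)) (Wsp (nu N k))"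
  unfolding Wsp_eq by (rule phi_linear)

text \<open>The bilinear map underlying the cap product, extended from \<open>W\<^sub>\<nu>\<^sub>(\<^sub>p\<^sub>) \<times> W\<^sub>\<nu>\<^sub>(\<^sub>q\<^sub>-\<^sub>p\<^sub>)\<close> to all tensors
  by means of the projection onto increasing words.\<close>

definition K :: "'m \<Rightarrow> ('k, 'v) tensor \<Rightarrow> ('k, 'v) tensor \<Rightarrow> (('m \<times> 'p \<Rightarrow>\<^sub>0 'k) set \<times> ('k, 'v) tensor \<Rightarrow>\<^sub>0 'k) set" where
  "K m s t = pure' (pure_over m (f (increasing_part a s))) (\<phi> b (increasing_part b t))"

lemma f_closed: "s \<in> carrier T \<Longrightarrow> f (increasing_part a s) \<in> carrier P"
  by (rule linear_closed[OF linear_comp[OF increasing_part_linear f]])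

lemma projection_linear: "(\<lambda>t. \<phi> b (increasing_part b t)) \<in> linear_maps T (Wsp b)"
  by (rule linear_comp[OF increasing_part_linear phi_Wsp])

lemma K_linear_1:
  assumes "s \<in> carrier T" "t \<in> carrier T"
  shows "(\<lambda>m. K m s t) \<in> linear_maps M C'"
  unfolding K_def
  by (rule linear_comp[OF over(2)[OF f_closed[OF assms(1)]]
        C'.pure_tensor_linear_left[OF linear_closed[OF projection_linear assms(2)]]])

lemma K_linear_2:
  assumes "m \<in> carrier M" "t \<in> carrier T"
  shows "(\<lambda>s. K m s t) \<in> linear_maps T C'"
  unfolding K_def
  by (rule linear_comp[OF linear_comp[OF linear_comp[OF increasing_part_linear f] over(3)[OF assms(1)]]
        C'.pure_tensor_linear_left[OF linear_closed[OF projection_linear assms(2)]]])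

lemma K_linear_3:
  assumes "m \<in> carrier M" "s \<in> carrier T"
  shows "K m s \<in> linear_maps T C'"
  unfolding K_def[abs_def]
  by (rule linear_comp[OF projection_linear
        C'.pure_tensor_linear_right[OF linear_closed[OF over(3)[OF assms(1)] f_closed[OF assms(2)]]]])

text \<open>The cap product of \<open>m \<otimes> w\<close> with the cochain, as a function of \<open>w\<close> on the full tensor algebra;
  only its values in degree \<open>\<nu>(q)\<close> matter.\<close>

definition capmap :: "'m \<Rightarrow> ('k, 'v) tensor \<Rightarrow> (('m \<times> 'p \<Rightarrow>\<^sub>0 'k) set \<times> ('k, 'v) tensor \<Rightarrow>\<^sub>0 'k) set" where
  "capmap m = (SOME G. G \<in> linear_maps T C' \<and> (\<forall>s\<in>V a. \<forall>t\<in>V b. G (s \<otimes>\<^bsub>T\<^esub> t) = K m s t))"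

lemma capmap:
  assumes "m \<in> carrier M"
  shows capmap_linear: "capmap m \<in> linear_maps T C'"
    and capmap_mult: "s \<in> V a \<Longrightarrow> t \<in> V b \<Longrightarrow> capmap m (s \<otimes>\<^bsub>T\<^esub> t) = K m s t"
proof -
  have "\<exists>G. G \<in> linear_maps T C' \<and> (\<forall>s\<in>V a. \<forall>t\<in>V b. G (s \<otimes>\<^bsub>T\<^esub> t) = K m s t)"
    by (rule tensor_split_lift[OF C'K.kspace_axioms K_linear_2[OF assms] K_linear_3[OF assms], of a b])
      (assumption | intro exI conjI ballI | simp)+
  from someI_ex[OF this] show "capmap m \<in> linear_maps T C'"
    and "s \<in> V a \<Longrightarrow> t \<in> V b \<Longrightarrow> capmap m (s \<otimes>\<^bsub>T\<^esub> t) = K m s t"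
    unfolding capmap_def[symmetric] by blast+
qed

lemma capmap_word:
  assumes "m \<in> carrier M" "length vs = a + b"
  shows "capmap m (tw vs) = K m (tw (take a vs)) (tw (drop a vs))"
proof -
  have "tw vs = tw (take a vs) \<otimes>\<^bsub>T\<^esub> tw (drop a vs)"
    by (simp add: tensor_word_append[symmetric])
  then show ?thesis
    using capmap_mult[OF assms(1) tensor_word_in_power tensor_word_in_power] assms(2) by simp
qed

lemma capmap_linear_left:
  assumes "w \<in> V (a + b)"
  shows "(\<lambda>m. capmap m w) \<in> linear_maps M C'"
proof (rule linear_mapsI)
  have wc: "w \<in> carrier T" using assms tensor_power_subset by blast
  show "capmap m w \<in> carrier C'" if "m \<in> carrier M" for m
    by (rule linear_closed[OF capmap_linear[OF that] wc])
  note kl = linear_mapsD(2,3)[OF K_linear_1[OF tensor_word_closed tensor_word_closed]]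
  show "capmap (m \<oplus>\<^bsub>M\<^esub> m') w = capmap m w \<oplus>\<^bsub>C'\<^esub> capmap m' w" if m: "m \<in> carrier M" "m' \<in> carrier M" for m m'
    by (rule tensor_power_eqI[OF C'K.kspace_axioms capmap_linear
          linear_add_map[OF C'K.kspace_axioms capmap_linear capmap_linear] _ assms])
      (simp_all add: m capmap_word kl)
  show "capmap (c \<odot>\<^bsub>M\<^esub> m) w = c \<odot>\<^bsub>C'\<^esub> capmap m w" if m: "m \<in> carrier M" for c m
    by (rule tensor_power_eqI[OF C'K.kspace_axioms capmap_linear
          linear_smult_map[OF C'K.kspace_axioms capmap_linear] _ assms])
      (simp_all add: m capmap_word kl)
qed

subsection \<open>Evaluation of the definitions\<close>

abbreviation "cap_gens \<equiv> {x \<otimes>\<^bsub>T\<^esub> y \<otimes>\<^bsub>T\<^esub> z \<otimes>\<^bsub>T\<^esub> d \<otimes>\<^bsub>T\<^esub> h | x y z d h.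
    x \<in> V 0 \<and> y \<in> W a \<and> z \<in> V 0 \<and> d \<in> W b \<and> h \<in> V 0}"

lemma W_carrier: "y \<in> W r \<Longrightarrow> y \<in> carrier T"
  using koszul_W_subset tensor_power_subset by blast

lemma cap_gens_closed: "cap_gens \<subseteq> carrier T"
proof
  fix t assume "t \<in> cap_gens"
  then obtain x y z d h where "t = x \<otimes>\<^bsub>T\<^esub> y \<otimes>\<^bsub>T\<^esub> z \<otimes>\<^bsub>T\<^esub> d \<otimes>\<^bsub>T\<^esub> h"
    "x \<in> V 0" "y \<in> W a" "z \<in> V 0" "d \<in> W b" "h \<in> V 0" by blast
  moreover have "V 0 \<subseteq> carrier T" by (rule tensor_power_subset)
  ultimately show "t \<in> carrier T" using W_carrier by (auto intro!: T.m_closed)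
qed

lemma one_in_V0: "\<one>\<^bsub>T\<^esub> \<in> V 0"
  using tensor_word_in_power[of "[]" 0] by (simp add: tensor_word_Nil)

text \<open>The cap product evaluates \<open>cap_on_words\<close> at every element of \<open>W\<^sub>\<nu>\<^sub>(\<^sub>q\<^sub>)\<close>, while this map has an
  arbitrary default value outside the span of the products; so the inclusion
  \<open>W\<^sub>\<nu>\<^sub>(\<^sub>q\<^sub>) \<subseteq> W\<^sub>\<nu>\<^sub>(\<^sub>p\<^sub>) \<otimes> W\<^sub>\<nu>\<^sub>(\<^sub>q\<^sub>-\<^sub>p\<^sub>)\<close> is indispensable. It is the shuffle expansion.\<close>

lemma W_subset_cap_domain: "W (nu N q) \<subseteq> linear_span T cap_gens"
proof
  fix w assume "w \<in> W (nu N q)"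
  then have "w \<in> Ant scale (a + b) ` V (a + b)" unfolding W_eq unfolding additive .
  from Ant_split_span[OF this]
  have 1: "w \<in> linear_span T {x \<otimes>\<^bsub>T\<^esub> y | x y. x \<in> W a \<and> y \<in> W b}" unfolding W_eq .
  have 2: "{x \<otimes>\<^bsub>T\<^esub> y | x y. x \<in> W a \<and> y \<in> W b} \<subseteq> cap_gens"
  proof
    fix t assume "t \<in> {x \<otimes>\<^bsub>T\<^esub> y | x y. x \<in> W a \<and> y \<in> W b}"
    then obtain x y where xy: "t = x \<otimes>\<^bsub>T\<^esub> y" "x \<in> W a" "y \<in> W b" by blast
    then have "t = \<one>\<^bsub>T\<^esub> \<otimes>\<^bsub>T\<^esub> x \<otimes>\<^bsub>T\<^esub> \<one>\<^bsub>T\<^esub> \<otimes>\<^bsub>T\<^esub> y \<otimes>\<^bsub>T\<^esub> \<one>\<^bsub>T\<^esub>"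
      using W_carrier by simp
    then show "t \<in> cap_gens" using xy(2,3) one_in_V0 by blast
  qed
  show "w \<in> linear_span T cap_gens"
    by (rule subsetD[OF T.span_mono[OF subset_trans[OF 2 T.span_superset] cap_gens_closed] 1])
qed

lemma f'_eq: "y \<in> W a \<Longrightarrow> f' y = f (increasing_part a y)"
  using inv_phi[of y a] by (simp add: W_eq)

text \<open>The three factors in \<open>V\<^sup>\<otimes>\<^sup>0\<close> are scalars and can be pulled out of all the tensor products.\<close>

lemma cap_on_words_eq:
  assumes m: "m \<in> carrier M"
  shows "cap_on_words scale N M P p q 0 0 0 f' m = restrict (capmap m) (linear_span T cap_gens)"
proof -
  let ?D = "linear_span T cap_gens"
  let ?X = "T\<lparr>carrier := ?D\<rparr>"
  let ?\<pi> = "to_sym scale N"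
  let ?S = "\<lambda>g. \<forall>x\<in>V 0. \<forall>y\<in>W a. \<forall>z\<in>V 0. \<forall>d\<in>W b. \<forall>h\<in>V 0.
      g (x \<otimes>\<^bsub>T\<^esub> y \<otimes>\<^bsub>T\<^esub> z \<otimes>\<^bsub>T\<^esub> d \<otimes>\<^bsub>T\<^esub> h) = pure'
        (pure_over (ract M (lact M (?\<pi> h) m) (?\<pi> x)) (ract P (f' y) (?\<pi> z))) d"
  note sub = T.span_subspace[OF cap_gens_closed]
  have kX: "kspace ?X" by (rule T.subspace_kspace[OF sub])
  have lin: "capmap m \<in> linear_maps ?X C'"
    by (rule linear_restrict_domain[OF capmap_linear[OF m] T.span_subset_carrier[OF cap_gens_closed]])
  have eval_at: "capmap m (x \<otimes>\<^bsub>T\<^esub> y \<otimes>\<^bsub>T\<^esub> z \<otimes>\<^bsub>T\<^esub> d \<otimes>\<^bsub>T\<^esub> h) = pure'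
        (pure_over (ract M (lact M (?\<pi> h) m) (?\<pi> x)) (ract P (f' y) (?\<pi> z))) d"
    if mem: "x \<in> V 0" "y \<in> W a" "z \<in> V 0" "d \<in> W b" "h \<in> V 0" for x y z d h
  proof -
    obtain \<alpha> \<beta> \<gamma> where s: "x = \<alpha> \<odot>\<^bsub>T\<^esub> \<one>\<^bsub>T\<^esub>" "z = \<beta> \<odot>\<^bsub>T\<^esub> \<one>\<^bsub>T\<^esub>" "h = \<gamma> \<odot>\<^bsub>T\<^esub> \<one>\<^bsub>T\<^esub>"
      using tensor_power_zero[OF mem(1)] tensor_power_zero[OF mem(3)] tensor_power_zero[OF mem(5)] by metis
    have yc: "y \<in> carrier T" and dc: "d \<in> carrier T" using mem W_carrier by blast+
    have yV: "y \<in> V a" and dV: "d \<in> V b" using mem koszul_W_subset by blast+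
    have fy: "f' y = f (increasing_part a y)" by (rule f'_eq[OF mem(2)])
    have fc: "f (increasing_part a y) \<in> carrier P" by (rule f_closed[OF yc])
    have pd: "\<phi> b (increasing_part b d) = d" using phi_increasing_part mem(4) unfolding W_eq .
    have po: "pure_over m (f (increasing_part a y)) \<in> carrier MP" by (rule linear_closed[OF over(3)[OF m] fc])
    have "x \<otimes>\<^bsub>T\<^esub> y \<otimes>\<^bsub>T\<^esub> z \<otimes>\<^bsub>T\<^esub> d \<otimes>\<^bsub>T\<^esub> h = (\<alpha> * \<gamma> * \<beta>) \<odot>\<^bsub>T\<^esub> (y \<otimes>\<^bsub>T\<^esub> d)"
      unfolding s using yc dc by (simp add: T.smult_mult_left T.smult_mult_right T.smult_smult mult_ac)
    then have "capmap m (x \<otimes>\<^bsub>T\<^esub> y \<otimes>\<^bsub>T\<^esub> z \<otimes>\<^bsub>T\<^esub> d \<otimes>\<^bsub>T\<^esub> h) = (\<alpha> * \<gamma> * \<beta>) \<odot>\<^bsub>C'\<^esub> K m y d"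
      using linear_smult[OF capmap_linear[OF m], of "y \<otimes>\<^bsub>T\<^esub> d"] yc dc capmap_mult[OF m yV dV] by simp
    also have "\<dots> = (\<alpha> * \<gamma> * \<beta>) \<odot>\<^bsub>C'\<^esub> pure' (pure_over m (f (increasing_part a y))) d"
      unfolding K_def pd ..
    also have "\<dots> = pure' ((\<alpha> * \<gamma> * \<beta>) \<odot>\<^bsub>MP\<^esub> pure_over m (f (increasing_part a y))) d"
      by (rule linear_smult[OF C'.pure_tensor_linear_left po, symmetric]) (simp add: mem(4))
    also have "(\<alpha> * \<gamma> * \<beta>) \<odot>\<^bsub>MP\<^esub> pure_over m (f (increasing_part a y))
        = pure_over ((\<alpha> * \<gamma>) \<odot>\<^bsub>M\<^esub> m) (\<beta> \<odot>\<^bsub>P\<^esub> f (increasing_part a y))"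
      using linear_smult[OF over(3)[OF MK.smult_in[OF m]] fc, of "\<alpha> * \<gamma>" \<beta>]
        linear_smult[OF over(2)[OF fc] m, of "\<alpha> * \<gamma>"] kspace.smult_smult[OF kspace_MP po, of \<beta> "\<alpha> * \<gamma>"]
      by (simp add: mult_ac)
    also have "(\<alpha> * \<gamma>) \<odot>\<^bsub>M\<^esub> m = ract M (lact M (?\<pi> h) m) (?\<pi> x)"
      unfolding s to_sym_scalar using m by (simp add: M.lact_scalar M.ract_scalar MK.smult_smult)
    also have "\<beta> \<odot>\<^bsub>P\<^esub> f (increasing_part a y) = ract P (f' y) (?\<pi> z)"
      unfolding s to_sym_scalar fy using fc by (simp add: P.ract_scalar)
    finally show ?thesis .
  qed
  have "the_linear_map ?X C' ?S = restrict (capmap m) (carrier ?X)"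
  proof (rule the_linear_map_eq[OF kX lin])
    show "?S (restrict (capmap m) (carrier ?X))"
    proof (intro ballI)
      fix x y z d h assume mem: "x \<in> V 0" "y \<in> W a" "z \<in> V 0" "d \<in> W b" "h \<in> V 0"
      have "x \<otimes>\<^bsub>T\<^esub> y \<otimes>\<^bsub>T\<^esub> z \<otimes>\<^bsub>T\<^esub> d \<otimes>\<^bsub>T\<^esub> h \<in> ?D"
        by (rule subsetD[OF T.span_superset]) (use mem in blast)
      then show "restrict (capmap m) (carrier ?X) (x \<otimes>\<^bsub>T\<^esub> y \<otimes>\<^bsub>T\<^esub> z \<otimes>\<^bsub>T\<^esub> d \<otimes>\<^bsub>T\<^esub> h) = pure'
        (pure_over (ract M (lact M (?\<pi> h) m) (?\<pi> x)) (ract P (f' y) (?\<pi> z))) d"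
        using eval_at[OF mem] by simp
    qed
    fix g t assume g: "g \<in> linear_maps ?X C'" "?S g" and t: "t \<in> carrier ?X"
    show "g t = capmap m t"
    proof (rule linear_eq_on_span[OF T.kspace_axioms C'K.kspace_axioms cap_gens_closed g(1) lin])
      show "t \<in> ?D" using t by simp
      fix w assume "w \<in> cap_gens"
      then obtain x y z d h where w: "w = x \<otimes>\<^bsub>T\<^esub> y \<otimes>\<^bsub>T\<^esub> z \<otimes>\<^bsub>T\<^esub> d \<otimes>\<^bsub>T\<^esub> h"
        and mem: "x \<in> V 0" "y \<in> W a" "z \<in> V 0" "d \<in> W b" "h \<in> V 0" by blast
      show "g w = capmap m w" unfolding w eval_at[OF mem] by (rule bspec[OF bspec[OF bspec[OF bspec[OF bspec[OF g(2) mem(1)] mem(2)] mem(3)] mem(4)] mem(5)])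
    qed
  qed
  then show ?thesis
    unfolding cap_on_words_def Let_def by simp
qed

text \<open>Linearity in \<open>m\<close> of the maps chosen separately for each \<open>m\<close> is what makes their common extension
  to \<open>M \<otimes> W\<^sub>\<nu>\<^sub>(\<^sub>q\<^sub>)\<close> exist.\<close>

lemma cap_term_pure:
  assumes m: "m \<in> carrier M" and w: "w \<in> W (nu N q)"
  shows "cap_term scale N M P p q 0 0 0 f' (pure_tensor M (Wsp (nu N q)) m w) = capmap m w"
proof -
  let ?Y = "tensor_product M (Wsp (nu N q))"
  have WV: "w \<in> V (a + b)" if "w \<in> W (nu N q)" for w
    using subsetD[OF koszul_W_subset that] unfolding additive .
  have cw: "cap_on_words scale N M P p q 0 0 0 f' m w = capmap m w"
    if "m \<in> carrier M" "w \<in> W (nu N q)" for m w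
    using that W_subset_cap_domain by (simp add: cap_on_words_eq subset_iff)
  obtain g where g: "g \<in> linear_maps ?Y C'"
    "\<And>m w. m \<in> carrier M \<Longrightarrow> w \<in> carrier (Wsp (nu N q)) \<Longrightarrow> g (pure_tensor M (Wsp (nu N q)) m w) = capmap m w"
  proof (rule chains.tensor_product_lift[OF C'K.kspace_axioms, of capmap])
    show "(\<lambda>m. capmap m w) \<in> linear_maps M C'" if "w \<in> carrier (Wsp (nu N q))" for w
      using that by (intro capmap_linear_left WV) simp
    show "capmap m \<in> linear_maps (Wsp (nu N q)) C'" if "m \<in> carrier M" for m
      unfolding koszul_space_def[of scale N "nu N q"]
      by (rule linear_restrict_domain[OF capmap_linear[OF that]]) (use W_carrier in blast)
  qed blast
  have "cap_term scale N M P p q 0 0 0 f' = restrict g (carrier ?Y)"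
    unfolding cap_term_def
  proof (rule the_linear_map_eq[OF chains.kspace_tensor_product g(1)])
    show "\<forall>m\<in>carrier M. \<forall>w\<in>W (nu N q). restrict g (carrier ?Y) (pure_tensor M (Wsp (nu N q)) m w)
        = cap_on_words scale N M P p q 0 0 0 f' m w"
      using g(2) cw chains.pure_tensor_closed by simp
    fix h t assume h: "h \<in> linear_maps ?Y C'"
      "\<forall>m\<in>carrier M. \<forall>w\<in>W (nu N q). h (pure_tensor M (Wsp (nu N q)) m w) = cap_on_words scale N M P p q 0 0 0 f' m w"
      and t: "t \<in> carrier ?Y"
    show "h t = g t"
      by (rule chains.tensor_product_eqI[OF C'K.kspace_axioms h(1) g(1) _ t]) (use h(2) g(2) cw in simp)
  qed
  then show ?thesis using g(2) m w chains.pure_tensor_closed by simp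
qed

lemma koszul_cap_pure:
  assumes m: "m \<in> carrier M" and w: "w \<in> W (nu N q)"
  shows "koszul_cap scale N M P p q (pure_tensor M (Wsp (nu N q)) m w) f' = (- 1) ^ (q * p) \<odot>\<^bsub>C'\<^esub> capmap m w"
proof (cases "odd p \<and> odd (q - p)")
  case True
  have "nu N (p + (q - p)) = nu N p + nu N (q - p)" using additive le by simp
  then have N2: "N = 2" using nu_additive_odd True by blast
  have "even q" using True le by simp
  then have sign: "(- 1 :: 'k) ^ (q * p) = 1" by simp
  have closed: "capmap m w \<in> carrier C'" by (rule linear_closed[OF capmap_linear[OF m] W_carrier[OF w]])
  have "koszul_cap scale N M P p q (pure_tensor M (Wsp (nu N q)) m w) f'
    = (\<Oplus>\<^bsub>C'\<^esub>i\<in>{..N - 2}. \<Oplus>\<^bsub>C'\<^esub>j\<in>{..N - 2 - i}.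
        cap_term scale N M P p q i (N - 2 - i - j) j f' (pure_tensor M (Wsp (nu N q)) m w))"
    unfolding koszul_cap_def Let_def if_P[OF True] ..
  also have "\<dots> = (\<Oplus>\<^bsub>C'\<^esub>i\<in>{0::nat}. \<Oplus>\<^bsub>C'\<^esub>j\<in>{0::nat}. capmap m w)"
  proof (rule C'K.finsum_cong')
    show "{..N - 2} = {0}" using N2 by auto
    fix i :: nat assume "i \<in> {0}"
    then have i: "i = 0" by simp
    show "(\<Oplus>\<^bsub>C'\<^esub>j\<in>{..N - 2 - i}. cap_term scale N M P p q i (N - 2 - i - j) j f' (pure_tensor M (Wsp (nu N q)) m w))
      = (\<Oplus>\<^bsub>C'\<^esub>j\<in>{0::nat}. capmap m w)"
    proof (rule C'K.finsum_cong')
      show "{..N - 2 - i} = {0}" using N2 by auto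
      fix j :: nat assume "j \<in> {0}"
      then have "j = 0" "N - 2 - i - j = 0" using N2 by simp_all
      then show "cap_term scale N M P p q i (N - 2 - i - j) j f' (pure_tensor M (Wsp (nu N q)) m w) = capmap m w"
        unfolding i using cap_term_pure[OF m w] by (simp only: diff_zero)
    qed (use closed in auto)
  qed (use closed in auto)
  also have "\<dots> = capmap m w" using closed by simp
  finally show ?thesis using closed sign by simp
next
  case False
  show ?thesis
    unfolding koszul_cap_def Let_def if_not_P[OF False] cap_term_pure[OF m w]
    by (simp only: mult.commute)
qed

lemma capmap_Ant:
  assumes m: "m \<in> carrier M"
  shows "capmap m (Ant scale (a + b) (tw (wd (a + b) x)))
    = (\<Oplus>\<^bsub>C'\<^esub>\<tau>\<in>shuffle_perms a b. of_int (sign \<tau>) \<odot>\<^bsub>C'\<^esub>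
        pure' (pure_over m (f (wedge scale (wd a (x \<circ> \<tau>)))))
          (\<phi> b (wedge scale (wd b (\<lambda>j. x (\<tau> (a + j)))))))"
proof -
  let ?s = "\<lambda>\<tau>. Ant scale a (tw (wd a (x \<circ> \<tau>)))" and ?t = "\<lambda>\<tau>. Ant scale b (tw (wd b (\<lambda>j. x (\<tau> (a + j)))))"
  have sV: "?s \<tau> \<in> V a" and tV: "?t \<tau> \<in> V b" for \<tau>
    by (intro Ant_in_power tensor_word_in_power length_wd)+
  then have st: "?s \<tau> \<otimes>\<^bsub>T\<^esub> ?t \<tau> \<in> carrier T" for \<tau>
    using tensor_power_subset by (blast intro: T.m_closed)
  have eval_at: "capmap m (of_int (sign \<tau>) \<odot>\<^bsub>T\<^esub> (?s \<tau> \<otimes>\<^bsub>T\<^esub> ?t \<tau>)) = of_int (sign \<tau>) \<odot>\<^bsub>C'\<^esub>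
        pure' (pure_over m (f (wedge scale (wd a (x \<circ> \<tau>)))))
          (\<phi> b (wedge scale (wd b (\<lambda>j. x (\<tau> (a + j))))))" for \<tau>
    unfolding linear_smult[OF capmap_linear[OF m] st] capmap_mult[OF m sV tV] K_def
    by (simp only: increasing_part_Ant length_wd)
  have "capmap m (Ant scale (a + b) (tw (wd (a + b) x)))
    = (\<Oplus>\<^bsub>C'\<^esub>\<tau>\<in>shuffle_perms a b. capmap m (of_int (sign \<tau>) \<odot>\<^bsub>T\<^esub> (?s \<tau> \<otimes>\<^bsub>T\<^esub> ?t \<tau>)))"
    unfolding Ant_shuffle
    by (rule linear_finsum[OF capmap_linear[OF m] T.kspace_axioms C'K.kspace_axioms]) (use st in auto)
  then show ?thesis unfolding eval_at .
qed

text \<open>Applying \<open>id \<otimes> \<phi>\<close> to the right-hand side gives the cap product of the chain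
  \<open>m \<otimes> \<phi>(x\<^sub>1 \<and> \<dots>)\<close>; injectivity of \<open>id \<otimes> \<phi>\<close> then identifies the inverse image.\<close>

theorem koszul_cap_ext_wedge:
  assumes m: "m \<in> carrier M"
  shows "koszul_cap_ext scale N n e M P p q (pure_tensor M (E (nu N q)) m (wedge scale (wd (a + b) x))) f
    = (- 1) ^ (q * p) \<odot>\<^bsub>C\<^esub> (\<Oplus>\<^bsub>C\<^esub>\<tau>\<in>shuffle_perms a b. of_int (sign \<tau>) \<odot>\<^bsub>C\<^esub>
        pure_tensor MP (E b) (pure_over m (f (wedge scale (wd a (x \<circ> \<tau>)))))
          (wedge scale (wd b (\<lambda>j. x (\<tau> (a + j))))))"
    (is "_ = (- 1) ^ (q * p) \<odot>\<^bsub>C\<^esub> (\<Oplus>\<^bsub>C\<^esub>\<tau>\<in>_. of_int (sign \<tau>) \<odot>\<^bsub>C\<^esub> ?t \<tau>)")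
proof -
  let ?I = "id_tensor_map MP (E b) (Wsp b) (\<phi> b)"
  let ?R = "(- 1) ^ (q * p) \<odot>\<^bsub>C\<^esub> (\<Oplus>\<^bsub>C\<^esub>\<tau>\<in>shuffle_perms a b. of_int (sign \<tau>) \<odot>\<^bsub>C\<^esub> ?t \<tau>)"
  let ?w = "Ant scale (nu N q) (tw (wd (nu N q) x))"
  note I = id_tensor_map_linear[OF kspace_MP kspace_exterior_power kspace_Wsp phi_Wsp]
  have po: "pure_over m (f (wedge scale (wd a y))) \<in> carrier MP" for y
    by (intro linear_closed[OF over(3)[OF m]] linear_closed[OF f] wedge_in_power length_wd)
  have wb: "wedge scale (wd b y) \<in> carrier (E b)" for y by (intro wedge_in_power length_wd)
  have t: "?t \<tau> \<in> carrier C" for \<tau> by (rule C.pure_tensor_closed[OF po wb])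
  then have ts: "(\<lambda>\<tau>. of_int (sign \<tau>) \<odot>\<^bsub>C\<^esub> ?t \<tau>) \<in> shuffle_perms a b \<rightarrow> carrier C" by blast
  have sum: "(\<Oplus>\<^bsub>C\<^esub>\<tau>\<in>shuffle_perms a b. of_int (sign \<tau>) \<odot>\<^bsub>C\<^esub> ?t \<tau>) \<in> carrier C"
    by (rule CK.finsum_closed[OF ts])
  have "?I ?R = (- 1) ^ (q * p) \<odot>\<^bsub>C'\<^esub> (\<Oplus>\<^bsub>C'\<^esub>\<tau>\<in>shuffle_perms a b. ?I (of_int (sign \<tau>) \<odot>\<^bsub>C\<^esub> ?t \<tau>))"
    unfolding linear_smult[OF I(1) sum]
    by (simp only: linear_finsum[OF I(1) CK.kspace_axioms C'K.kspace_axioms ts])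
  also have "\<dots> = (- 1) ^ (q * p) \<odot>\<^bsub>C'\<^esub> capmap m (Ant scale (a + b) (tw (wd (a + b) x)))"
    unfolding capmap_Ant[OF m] linear_smult[OF I(1) t] I(2)[OF po wb] ..
  finally have IR: "?I ?R = (- 1) ^ (q * p) \<odot>\<^bsub>C'\<^esub> capmap m ?w" unfolding additive .
  have w: "?w \<in> W (nu N q)"
    unfolding W_eq by (intro imageI tensor_word_in_power length_wd)
  have "id_tensor_map M (E (nu N q)) (Wsp (nu N q)) (\<phi> (nu N q))
      (pure_tensor M (E (nu N q)) m (wedge scale (wd (a + b) x))) = pure_tensor M (Wsp (nu N q)) m ?w"
    unfolding additive[symmetric]
    using id_tensor_map_linear(2)[OF MK.kspace_axioms kspace_exterior_power kspace_Wsp phi_Wsp m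
        wedge_in_power[OF length_wd]] phi_wedge[OF length_wd] by metis
  then have "koszul_cap_ext scale N n e M P p q (pure_tensor M (E (nu N q)) m (wedge scale (wd (a + b) x))) f
      = inv_into (carrier C) ?I (?I ?R)"
    unfolding koszul_cap_ext_def Let_def IR by (simp only: koszul_cap_pure[OF m w])
  also have "\<dots> = ?R"
  proof (rule inv_into_f_f)
    show "inj_on ?I (carrier C)"
      by (rule id_tensor_map_inj[OF kspace_MP kspace_exterior_power kspace_Wsp phi_Wsp _ increasing_part_phi])
        (use linear_restrict_domain[OF increasing_part_linear, of "W b"] W_carrier in \<open>auto simp: koszul_space_def\<close>)
    show "?R \<in> carrier C" by (rule CK.smult_in[OF sum])
  qed
  finally show ?thesis .
qed

end

theorem mainTheorem5:
  fixes scale :: "'k::field \<Rightarrow> 'v::ab_group_add \<Rightarrow> 'v"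
    and e :: "nat \<Rightarrow> 'v"
    and n N p q :: nat
    and M :: "('k, 'v, 'm) sym_bimodule"
    and P :: "('k, 'v, 'p) sym_bimodule"
    and f :: "('k, 'v) tensor set \<Rightarrow> 'p"
    and m :: 'm
    and s :: "nat \<Rightarrow> nat"
    and x :: "nat \<Rightarrow> 'v"
  assumes "n \<ge> 2"
    and "finite_dimensional_vector_space scale (e ` {1..n})" and "inj_on e {1..n}"
    and "2 \<le> N" and "N \<le> n"
    and "algebra_bimodule (sym_algebra scale N) M"
    and "algebra_bimodule (sym_algebra scale N) P"
    and "p \<le> q" and "nu N (q - p) = nu N q - nu N p"
    and "f \<in> linear_maps (exterior_power scale (nu N p)) P"
    and "m \<in> carrier M"
    and "strict_mono_on {1..nu N q} s" and "s ` {1..nu N q} \<subseteq> {1..n}"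
    and "\<And>j. j \<in> {1..nu N q} \<Longrightarrow> x j = e (s j)"
  defines "MP \<equiv> tensor_product_over (sym_algebra scale N) M P"
    and "E \<equiv> exterior_power scale"
  defines "C \<equiv> tensor_product MP (E (nu N (q - p)))"
  shows "koszul_cap_ext scale N n e M P p q
           (pure_tensor M (E (nu N q)) m (wedge scale (map x [1..<Suc (nu N q)]))) f
         = (- 1) ^ (q * p) \<odot>\<^bsub>C\<^esub>
           (\<Oplus>\<^bsub>C\<^esub> \<sigma> \<in> shuffle_perms (nu N p) (nu N (q - p)).
              of_int (sign \<sigma>) \<odot>\<^bsub>C\<^esub>
              pure_tensor MP (E (nu N (q - p)))
                (pure_tensor_over (sym_algebra scale N) M P m
                   (f (wedge scale (map (\<lambda>j. x (\<sigma> j)) [1..<Suc (nu N p)]))))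
                (wedge scale (map (\<lambda>j. x (\<sigma> j)) [Suc (nu N p)..<Suc (nu N q)])))"
proof -
  have "nu N p \<le> nu N q" by (rule nu_mono) (use assms(4,8) in simp_all)
  then have add: "nu N q = nu N p + nu N (q - p)" using assms(9) by simp
  interpret cap_setting scale e n N p q M P f
    by (intro cap_setting.intro based_tensors.intro based_tensors_axioms.intro cap_setting_axioms.intro
        assms(2,3,4,6,7,8,10) add)
  have first: "map (\<lambda>j. x (\<sigma> j)) [1..<Suc (nu N p)] = wd (nu N p) (x \<circ> \<sigma>)" for \<sigma>
    by (simp add: wd_def)
  have second: "map (\<lambda>j. x (\<sigma> j)) [Suc (nu N p)..<Suc (nu N q)]
      = wd (nu N (q - p)) (\<lambda>j. x (\<sigma> (nu N p + j)))" for \<sigma>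
    by (rule nth_equalityI) (use add in \<open>auto simp del: upt_Suc\<close>)
  have all: "map x [1..<Suc (nu N q)] = wd (nu N p + nu N (q - p)) x"
    unfolding wd_def add[symmetric] ..
  show ?thesis
    unfolding C_def E_def MP_def first second all
    by (rule koszul_cap_ext_wedge[OF assms(11)])
qed

end
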